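(* Define, for every integer $n \ge 11$, \[ g(n) = \begin{cases} \lfloor \frac{n}{6}\rfloor, & n \equiv 0,1,4 \pmod 6,\\ \lfloor \frac{n}{6}\rfloor - 1, & n \equiv 2,3 \pmod 6,\\ \lfloor \frac{n}{6}\rfloor + 1, & n \equiv 5 \pmod 6.\end{cases} \] Then for every integer $n \ge 11$, the maximum number of triangles in an $n$-vertex $P_6^2$-free graph is \[ \mathrm{ex}(n, K_3, P_6^2) = \left\lfloor \frac{n^2}{4} \right\rfloor + g(n). \] Moreover, the extremal graphs (the $n$-vertex $P_6^2$-free graphs with exactly $\mathrm{ex}(n,K_3,P_6^2)$ triangles) are, up to isomorphism, exactly the following: \begin{itemize} \item when $n \equiv 0,1 \pmod 6$, the graph $H_n^{\lfloor n/2 \rfloor}$; \item when $n \equiv 2 \pmod 6$, the graph $H_n^{\lfloor n/2 \rfloor - 1}$; \item when $n \equiv 3,4 \pmod 6$, the graph $H_n^{\lceil n/2 \rceil + 1}$; \item when $n \equiv 5 \pmod 6$, the graph $H_n^{\lceil n/2 \rceil}$. \end{itemize}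
   Context: All graphs are finite, simple and undirected. $P_6^2$ (the square of the path on $6$ vertices) is the graph on vertices $v_1,\dots,v_6$ in which $v_iv_j$ is an edge if and only if $1 \le |i-j| \le 2$. A graph is $P_6^2$-free if it contains no (not necessarily induced) subgraph isomorphic to $P_6^2$. $\mathrm{ex}(n,K_3,P_6^2)$ denotes the maximum number of triangles (subgraphs isomorphic to $K_3$) in an $n$-vertex $P_6^2$-free graph. For $i$ divisible by $3$ with $0< i < n$, $H_n^i$ is the $n$-vertex graph obtained from the complete bipartite graph $K_{i,n-i}$ by adding $i/3$ pairwise vertex-disjoint triangles inside the class $X$ of size $i$ (so that these triangles cover $X$); the class of size $n-i$ remains independent. *)

theory Defs
  imports "Graph_Theory.Graph_Theory"
begin

text \<open>A finite simple undirected graph is a \<^locale>\<open>pair_graph\<close>: a finite loop-free symmetric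
  digraph without parallel arcs, each edge being represented by its two opposite arcs.\<close>

definition square_path6 :: "nat pair_pre_digraph" where
  "square_path6 = \<lparr> pverts = {1..6},
     parcs = {(i, j). i \<in> {1..6} \<and> j \<in> {1..6} \<and> 1 \<le> \<bar>int i - int j\<bar> \<and> \<bar>int i - int j\<bar> \<le> 2} \<rparr>"

definition free_of :: "'b pair_pre_digraph \<Rightarrow> 'a pair_pre_digraph \<Rightarrow> bool" where
  "free_of F G \<longleftrightarrow>
     \<not> (\<exists>H :: 'a pair_pre_digraph. subgraph (with_proj H) (with_proj G) \<and>
           digraph_iso (with_proj F) (with_proj H))"

definition num_triangles :: "'a pair_pre_digraph \<Rightarrow> nat" where
  "num_triangles G =
     card {T :: 'a pair_pre_digraph. subgraph (with_proj T) (with_proj G) \<and>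
             complete_digraph 3 (with_proj T)}"

definition graph_on :: "nat \<Rightarrow> 'a pair_pre_digraph \<Rightarrow> bool" where
  "graph_on n G \<longleftrightarrow> pair_graph G \<and> card (pverts G) = n"

text \<open>The maximum ranges over graphs with vertices in \<^typ>\<open>nat\<close>, which represent every finite
  graph up to isomorphism.\<close>

definition ex_K3 :: "nat \<Rightarrow> 'b pair_pre_digraph \<Rightarrow> nat" where
  "ex_K3 n F = Max {num_triangles G | G :: nat pair_pre_digraph. graph_on n G \<and> free_of F G}"

definition extremal_K3 :: "nat \<Rightarrow> 'b pair_pre_digraph \<Rightarrow> 'a pair_pre_digraph \<Rightarrow> bool" where
  "extremal_K3 n F G \<longleftrightarrow> graph_on n G \<and> free_of F G \<and> num_triangles G = ex_K3 n F"

text \<open>The classes are \<open>X = {0..<i}\<close> and \<open>Y = {i..<n}\<close>; the triangles inside \<open>X\<close> are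
  \<open>{3k, 3k+1, 3k+2}\<close>. Meaningful for \<open>3 dvd i\<close> and \<open>0 < i < n\<close>.\<close>

definition H_graph :: "nat \<Rightarrow> nat \<Rightarrow> nat pair_pre_digraph" where
  "H_graph n i = (let X = {0..<i}; Y = {i..<n} in
     \<lparr> pverts = X \<union> Y,
       parcs = X \<times> Y \<union> Y \<times> X \<union> {(u, v). u \<in> X \<and> v \<in> X \<and> u \<noteq> v \<and> u div 3 = v div 3} \<rparr>)"

definition g :: "nat \<Rightarrow> int" where
  "g n = (if n mod 6 \<in> {0, 1, 4} then int (n div 6)
          else if n mod 6 \<in> {2, 3} then int (n div 6) - 1
          else int (n div 6) + 1)"

end

theory Submission
  imports Defs
begin

text \<open>In the graph of triangles, a squared path on six vertices is a tight path of four triangles.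
  Forbidding it makes triangles sharing edges very rigid. A \<open>K\<^sub>5\<close> shares no edge with another
  triangle. Every triangle outside the \<open>K\<^sub>5\<close>s either has an edge lying in no other triangle, or is a
  core \<open>T\<close>, or consists of a common neighbour of a core \<open>T\<close> and two vertices of \<open>T\<close>. Charging triangles
  of the first kind to such an edge, and those of the third kind to the edges between \<open>T\<close> and its common
  neighbours, gives a triangle-free graph \<open>E\<close> such that the number of triangles is at most
  \<open>|E| + #cores + 10 #K\<^sub>5\<close>.

  This quantity is bounded by induction: large cliques, or two cores sharing a vertex, contain vertices
  of small total degree, which are deleted. If the cores are disjoint, then \<open>E\<close> is so close to the
  Mantel bound that it is bipartite with all cores in one class, and the charged edges force
  the cores to cover that class.\<close>

section \<open>Clique systems\<close>

text \<open>Inside a K4 no edge is private to one triangle, so its four triangles need another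
  charge: one is the core \<open>T\<close>, the other three go to the three edges joining the fourth
  vertex to \<open>T\<close>. Thus an edge of \<open>E\<close> pays for one triangle, and only cores
  and the triangles of K5s come on top. In the counting, the forbidden graph acts mainly through
  \<open>near\<close> and \<open>own\<close>. The sharp value cannot be carried through an induction
  on deletions: \<open>g\<close> is not monotone, and small systems such as a single K5 exceed it.
  So bounds of increasing strength are used: \<open>crude\<close> for all systems,
  \<open>relaxed_max\<close> plus 2 for systems of triples, and the sharp value only from 11
  vertices on, where one deletion followed by a weaker bound already falls short of it. Since
  \<open>relaxed_max\<close> exceeds the sharp value by at most 1, the graph \<open>E\<close> of an
  extremal graph lacks at most one edge of a complete bipartite graph, while a vertex of the class
  of the cores that lies in no core would cause two missing edges.\<close>

text \<open>\<open>E\<close> holds the edges charged to triangles and \<open>\<K>\<close> the cores and the \<open>K\<^sub>5\<close>s. Cliques of all sizes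
  from 3 to 5 are admitted because the system has to be closed under the deletion of vertices.\<close>

locale clique_system =
  fixes V :: "'a set" and E :: "('a \<times> 'a) set" and \<K> :: "'a set set"
  assumes finite_V: "finite V"
    and E_sub: "E \<subseteq> V \<times> V"
    and E_sym: "(x, y) \<in> E \<Longrightarrow> (y, x) \<in> E"
    and triangle_free: "(x, y) \<in> E \<Longrightarrow> (y, z) \<in> E \<Longrightarrow> (x, z) \<notin> E"
    and K_sub: "K \<in> \<K> \<Longrightarrow> K \<subseteq> V"
    and K_ge3: "K \<in> \<K> \<Longrightarrow> 3 \<le> card K"
    and K_le5: "K \<in> \<K> \<Longrightarrow> card K \<le> 5"
    and K_indep: "K \<in> \<K> \<Longrightarrow> x \<in> K \<Longrightarrow> y \<in> K \<Longrightarrow> (x, y) \<notin> E"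
    and K_share: "K \<in> \<K> \<Longrightarrow> L \<in> \<K> \<Longrightarrow> K \<noteq> L \<Longrightarrow> x \<in> K \<Longrightarrow> x \<in> L \<Longrightarrow> y \<in> K \<Longrightarrow> y \<in> L \<Longrightarrow> x = y"
    and near: "K \<in> \<K> \<Longrightarrow> v \<notin> K \<Longrightarrow> x \<in> K \<Longrightarrow> y \<in> K \<Longrightarrow> x \<noteq> y \<Longrightarrow>
      (v, x) \<in> E \<or> (\<exists>L\<in>\<K>. v \<in> L \<and> x \<in> L) \<Longrightarrow>
      (v, y) \<in> E \<or> (\<exists>L\<in>\<K>. v \<in> L \<and> y \<in> L) \<Longrightarrow> card K = 3 \<and> K \<subseteq> E `` {v}"
    and own: "K \<in> \<K> \<Longrightarrow> L \<in> \<K> \<Longrightarrow> K \<noteq> L \<Longrightarrow> a \<in> K \<Longrightarrow> K \<subseteq> E `` {y} \<Longrightarrow>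
      b \<in> L \<Longrightarrow> L \<subseteq> E `` {z} \<Longrightarrow> {a, y} \<noteq> {b, z}"
begin

lemma finite_E: "finite E"
  using E_sub finite_V by (meson finite_SigmaI finite_subset)

lemma finite_nbrs [simp]: "finite (E `` {v})"
  using finite_E by (rule finite_Image)

lemma finite_cliques: "finite \<K>"
  using K_sub finite_V by (meson PowI finite_Pow_iff finite_subset subsetI)

lemma finite_clique: "K \<in> \<K> \<Longrightarrow> finite K"
  using K_sub finite_V finite_subset by blast

text \<open>Twice the bound on the number of triangles, since \<open>E\<close> contains both arcs of an edge.\<close>

definition weight2 :: nat where
  "weight2 = card E + 2 * (\<Sum>K\<in>\<K>. card K choose 3)"

text \<open>The neighbourhood in the graph formed by \<open>E\<close> and all pairs inside cliques.
  \<open>near\<close> treats both kinds of adjacency alike, so degrees are estimated here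
  first.\<close>

definition dnbrs :: "'a \<Rightarrow> 'a set" where
  "dnbrs v = E `` {v} \<union> (\<Union>{K \<in> \<K>. v \<in> K} - {v})"

lemma in_dnbrs: "x \<in> dnbrs v \<longleftrightarrow> (v, x) \<in> E \<or> x \<noteq> v \<and> (\<exists>K\<in>\<K>. v \<in> K \<and> x \<in> K)"
  unfolding dnbrs_def by auto

lemma irrefl: "(x, x) \<notin> E"
  using triangle_free by blast

lemma dnbrs_sym: "x \<in> dnbrs v \<longleftrightarrow> v \<in> dnbrs x"
  unfolding in_dnbrs using E_sym by blast

lemma dnbrs_sub: "dnbrs v \<subseteq> V"
  unfolding dnbrs_def using E_sub K_sub by blast

lemma near': "K \<in> \<K> \<Longrightarrow> v \<notin> K \<Longrightarrow> x \<in> K \<Longrightarrow> y \<in> K \<Longrightarrow> x \<in> dnbrs v \<Longrightarrow> y \<in> dnbrs v \<Longrightarrow>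
    x = y \<or> card K = 3 \<and> K \<subseteq> E `` {v}"
  using near unfolding in_dnbrs by blast

end

section \<open>Deleting vertices from a clique system\<close>

abbreviation restrE :: "('a \<times> 'a) set \<Rightarrow> 'a set \<Rightarrow> ('a \<times> 'a) set" where
  "restrE E S \<equiv> E \<inter> (- S) \<times> (- S)"

text \<open>A clique is truncated, not dropped, as long as a triangle remains; a K5 losing one
  vertex still counts with the 4 triangles of a K4.\<close>

abbreviation restrK :: "'a set set \<Rightarrow> 'a set \<Rightarrow> 'a set set" where
  "restrK \<K> S \<equiv> {K - S | K. K \<in> \<K> \<and> 3 \<le> card (K - S)}"

context clique_system
begin

text \<open>Used to reindex sums over truncated cliques: three remaining vertices determine the
  clique, because distinct cliques share at most one vertex.\<close>

lemma restrK_inj: "inj_on (\<lambda>K. K - S) {K \<in> \<K>. 3 \<le> card (K - S)}"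
proof (rule inj_onI, rule ccontr)
  fix K L assume *: "K \<in> {K \<in> \<K>. 3 \<le> card (K - S)}" "L \<in> {K \<in> \<K>. 3 \<le> card (K - S)}"
    "K - S = L - S" "K \<noteq> L"
  have "finite (K - S)" using * finite_clique by auto
  then obtain x y where "x \<in> K - S" "y \<in> K - S" "x \<noteq> y"
    using * by (metis (no_types, lifting) card_le_Suc0_iff_eq mem_Collect_eq not_less_eq_eq
        numeral_3_eq_3 Suc_leD)
  with * show False using K_share[of K L x y] by blast
qed

text \<open>Two vertices of the trace suffice to apply \<open>near\<close> to the original clique.
  It is therefore a triple, and a triple with three vertices left has lost none.\<close>

lemma card_restr_full:
  assumes "K \<in> \<K>" "3 \<le> card (K - S)" "K - S \<subseteq> E `` {v}"
  shows "card K = 3 \<and> K - S = K \<and> v \<notin> K"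
proof -
  have fin: "finite K" using assms finite_clique by auto
  obtain x y where xy: "x \<in> K - S" "y \<in> K - S" "x \<noteq> y"
    using assms(2) fin by (metis card_le_Suc0_iff_eq finite_Diff not_less_eq_eq numeral_3_eq_3 Suc_leD)
  have v: "v \<notin> K" using K_indep[OF assms(1), of v x] xy assms(3) by blast
  have "card K = 3" using near[OF assms(1) v, of x y] xy assms(3) by blast
  moreover have "K - S = K" using calculation assms(2) fin by (metis Diff_subset card_seteq)
  ultimately show ?thesis using v by blast
qed

text \<open>The delicate conditions are \<open>near\<close> and \<open>own\<close>. Both concern a
  vertex joined by \<open>E\<close> to a whole clique; such a clique is a triple and survives only
  untruncated, so the conditions for the original system apply.\<close>

lemma restr: "clique_system (V - S) (restrE E S) (restrK \<K> S)"
proof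
  show "finite (V - S)" using finite_V by blast
  show "restrE E S \<subseteq> (V - S) \<times> (V - S)" using E_sub by blast
  show "(y, x) \<in> restrE E S" if "(x, y) \<in> restrE E S" for x y using that E_sym by blast
  show "(x, z) \<notin> restrE E S" if "(x, y) \<in> restrE E S" "(y, z) \<in> restrE E S" for x y z
    using that triangle_free by blast
  show "K \<subseteq> V - S" if "K \<in> restrK \<K> S" for K using that K_sub by blast
  show "3 \<le> card K" if "K \<in> restrK \<K> S" for K using that by blast
  show "card K \<le> 5" if K: "K \<in> restrK \<K> S" for K
  proof -
    obtain K' where "K' \<in> \<K>" "K = K' - S" using K by blast
    then show ?thesis using K_le5[of K'] finite_clique[of K'] card_mono[of K' "K' - S"] by force
  qed
  show "(x, y) \<notin> restrE E S" if "K \<in> restrK \<K> S" "x \<in> K" "y \<in> K" for K x y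
    using that K_indep by blast
  show "x = y" if "K \<in> restrK \<K> S" "L \<in> restrK \<K> S" "K \<noteq> L" "x \<in> K" "x \<in> L" "y \<in> K" "y \<in> L" for K L x y
    using that K_share by blast
  show "card K = 3 \<and> K \<subseteq> restrE E S `` {v}" if K: "K \<in> restrK \<K> S" "v \<notin> K" "x \<in> K" "y \<in> K" "x \<noteq> y"
    "(v, x) \<in> restrE E S \<or> (\<exists>L\<in>restrK \<K> S. v \<in> L \<and> x \<in> L)"
    "(v, y) \<in> restrE E S \<or> (\<exists>L\<in>restrK \<K> S. v \<in> L \<and> y \<in> L)" for K v x y
  proof -
    obtain K' where K': "K' \<in> \<K>" "K = K' - S" "3 \<le> card K" using K(1) by blast
    have vS: "v \<notin> S" using K(6) by blast
    then have v: "v \<notin> K'" using K K' by blast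
    have "card K' = 3 \<and> K' \<subseteq> E `` {v}"
      using near[OF K'(1) v, of x y] K(3-7) K'(2) by blast
    moreover from this have "K = K'" using K' finite_clique by (metis Diff_subset card_seteq)
    ultimately show ?thesis using vS K' by blast
  qed
  show "{a, y} \<noteq> {b, z}" if *: "K \<in> restrK \<K> S" "L \<in> restrK \<K> S" "K \<noteq> L" "a \<in> K" "K \<subseteq> restrE E S `` {y}"
    "b \<in> L" "L \<subseteq> restrE E S `` {z}" for K L a b y z
  proof -
    obtain K' where K': "K' \<in> \<K>" "K = K' - S" "3 \<le> card K" using *(1) by blast
    obtain L' where L': "L' \<in> \<K>" "L = L' - S" "3 \<le> card L" using *(2) by blast
    have "K = K'" using card_restr_full[of K' S y] K' *(5) by blast
    moreover have "L = L'" using card_restr_full[of L' S z] L' *(7) by blast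
    ultimately show ?thesis using own[of K L a y b z] * K' L' by blast
  qed
qed

lemma sum_restrK:
  "(\<Sum>L\<in>restrK \<K> S. card L choose 3) = (\<Sum>K\<in>\<K>. card (K - S) choose 3)"
proof -
  have "restrK \<K> S = (\<lambda>K. K - S) ` {K \<in> \<K>. 3 \<le> card (K - S)}" by blast
  then have "(\<Sum>L\<in>restrK \<K> S. card L choose 3) = (\<Sum>K\<in>{K \<in> \<K>. 3 \<le> card (K - S)}. card (K - S) choose 3)"
    using sum.reindex[OF restrK_inj] by simp
  also have "\<dots> = (\<Sum>K\<in>\<K>. card (K - S) choose 3)"
    by (rule sum.mono_neutral_left) (auto simp: finite_cliques intro: binomial_eq_0)
  finally show ?thesis .
qed

lemma weight2_restr:
  assumes "S \<subseteq> V"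
  shows "weight2 \<le> clique_system.weight2 (restrE E S) (restrK \<K> S) + 2 * (\<Sum>v\<in>S. card (E `` {v}))
    + 2 * (\<Sum>K\<in>\<K>. (card K choose 3) - (card (K - S) choose 3))"
proof -
  interpret R: clique_system "V - S" "restrE E S" "restrK \<K> S" by (rule restr)
  have finS: "finite S" using assms finite_V finite_subset by blast
  let ?O = "SIGMA v:S. E `` {v}"
  \<comment> \<open>Arcs with both ends in \<open>S\<close> occur in both \<open>?O\<close> and its
    converse; only an upper bound on the loss is wanted.\<close>
  have "E \<subseteq> restrE E S \<union> ?O \<union> ?O\<inverse>" using E_sym by auto
  moreover have "finite ?O" using finS by simp
  ultimately have "card E \<le> card (restrE E S \<union> ?O \<union> ?O\<inverse>)"
    using R.finite_E by (intro card_mono) auto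
  also have "\<dots> \<le> card (restrE E S) + card ?O + card (?O\<inverse>)"
    by (meson card_Un_le add_le_mono order_refl order_trans)
  also have "card (?O\<inverse>) = card ?O" by (rule card_inverse)
  also have "card ?O = (\<Sum>v\<in>S. card (E `` {v}))" using finS by simp
  finally have 1: "card E \<le> card (restrE E S) + 2 * (\<Sum>v\<in>S. card (E `` {v}))" by simp
  have "(\<Sum>K\<in>\<K>. card K choose 3) \<le> (\<Sum>K\<in>\<K>. (card (K - S) choose 3) + ((card K choose 3) - (card (K - S) choose 3)))"
    by (rule sum_mono) simp
  then have 2: "(\<Sum>K\<in>\<K>. card K choose 3) \<le> (\<Sum>L\<in>restrK \<K> S. card L choose 3) +
     (\<Sum>K\<in>\<K>. (card K choose 3) - (card (K - S) choose 3))"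
    by (simp add: sum.distrib sum_restrK)
  show ?thesis unfolding weight2_def R.weight2_def using 1 2 by simp
qed

end

section \<open>Degree sums and Mantel's bound\<close>

lemma mult_le_square_div_4: "(a::nat) * b \<le> (a + b)\<^sup>2 div 4"
proof -
  have "4 * (int a * int b) \<le> (int a + int b)\<^sup>2"
    using zero_le_power2[of "int a - int b"] by (simp add: power2_eq_square algebra_simps)
  then have "4 * (a * b) \<le> (a + b)\<^sup>2" by (metis (mono_tags) of_nat_add of_nat_mult of_nat_numeral of_nat_power of_nat_le_iff)
  then show ?thesis by simp
qed

context clique_system
begin

lemma card_E_split:
  assumes "X \<union> Y = V" "X \<inter> Y = {}" "E \<inter> X \<times> X = {}"
  shows "card E = 2 * card (E \<inter> X \<times> Y) + card (E \<inter> Y \<times> Y)"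
    and "(\<Sum>y\<in>Y. card (E `` {y})) = card (E \<inter> X \<times> Y) + card (E \<inter> Y \<times> Y)"
proof -
  have E: "E = (E \<inter> X \<times> Y) \<union> (E \<inter> Y \<times> X) \<union> (E \<inter> Y \<times> Y)" using E_sub assms by blast
  have conv: "E \<inter> Y \<times> X = (E \<inter> X \<times> Y)\<inverse>" using E_sym by blast
  have eq: "card (E \<inter> Y \<times> X) = card (E \<inter> X \<times> Y)" unfolding conv by (rule card_inverse)
  have "card E = card ((E \<inter> X \<times> Y) \<union> (E \<inter> Y \<times> X)) + card (E \<inter> Y \<times> Y)"
    using assms(2) by (subst E, subst card_Un_disjoint) (auto simp: finite_E)
  also have "card ((E \<inter> X \<times> Y) \<union> (E \<inter> Y \<times> X)) = card (E \<inter> X \<times> Y) + card (E \<inter> Y \<times> X)"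
    using assms(2) by (subst card_Un_disjoint) (auto simp: finite_E)
  finally show "card E = 2 * card (E \<inter> X \<times> Y) + card (E \<inter> Y \<times> Y)" using eq by simp
  have finY: "finite Y" using assms finite_V by auto
  have "(\<Sum>y\<in>Y. card (E `` {y})) = card (SIGMA y:Y. E `` {y})" using finY by simp
  also have "(SIGMA y:Y. E `` {y}) = (E \<inter> Y \<times> X) \<union> (E \<inter> Y \<times> Y)" using E_sub assms by auto
  also have "card \<dots> = card (E \<inter> Y \<times> X) + card (E \<inter> Y \<times> Y)"
    using assms(2) by (subst card_Un_disjoint) (auto simp: finite_E)
  finally show "(\<Sum>y\<in>Y. card (E `` {y})) = card (E \<inter> X \<times> Y) + card (E \<inter> Y \<times> Y)" using eq by simp
qed

text \<open>\<open>X\<close> is the neighbourhood of a vertex of maximum degree, independent because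
  \<open>E\<close> is triangle-free. The same partition serves Mantel's bound and the structure
  theorem for disjoint triples.\<close>

lemma max_degree_split:
  obtains X Y where "X \<union> Y = V" "X \<inter> Y = {}" "E \<inter> X \<times> X = {}"
    "\<And>v. v \<in> V \<Longrightarrow> card (E `` {v}) \<le> card X"
proof (cases "V = {}")
  case True
  then show ?thesis using E_sub by (intro that[of "{}" "{}"]) auto
next
  case False
  then obtain u where u: "u \<in> V" "\<And>v. v \<in> V \<Longrightarrow> card (E `` {v}) \<le> card (E `` {u})"
    using Max_in[of "(\<lambda>v. card (E `` {v})) ` V"] Max_ge[of "(\<lambda>v. card (E `` {v})) ` V"] finite_V by fastforce
  show ?thesis
  proof (rule that[of "E `` {u}" "V - E `` {u}"])
    show "E `` {u} \<union> (V - E `` {u}) = V" using E_sub by blast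
    show "E \<inter> E `` {u} \<times> E `` {u} = {}" using triangle_free by blast
  qed (use u in auto)
qed

text \<open>Every edge has an end outside the independent set \<open>X\<close>, so the degree sum
  over \<open>Y\<close>, at most \<open>card X * card Y\<close>, already counts every edge.\<close>

lemma mantel: "card E \<le> 2 * ((card V)\<^sup>2 div 4)"
proof -
  obtain X Y where XY: "X \<union> Y = V" "X \<inter> Y = {}" "E \<inter> X \<times> X = {}"
    "\<And>v. v \<in> V \<Longrightarrow> card (E `` {v}) \<le> card X" using max_degree_split by metis
  have fin: "finite X" "finite Y" using XY(1) finite_V by (metis finite_Un)+
  have "(\<Sum>y\<in>Y. card (E `` {y})) \<le> (\<Sum>y\<in>Y. card X)" using XY by (intro sum_mono) blast
  then have "card E \<le> 2 * (card X * card Y)" using card_E_split[OF XY(1-3)] by (simp add: mult.commute)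
  moreover have "card V = card X + card Y" using XY fin by (metis card_Un_disjoint)
  ultimately show ?thesis using mult_le_square_div_4[of "card X" "card Y"] by simp
qed

section \<open>Deleting a clique with more than three vertices\<close>

text \<open>Outside a large clique the neighbourhoods of its vertices are disjoint, and so are the other
  cliques meeting it.\<close>

lemma outside_large_clique:
  assumes K: "K \<in> \<K>" "3 < card K"
  shows "(\<Sum>v\<in>K. card (E `` {v})) + (\<Sum>L\<in>{L \<in> \<K>. L \<noteq> K \<and> L \<inter> K \<noteq> {}}. card (L - K)) \<le> card V - card K"
proof -
  let ?M = "{L \<in> \<K>. L \<noteq> K \<and> L \<inter> K \<noteq> {}}"
  \<comment> \<open>As \<open>K\<close> is not a triple, \<open>near\<close> leaves a vertex outside
    \<open>K\<close> at most one neighbour in it. All three disjointness claims below are instances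
    of this.\<close>
  have n: "x = y" if "x \<in> K" "y \<in> K" "v \<notin> K" "x \<in> dnbrs v" "y \<in> dnbrs v" for x y v
    using near'[OF K(1) that(3,1,2,4,5)] K(2) by auto
  have finK: "finite K" using K finite_clique by blast
  have 1: "card (\<Union>v\<in>K. E `` {v}) = (\<Sum>v\<in>K. card (E `` {v}))"
  proof (rule card_UN_disjoint[OF finK], simp, intro ballI impI)
    fix v w assume vw: "v \<in> K" "w \<in> K" "v \<noteq> w"
    show "E `` {v} \<inter> E `` {w} = {}"
    proof (rule ccontr)
      assume "E `` {v} \<inter> E `` {w} \<noteq> {}"
      then obtain x where x: "(v, x) \<in> E" "(w, x) \<in> E" by blast
      then have "x \<notin> K" using K_indep K vw by blast
      then show False using n[of v w x] vw x E_sym unfolding in_dnbrs by blast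
    qed
  qed
  have 2: "card (\<Union>L\<in>?M. L - K) = (\<Sum>L\<in>?M. card (L - K))"
  proof (rule card_UN_disjoint)
    show "finite ?M" using finite_cliques by simp
    show "\<forall>L\<in>?M. finite (L - K)" using finite_clique by blast
    show "\<forall>L\<in>?M. \<forall>L'\<in>?M. L \<noteq> L' \<longrightarrow> (L - K) \<inter> (L' - K) = {}"
    proof (intro ballI impI, rule ccontr)
      fix L L' assume L: "L \<in> ?M" "L' \<in> ?M" "L \<noteq> L'" "(L - K) \<inter> (L' - K) \<noteq> {}"
      then obtain x u v where x: "x \<in> L" "x \<in> L'" "x \<notin> K" "u \<in> L" "u \<in> K" "v \<in> L'" "v \<in> K" by blast
      then have "u = v" using n[of u v x] L unfolding in_dnbrs by blast
      then show False using K_share[of L L' x u] L x by blast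
    qed
  qed
  have 3: "(\<Union>v\<in>K. E `` {v}) \<inter> (\<Union>L\<in>?M. L - K) = {}"
  proof (rule ccontr)
    assume "(\<Union>v\<in>K. E `` {v}) \<inter> (\<Union>L\<in>?M. L - K) \<noteq> {}"
    then obtain x v L u where x: "v \<in> K" "(v, x) \<in> E" "L \<in> \<K>" "L \<noteq> K" "x \<in> L" "x \<notin> K" "u \<in> L" "u \<in> K" by blast
    then have "u = v" using n[of u v x] E_sym unfolding in_dnbrs by blast
    then show False using K_indep[of L v x] x by blast
  qed
  have sub: "(\<Union>v\<in>K. E `` {v}) \<union> (\<Union>L\<in>?M. L - K) \<subseteq> V - K"
    using E_sub K_sub K_indep K(1) by blast
  then have "card ((\<Union>v\<in>K. E `` {v}) \<union> (\<Union>L\<in>?M. L - K)) \<le> card (V - K)"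
    using finite_V by (intro card_mono) auto
  moreover have "card ((\<Union>v\<in>K. E `` {v}) \<union> (\<Union>L\<in>?M. L - K)) =
      card (\<Union>v\<in>K. E `` {v}) + card (\<Union>L\<in>?M. L - K)"
    using sub finite_V by (intro card_Un_disjoint 3) (meson finite_Diff finite_subset le_sup_iff)+
  moreover have "card (V - K) = card V - card K" using finK K_sub[OF K(1)] by (rule card_Diff_subset)
  ultimately show ?thesis using 1 2 by simp
qed

text \<open>Another clique meeting \<open>K\<close> loses one vertex, and with it 1, 3 or 6
  triangles according to its size 3, 4 or 5. This is at most the number of its vertices outside
  \<open>K\<close>, up to an excess of 2 for size 5. Cliques of size 5 occupy four vertices outside
  \<open>K\<close> each, so at most \<open>(card V - card K) div 4\<close> of them meet
  \<open>K\<close>; this gives the last summand.\<close>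

lemma delete_large_clique:
  assumes K: "K \<in> \<K>" "3 < card K"
  shows "weight2 \<le> clique_system.weight2 (restrE E K) (restrK \<K> K) + 2 * (card K choose 3)
    + 2 * (card V - card K) + 4 * ((card V - card K) div 4)"
proof -
  let ?M = "{L \<in> \<K>. L \<noteq> K \<and> L \<inter> K \<noteq> {}}" and ?m = "card V - card K"
  let ?loss = "\<lambda>L. (card L choose 3) - (card (L - K) choose 3)"
  let ?e = "\<lambda>L. if card L = 5 then 2 else (0::nat)"
  have loss: "?loss L \<le> card (L - K) + ?e L \<and> 2 * ?e L \<le> card (L - K)" if L: "L \<in> ?M" for L
  proof -
    have fin: "finite L" using L finite_clique by blast
    obtain x where x: "x \<in> L" "x \<in> K" using L by blast
    have "L \<inter> K = {x}" using x L K_share[of L K x] K(1) by blast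
    then have *: "card (L - K) = card L - 1" using fin by (simp add: card_Diff_subset_Int)
    have "card L \<in> {3, 4, 5}" using K_ge3[of L] K_le5[of L] L by auto
    then show ?thesis using * by (auto simp: numeral_eq_Suc)
  qed
  have "(\<Sum>L\<in>\<K>. ?loss L) = (\<Sum>L\<in>?M \<union> {K}. ?loss L)"
  proof (rule sum.mono_neutral_right[OF finite_cliques])
    show "?M \<union> {K} \<subseteq> \<K>" using K by blast
    show "\<forall>L\<in>\<K> - (?M \<union> {K}). ?loss L = 0"
    proof
      fix L assume "L \<in> \<K> - (?M \<union> {K})"
      then have "L - K = L" by blast
      then show "?loss L = 0" by simp
    qed
  qed
  also have "\<dots> = (\<Sum>L\<in>?M. ?loss L) + ?loss K"
    using finite_cliques by (subst sum.union_disjoint) auto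
  finally have A1: "(\<Sum>L\<in>\<K>. ?loss L) = (\<Sum>L\<in>?M. ?loss L) + ?loss K" .
  have A2: "?loss K = card K choose 3" by (subst Diff_cancel, subst card.empty, subst binomial_eq_0) simp_all
  have A3: "(\<Sum>L\<in>?M. ?loss L) \<le> (\<Sum>L\<in>?M. card (L - K)) + (\<Sum>L\<in>?M. ?e L)"
    using loss by (subst sum.distrib[symmetric], intro sum_mono) blast
  have A: "(\<Sum>L\<in>\<K>. ?loss L) \<le> (\<Sum>L\<in>?M. card (L - K)) + (\<Sum>L\<in>?M. ?e L) + (card K choose 3)"
    unfolding A1 A2 using A3 by (rule add_right_mono)
  have e: "(\<Sum>L\<in>?M. ?e L) = 2 * card {L \<in> ?M. card L = 5}"
  proof -
    have "(\<Sum>L\<in>?M. ?e L) = (\<Sum>L\<in>{L \<in> ?M. card L = 5}. 2)"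
      using finite_cliques by (intro sum.mono_neutral_cong_right) auto
    then show ?thesis by simp
  qed
  have "2 * (\<Sum>L\<in>?M. ?e L) \<le> (\<Sum>L\<in>?M. card (L - K))"
    unfolding sum_distrib_left using loss by (intro sum_mono) blast
  moreover have B: "(\<Sum>v\<in>K. card (E `` {v})) + (\<Sum>L\<in>?M. card (L - K)) \<le> ?m"
    using outside_large_clique[OF K] .
  ultimately have "card {L \<in> ?M. card L = 5} * 4 \<le> ?m" unfolding e by simp
  then have N: "card {L \<in> ?M. card L = 5} \<le> ?m div 4" by (simp add: less_eq_div_iff_mult_less_eq)
  have "weight2 \<le> clique_system.weight2 (restrE E K) (restrK \<K> K) + 2 * (\<Sum>v\<in>K. card (E `` {v}))
      + 2 * ((\<Sum>L\<in>?M. card (L - K)) + 2 * card {L \<in> ?M. card L = 5} + (card K choose 3))"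
    using weight2_restr[OF K_sub[OF K(1)]] A unfolding e by (meson add_left_mono mult_le_mono2 order_trans)
  also have "\<dots> = clique_system.weight2 (restrE E K) (restrK \<K> K) + 2 * (card K choose 3)
      + 2 * ((\<Sum>v\<in>K. card (E `` {v})) + (\<Sum>L\<in>?M. card (L - K))) + 4 * card {L \<in> ?M. card L = 5}"
    by (simp add: algebra_simps)
  also have "\<dots> \<le> clique_system.weight2 (restrE E K) (restrK \<K> K) + 2 * (card K choose 3) + 2 * ?m + 4 * (?m div 4)"
    by (intro add_mono order_refl mult_left_mono B N) auto
  finally show ?thesis .
qed

section \<open>Triples sharing a vertex\<close>

definition full_nbrs :: "'a set \<Rightarrow> 'a set" where
  "full_nbrs K = {z. K \<subseteq> E `` {z}}"

lemma finite_dnbrs [simp]: "finite (dnbrs v)"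
  using dnbrs_sub finite_V finite_subset by blast

lemma full_nbrs_sub: "K \<in> \<K> \<Longrightarrow> full_nbrs K \<subseteq> V - K"
proof
  fix z assume K: "K \<in> \<K>" and z: "z \<in> full_nbrs K"
  have "K \<noteq> {}" using K_ge3[OF K] by auto
  then obtain x where "x \<in> K" by blast
  then show "z \<in> V - K" using z K K_indep[of K z x] E_sub unfolding full_nbrs_def by blast
qed

text \<open>Double counting: by \<open>near\<close> a vertex outside \<open>T\<close> sees at most
  one vertex of \<open>T\<close>, unless it is a full neighbour and sees two more; a vertex of
  \<open>T\<close> sees two, which accounts for the 3.\<close>

lemma sum_dnbrs_triple:
  assumes T: "T \<in> \<K>" "card T = 3"
  shows "(\<Sum>v\<in>T. card (dnbrs v)) \<le> card V + 3 + 2 * card (full_nbrs T)"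
proof -
  have finT: "finite T" using T finite_clique by blast
  let ?Z = "full_nbrs T"
  have Z: "?Z \<subseteq> V" using full_nbrs_sub T by blast
  have finZ: "finite ?Z" using Z finite_V finite_subset by blast
  have "(\<Sum>v\<in>T. card (dnbrs v)) = (\<Sum>v\<in>T. \<Sum>x\<in>V. if x \<in> dnbrs v then 1 else 0)"
  proof (rule sum.cong[OF refl])
    fix v
    have "card (dnbrs v) = (\<Sum>x\<in>dnbrs v. 1)" by simp
    also have "\<dots> = (\<Sum>x\<in>V. if x \<in> dnbrs v then 1 else 0)"
      using dnbrs_sub finite_V by (intro sum.mono_neutral_cong_left) auto
    finally show "card (dnbrs v) = (\<Sum>x\<in>V. if x \<in> dnbrs v then 1 else 0)" .
  qed
  also have "\<dots> = (\<Sum>x\<in>V. \<Sum>v\<in>T. if x \<in> dnbrs v then 1 else 0)" by (rule sum.swap)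
  also have "\<dots> = (\<Sum>x\<in>V. card (T \<inter> dnbrs x))"
  proof (rule sum.cong[OF refl])
    fix x
    have "(\<Sum>v\<in>T. if x \<in> dnbrs v then 1 else 0) = (\<Sum>v\<in>T \<inter> dnbrs x. (1::nat))"
      using finT dnbrs_sym by (intro sum.mono_neutral_cong_right) auto
    then show "(\<Sum>v\<in>T. if x \<in> dnbrs v then 1 else 0) = card (T \<inter> dnbrs x)" by simp
  qed
  also have "\<dots> \<le> (\<Sum>x\<in>V. 1 + (if x \<in> T then 1 else 0) + (if x \<in> ?Z then 2 else 0))"
  proof (rule sum_mono)
    fix x
    have le3: "card (T \<inter> dnbrs x) \<le> 3" using T finT card_mono[of T "T \<inter> dnbrs x"] by simp
    consider "x \<in> T" | "x \<notin> T" "x \<in> ?Z" | "x \<notin> T" "x \<notin> ?Z" by blast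
    then show "card (T \<inter> dnbrs x) \<le> 1 + (if x \<in> T then 1 else 0) + (if x \<in> ?Z then 2 else 0)"
    proof cases
      case 1
      have "T \<inter> dnbrs x \<subseteq> T - {x}" unfolding dnbrs_def using irrefl by blast
      then have "card (T \<inter> dnbrs x) \<le> card (T - {x})" using finT by (intro card_mono) auto
      then show ?thesis using 1 T finT by simp
    next
      case 2
      then show ?thesis using le3 by simp
    next
      case 3
      have "card (T \<inter> dnbrs x) \<le> Suc 0"
        using near'[OF T(1) 3(1)] 3(2) finT unfolding full_nbrs_def
        by (subst card_le_Suc0_iff_eq) auto
      then show ?thesis by simp
    qed
  qed
  also have "\<dots> = card V + card (V \<inter> T) + 2 * card (V \<inter> ?Z)"
    unfolding sum.distrib using finite_V by (simp add: sum.If_cases)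
  finally show ?thesis using T Z K_sub[OF T(1)] by (simp add: Int_absorb1)
qed

definition mult :: "'a \<Rightarrow> nat" where
  "mult v = card {K \<in> \<K>. v \<in> K}"

text \<open>Nothing is counted twice: the triples through \<open>v\<close> are disjoint apart from
  \<open>v\<close>, and no edge of \<open>E\<close> lies inside a clique.\<close>

lemma card_dnbrs_triples:
  assumes "\<forall>K\<in>\<K>. card K = 3"
  shows "card (dnbrs v) = card (E `` {v}) + 2 * mult v"
proof -
  let ?M = "{K \<in> \<K>. v \<in> K}"
  have "\<Union>?M - {v} = (\<Union>K\<in>?M. K - {v})" by blast
  also have "card \<dots> = (\<Sum>K\<in>?M. card (K - {v}))"
  proof (rule card_UN_disjoint)
    show "finite ?M" using finite_cliques by simp
    show "\<forall>K\<in>?M. finite (K - {v})" using finite_clique by blast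
    show "\<forall>K\<in>?M. \<forall>L\<in>?M. K \<noteq> L \<longrightarrow> (K - {v}) \<inter> (L - {v}) = {}" using K_share by blast
  qed
  also have "\<dots> = (\<Sum>K\<in>?M. 2)"
    using assms finite_clique by (intro sum.cong) auto
  finally have "card (\<Union>?M - {v}) = 2 * mult v" unfolding mult_def by simp
  moreover have "E `` {v} \<inter> (\<Union>?M - {v}) = {}" using K_indep by blast
  ultimately show ?thesis unfolding dnbrs_def using finite_dnbrs[of v]
    by (subst card_Un_disjoint) (auto simp: dnbrs_def)
qed

text \<open>Two triples sharing the vertex \<open>a\<close> force their other four vertices to have small total
  degree, because the common neighbourhoods of the two triples are disjoint parts of the
  neighbourhood of \<open>a\<close>.\<close>

lemma overlap_degree_sum:
  assumes tri: "\<forall>K\<in>\<K>. card K = 3"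
    and T: "T \<in> \<K>" "T' \<in> \<K>" "T \<noteq> T'" "a \<in> T" "a \<in> T'"
  defines "S \<equiv> (T \<union> T') - {a}"
  shows "card S = 4" and
    "(\<Sum>v\<in>S. card (E `` {v})) + card {K \<in> \<K>. K \<inter> S \<noteq> {}} + 8 \<le> 2 * card V"
proof -
  have fin: "finite T" "finite T'" using T finite_clique by auto
  have int: "T \<inter> T' = {a}" using T K_share by blast
  have disj: "(T - {a}) \<inter> (T' - {a}) = {}" using int by blast
  have S: "S = (T - {a}) \<union> (T' - {a})" unfolding S_def by blast
  have c2: "card (T - {a}) = 2" "card (T' - {a}) = 2" using T tri fin by simp_all
  show cS: "card S = 4" unfolding S using disj c2 fin by (subst card_Un_disjoint) auto
  have finS: "finite S" using fin S by auto
  let ?Z = "full_nbrs T" and ?Z' = "full_nbrs T'"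
  have finZ: "finite ?Z" "finite ?Z'" using full_nbrs_sub T finite_V by (meson finite_Diff finite_subset)+
  have "S \<union> ?Z \<union> ?Z' \<subseteq> dnbrs a"
    unfolding S full_nbrs_def dnbrs_def using T E_sym by blast
  then have "card (S \<union> ?Z \<union> ?Z') \<le> card (dnbrs a)" by (intro card_mono) auto
  \<comment> \<open>A common full neighbour \<open>y\<close> would make the edge between
    \<open>a\<close> and \<open>y\<close> belong to both triples, against
    \<open>own\<close>.\<close>
  moreover have "?Z \<inter> ?Z' = {}"
    unfolding full_nbrs_def using own[of T T' a _ a] T by blast
  moreover have "S \<inter> ?Z = {}" "S \<inter> ?Z' = {}"
  proof -
    show "S \<inter> ?Z = {}" unfolding S full_nbrs_def using T K_indep[of T] K_indep[of T'] by blast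
    show "S \<inter> ?Z' = {}" unfolding S full_nbrs_def using T K_indep[of T] K_indep[of T'] by blast
  qed
  ultimately have da: "4 + card ?Z + card ?Z' \<le> card (dnbrs a)"
    using finS finZ cS by (simp add: card_Un_disjoint Int_Un_distrib2)
  have "(\<Sum>v\<in>T. card (dnbrs v)) = card (dnbrs a) + (\<Sum>v\<in>T - {a}. card (dnbrs v))"
    "(\<Sum>v\<in>T'. card (dnbrs v)) = card (dnbrs a) + (\<Sum>v\<in>T' - {a}. card (dnbrs v))"
    using T fin by (simp_all add: sum.remove)
  moreover have "(\<Sum>v\<in>S. card (dnbrs v)) = (\<Sum>v\<in>T - {a}. card (dnbrs v)) + (\<Sum>v\<in>T' - {a}. card (dnbrs v))"
    unfolding S using disj fin by (intro sum.union_disjoint) auto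
  \<comment> \<open>Removing the degree of \<open>a\<close> from both sums takes away at least 8
    plus twice the sizes of \<open>?Z\<close> and \<open>?Z'\<close>, so that only 3 + 3 - 8 = -2
    remains besides \<open>2 * card V\<close>.\<close>
  ultimately have 1: "(\<Sum>v\<in>S. card (dnbrs v)) + 2 \<le> 2 * card V"
    using sum_dnbrs_triple[of T] sum_dnbrs_triple[of T'] T tri da by fastforce
  let ?M = "{K \<in> \<K>. K \<inter> S \<noteq> {}}"
  have finM: "finite ?M" using finite_cliques by simp
  have "(\<Sum>v\<in>S. mult v) = (\<Sum>v\<in>S. \<Sum>K\<in>\<K>. if v \<in> K then 1 else 0)"
    unfolding mult_def using finite_cliques by (intro sum.cong refl) (simp add: sum.If_cases Int_def)
  also have "\<dots> = (\<Sum>K\<in>\<K>. \<Sum>v\<in>S. if v \<in> K then 1 else 0)" by (rule sum.swap)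
  also have "\<dots> = (\<Sum>K\<in>\<K>. card (K \<inter> S))"
    using finS by (intro sum.cong refl) (simp add: sum.If_cases Int_commute)
  also have "\<dots> = (\<Sum>K\<in>?M. card (K \<inter> S))"
    using finite_cliques by (intro sum.mono_neutral_right) auto
  finally have m: "(\<Sum>v\<in>S. mult v) = (\<Sum>K\<in>?M. card (K \<inter> S))" .
  have "T \<inter> S = T - {a}" "T' \<inter> S = T' - {a}" unfolding S using int by auto
  then have c: "card (T \<inter> S) = 2" "card (T' \<inter> S) = 2" using c2 by simp_all
  then have TM: "T \<in> ?M" "T' \<in> ?M" using T by auto
  \<comment> \<open>Every triple in \<open>?M\<close> meets \<open>S\<close>, and \<open>T\<close>
    and \<open>T'\<close> do so in two vertices.\<close>
  have "(\<Sum>K\<in>?M. 1 + (if K \<in> {T, T'} then 1 else 0)) \<le> (\<Sum>K\<in>?M. card (K \<inter> S))"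
  proof (rule sum_mono)
    fix K assume "K \<in> ?M"
    then have "1 \<le> card (K \<inter> S)" using finS by (simp add: Suc_leI card_gt_0_iff)
    then show "1 + (if K \<in> {T, T'} then 1 else 0) \<le> card (K \<inter> S)" using c by auto
  qed
  moreover have "(\<Sum>K\<in>?M. if K \<in> {T, T'} then 1 else (0::nat)) = card {T, T'}"
    using finM TM by (simp add: sum.If_cases insert_absorb Int_absorb1 del: insert_iff)
  ultimately have 2: "card ?M + 2 \<le> (\<Sum>v\<in>S. mult v)"
    using T(3) unfolding m sum.distrib by simp
  have "(\<Sum>v\<in>S. 1) \<le> (\<Sum>v\<in>S. mult v)"
  proof (rule sum_mono)
    fix v assume "v \<in> S"
    then have "{K \<in> \<K>. v \<in> K} \<noteq> {}" unfolding S using T by blast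
    then show "1 \<le> mult v" unfolding mult_def using finite_cliques by (simp add: Suc_leI card_gt_0_iff)
  qed
  then have 3: "4 \<le> (\<Sum>v\<in>S. mult v)" using cS by simp
  \<comment> \<open>The sum of \<open>mult\<close> enters twice: one copy pays for
    \<open>card ?M + 2\<close>, the other for 4. With the 2 from above this makes 8.\<close>
  have "(\<Sum>v\<in>S. card (dnbrs v)) = (\<Sum>v\<in>S. card (E `` {v})) + 2 * (\<Sum>v\<in>S. mult v)"
    by (simp add: card_dnbrs_triples[OF tri] sum.distrib sum_distrib_left)
  then show "(\<Sum>v\<in>S. card (E `` {v})) + card ?M + 8 \<le> 2 * card V"
    using 1 2 3 by linarith
qed

text \<open>A triple meeting \<open>S\<close> disappears altogether, so the loss is at most twice
  the quantity bounded in \<open>overlap_degree_sum\<close>. The vertex \<open>a\<close> stays,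
  since its possibly large degree is what makes the other four small.\<close>

lemma delete_overlap:
  assumes tri: "\<forall>K\<in>\<K>. card K = 3"
    and T: "T \<in> \<K>" "T' \<in> \<K>" "T \<noteq> T'" "a \<in> T" "a \<in> T'"
  defines "S \<equiv> (T \<union> T') - {a}"
  shows "weight2 + 16 \<le> clique_system.weight2 (restrE E S) (restrK \<K> S) + 4 * card V"
proof -
  let ?M = "{K \<in> \<K>. K \<inter> S \<noteq> {}}"
  have "(\<Sum>K\<in>\<K>. (card K choose 3) - (card (K - S) choose 3)) \<le> (\<Sum>K\<in>\<K>. if K \<in> ?M then 1 else 0)"
  proof (rule sum_mono)
    fix K assume "K \<in> \<K>"
    then show "(card K choose 3) - (card (K - S) choose 3) \<le> (if K \<in> ?M then 1 else 0)"
      using tri by (cases "K \<inter> S = {}") (auto simp: Diff_triv)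
  qed
  also have "\<dots> = card ?M" using finite_cliques by (simp add: sum.If_cases Int_def)
  finally have "(\<Sum>K\<in>\<K>. (card K choose 3) - (card (K - S) choose 3)) \<le> card ?M" .
  moreover have "S \<subseteq> V" unfolding S_def using T K_sub by blast
  ultimately show ?thesis
    using weight2_restr[of S] overlap_degree_sum(2)[OF tri T, folded S_def] by linarith
qed

lemma weight2_triples: "\<forall>K\<in>\<K>. card K = 3 \<Longrightarrow> weight2 = card E + 2 * card \<K>"
  unfolding weight2_def by simp

lemma card_disjoint_triples:
  assumes tri: "\<forall>K\<in>\<K>. card K = 3" and dis: "disjoint \<K>" and sub: "\<Union>\<K> \<subseteq> P" "finite P"
  shows "3 * card \<K> \<le> card P" and "3 * card \<K> = card (\<Union>\<K>)"
proof -
  have "card (\<Union>\<K>) = (\<Sum>K\<in>\<K>. card K)"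
    using dis finite_clique by (simp add: card_Union_disjoint)
  then show "3 * card \<K> = card (\<Union>\<K>)" using tri by simp
  then show "3 * card \<K> \<le> card P" using sub card_mono by metis
qed

end

text \<open>The exception at 5 is due to \<open>K\<^sub>5\<close>, which has 10 triangles.\<close>

definition crude :: "nat \<Rightarrow> nat" where
  "crude n = n\<^sup>2 div 4 + n div 3 + (if n = 5 then 3 else 0)"

lemma crude_4: "4 \<le> n \<Longrightarrow> crude (n - 4) + 2 * n \<le> crude n + 8 "
proof -
  assume "4 \<le> n"
  then obtain m where n: "n = m + 4" by (metis add.commute le_Suc_ex)
  have "(m + 4)\<^sup>2 = m\<^sup>2 + (2 * m + 4) * 4" by (simp add: power2_eq_square algebra_simps)
  then have "(m + 4)\<^sup>2 div 4 = m\<^sup>2 div 4 + (2 * m + 4)" by simp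
  \<comment> \<open>The squares leave a slack of 4, which covers the extra 3 at
    \<open>m = 5\<close>.\<close>
  then show ?thesis unfolding crude_def n by (cases "m = 5") auto
qed

section \<open>Bounds on the weight of a clique system\<close>

definition tri_max :: "nat \<Rightarrow> int" where
  "tri_max n = int (n\<^sup>2 div 4) + g n"

text \<open>What a complete bipartite graph would give if cores in the larger class did not have to cover
  that class, so that its size need not be divisible by 3.\<close>

definition relaxed_max :: "nat \<Rightarrow> nat" where
  "relaxed_max n = n\<^sup>2 div 4 + ((n + 1) div 2) div 3"

lemma mod_6_cases:
  fixes n :: nat
  obtains k where "n = 6 * k" | k where "n = 6 * k + 1" | k where "n = 6 * k + 2"
    | k where "n = 6 * k + 3" | k where "n = 6 * k + 4" | k where "n = 6 * k + 5"
proof -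
  have "n = 6 * (n div 6) + n mod 6" "n mod 6 < 6" by simp_all
  then consider "n = 6 * (n div 6)" | "n = 6 * (n div 6) + 1" | "n = 6 * (n div 6) + 2"
    | "n = 6 * (n div 6) + 3" | "n = 6 * (n div 6) + 4" | "n = 6 * (n div 6) + 5" by linarith
  then show ?thesis using that by cases blast+
qed

lemma g_residue:
  assumes "r < 6"
  shows "g (6 * k + r) = (if r \<in> {0, 1, 4} then int k else if r \<in> {2, 3} then int k - 1 else int k + 1)"
proof -
  have "(6 * k + r) mod 6 = r" "(6 * k + r) div 6 = k" using assms by simp_all
  then show ?thesis unfolding g_def by simp
qed

lemma g_simps:
  "g (6 * k) = int k" "g (6 * k + 1) = int k" "g (6 * k + 2) = int k - 1"
  "g (6 * k + 3) = int k - 1" "g (6 * k + 4) = int k" "g (6 * k + 5) = int k + 1"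
  using g_residue[of 0 k] g_residue[of 1 k] g_residue[of 2 k] g_residue[of 3 k] g_residue[of 4 k]
    g_residue[of 5 k] by simp_all

text \<open>The constant 9 is attained for \<open>n\<close> congruent to 3 modulo 6.\<close>

lemma g_lower: "int n \<le> 6 * g n + 9"
  by (cases n rule: mod_6_cases; hypsubst; simp only: g_simps; simp)

lemma g_pos: "11 \<le> n \<Longrightarrow> 1 \<le> g n"
  by (cases n rule: mod_6_cases; hypsubst; simp only: g_simps; simp)

lemma half_third_simps:
  "((6 * k + 1) div 2) div 3 = (k::nat)" "((6 * k + 1 + 1) div 2) div 3 = k" "((6 * k + 2 + 1) div 2) div 3 = k"
  "((6 * k + 3 + 1) div 2) div 3 = k" "((6 * k + 4 + 1) div 2) div 3 = k" "((6 * k + 5 + 1) div 2) div 3 = k + 1"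
  by (simp_all add: div_mult2_eq[symmetric])

text \<open>The gap is 1 exactly for \<open>n\<close> congruent to 2 or 3 modulo 6. That it never
  exceeds 1 is what later leaves room for a single missing edge.\<close>

lemma relaxed_max_le: "int (relaxed_max n) \<le> tri_max n + 1"
  and relaxed_max_ge: "tri_max n \<le> int (relaxed_max n)"
  unfolding relaxed_max_def tri_max_def
  by (cases n rule: mod_6_cases; simp only: g_simps half_third_simps of_nat_add; simp)+

lemma square_div_4_add: "((m::nat) + 2 * d)\<^sup>2 div 4 = m\<^sup>2 div 4 + d * (m + d)"
proof -
  have "(m + 2 * d)\<^sup>2 = m\<^sup>2 + (d * (m + d)) * 4" by (simp add: power2_eq_square algebra_simps)
  then show ?thesis by simp
qed

lemma square_div_4_Suc: "(Suc m)\<^sup>2 div 4 = m\<^sup>2 div 4 + Suc m div 2"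
proof (cases "even m")
  case True
  then obtain k where "m = 2 * k" by blast
  then show ?thesis by (simp add: power2_eq_square)
next
  case False
  then obtain k where "m = 2 * k + 1" by (metis oddE)
  then show ?thesis by (simp add: power2_eq_square algebra_simps)
qed

text \<open>The left side is half the bound of \<open>delete_large_clique\<close> for a clique of
  size 4 with \<open>m\<close> vertices left, after \<open>crude m\<close> is inserted for the rest;
  \<open>crude_Suc5\<close> does the same for size 5.\<close>

lemma crude_Suc4: "4 + m + 2 * (m div 4) + crude m \<le> crude (m + 4)"
proof -
  have "(m + 4)\<^sup>2 div 4 = m\<^sup>2 div 4 + 2 * (m + 2)" using square_div_4_add[of m 2] by simp
  moreover have "2 * (m div 4) \<le> m" by linarith
  ultimately show ?thesis unfolding crude_def by (cases "m = 5") auto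
qed

lemma crude_Suc5: "10 + m + 2 * (m div 4) + crude m \<le> crude (m + 5)"
proof -
  have "(m + 5)\<^sup>2 div 4 = (m + 1)\<^sup>2 div 4 + 2 * (m + 1 + 2)"
    using square_div_4_add[of "m + 1" 2] by (simp add: add.commute)
  then have *: "(m + 5)\<^sup>2 div 4 = m\<^sup>2 div 4 + (m + 1) div 2 + 2 * m + 6" using square_div_4_Suc[of m] by simp
  have d: "2 * (m div 4) \<le> (m + 1) div 2"
    using div_le_mono[of m "m + 1" 2] by (simp add: div_mult2_eq[of m 2 2, simplified])
  \<comment> \<open>The general estimate needs \<open>3 <= m\<close>, and \<open>m = 5\<close>
    carries the exceptional value of \<open>crude\<close>. At \<open>m = 0\<close>, a lone K5, there
    is equality.\<close>
  consider "m = 0" | "m = 1" | "m = 2" | "m = 5" | "m \<ge> 3" "m \<noteq> 5" by linarith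
  then show ?thesis
  proof cases
    case 5
    have "m div 3 + 1 \<le> (m + 5) div 3" using div_le_mono[of "m + 3" "m + 5" 3] by simp
    then show ?thesis using 5 * d unfolding crude_def by simp
  qed (simp_all add: crude_def)
qed

text \<open>By \<open>delete_overlap\<close>, deleting four vertices with \<open>m\<close> left
  costs at most \<open>2 * m\<close> in terms of half the weight, so the 4 is pure gain.\<close>

lemma relaxed_max_4: "relaxed_max m + 2 * m + 4 \<le> relaxed_max (m + 4)"
proof -
  have "(m + 4)\<^sup>2 div 4 = m\<^sup>2 div 4 + 2 * (m + 2)" using square_div_4_add[of m 2] by simp
  moreover have "((m + 1) div 2) div 3 \<le> ((m + 4 + 1) div 2) div 3" by (intro div_le_mono) simp
  ultimately show ?thesis unfolding relaxed_max_def by simp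
qed

text \<open>If \<open>p\<close> exceeds the rounded-up half \<open>c\<close> by \<open>d\<close>,
  moving \<open>d\<close> vertices to the other side raises the product by at least
  \<open>d * d >= d\<close>, while \<open>p div 3\<close> exceeds \<open>c div 3\<close> by at most
  \<open>d\<close>.\<close>

lemma product_le_relaxed_max: "p * r + p div 3 \<le> relaxed_max (p + r)"
proof (cases "p \<le> (p + r + 1) div 2")
  case True
  then have "p div 3 \<le> ((p + r + 1) div 2) div 3" by (rule div_le_mono)
  then show ?thesis using mult_le_square_div_4[of p r] unfolding relaxed_max_def by linarith
next
  case False
  define c where "c = (p + r + 1) div 2"
  have c: "p + r \<le> 2 * c" unfolding c_def by simp
  define d where "d = p - c"
  have d: "p = c + d" "1 \<le> d" using False unfolding c_def d_def by auto
  have "d * (r + d) \<le> d * c" using c d by (intro mult_le_mono2) linarith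
  then have "p * r + d * d \<le> c * (r + d)" unfolding d(1) by (simp add: algebra_simps)
  also have "\<dots> \<le> (p + r)\<^sup>2 div 4"
    using mult_le_square_div_4[of c "r + d"] d by (simp add: ac_simps)
  finally have "p * r + d * d \<le> (p + r)\<^sup>2 div 4" .
  moreover have "d \<le> d * d" using d by simp
  moreover have "p div 3 \<le> c div 3 + d"
    using div_le_mono[of "c + d" "c + d * 3" 3] unfolding d(1) by simp
  ultimately have "p * r + p div 3 \<le> (p + r)\<^sup>2 div 4 + c div 3" by linarith
  then show ?thesis unfolding relaxed_max_def c_def .
qed

section \<open>Induction for arbitrary clique systems\<close>

text \<open>Weaker than the target, but valid for every number of vertices, so that it applies to
  whatever a deletion leaves behind.\<close>

theorem crude_bound:
  assumes "clique_system V E \<K>"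
  shows "clique_system.weight2 E \<K> \<le> 2 * crude (card V)"
  using assms
proof (induction "card V" arbitrary: V E \<K> rule: less_induct)
  case less
  interpret clique_system V E \<K> by fact
  have IH: "clique_system.weight2 (restrE E S) (restrK \<K> S) \<le> 2 * crude (card V - card S)"
    if S: "S \<subseteq> V" "S \<noteq> {}" for S
  proof -
    have "finite S" using S finite_V finite_subset by blast
    then have c: "card (V - S) = card V - card S" "0 < card S" using S by (simp_all add: card_Diff_subset card_gt_0_iff)
    moreover have "card S \<le> card V" using S finite_V card_mono by blast
    ultimately show ?thesis using less.hyps[OF _ restr[of S]] by simp
  qed
  consider (big) K where "K \<in> \<K>" "3 < card K"
    | (overlap) T T' a where "\<forall>K\<in>\<K>. card K = 3" "T \<in> \<K>" "T' \<in> \<K>" "T \<noteq> T'" "a \<in> T" "a \<in> T'"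
    | (dis) "\<forall>K\<in>\<K>. card K = 3" "disjoint \<K>"
    using K_ge3 unfolding disjoint_def by (metis disjoint_iff le_neq_implies_less)
  then show ?case
  proof cases
    case big
    define m where "m = card V - card K"
    have "K \<noteq> {}" using big by auto
    note IHK = IH[OF K_sub[OF big(1)] this]
    have V: "card V = m + card K" using big K_sub finite_V card_mono unfolding m_def by (metis le_add_diff_inverse2)
    have ch: "(4::nat) choose 3 = 4" "(5::nat) choose 3 = 10" by (simp_all add: numeral_eq_Suc)
    have "card K = 4 \<or> card K = 5" using big K_le5[of K] by linarith
    then show ?thesis
    proof
      assume c: "card K = 4"
      have "weight2 \<le> 2 * crude m + 8 + 2 * m + 4 * (m div 4)"
        using delete_large_clique[OF big] IHK unfolding c ch V by simp
      then show ?thesis using crude_Suc4[of m] unfolding V c by linarith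
    next
      assume c: "card K = 5"
      have "weight2 \<le> 2 * crude m + 20 + 2 * m + 4 * (m div 4)"
        using delete_large_clique[OF big] IHK unfolding c ch V by simp
      then show ?thesis using crude_Suc5[of m] unfolding V c by linarith
    qed
  next
    case overlap
    let ?S = "(T \<union> T') - {a}"
    have S: "card ?S = 4" "?S \<subseteq> V" using overlap_degree_sum(1)[OF overlap] K_sub overlap by auto
    then have "?S \<noteq> {}" by (metis card.empty zero_neq_numeral)
    then have "clique_system.weight2 (restrE E ?S) (restrK \<K> ?S) \<le> 2 * crude (card V - 4)"
      using IH[of ?S] S by simp
    moreover have "4 \<le> card V" using S finite_V card_mono by metis
    ultimately show ?thesis using delete_overlap[OF overlap] crude_4[of "card V"] by linarith
  next
    case dis
    have "3 * card \<K> \<le> card V" using card_disjoint_triples(1)[OF dis _ finite_V] K_sub by blast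
    then have "card \<K> \<le> card V div 3" by linarith
    then have "weight2 \<le> 2 * ((card V)\<^sup>2 div 4 + card V div 3)"
      unfolding weight2_triples[OF dis(1)] distrib_left by (intro add_mono mantel mult_le_mono2)
    then show ?thesis unfolding crude_def by (rule order_trans) simp
  qed
qed

lemma square_le_div_4: "(n::nat)\<^sup>2 \<le> 4 * (n\<^sup>2 div 4) + 1"
proof -
  obtain j where "n\<^sup>2 = 4 * j \<or> n\<^sup>2 = 4 * j + 1"
  proof (cases "even n")
    case True
    then obtain k where "n = 2 * k" by blast
    then show ?thesis by (intro that[of "k * k"]) (simp add: power2_eq_square)
  next
    case False
    then obtain k where "n = 2 * k + 1" by (metis oddE)
    then show ?thesis by (intro that[of "k * k + k"]) (simp add: power2_eq_square algebra_simps)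
  qed
  then show ?thesis by auto
qed

text \<open>One deletion followed by \<open>crude_bound\<close> is enough. After clearing the floors
  two quadratics in \<open>m\<close> with the same leading term are compared; for size 5 this comes
  down to \<open>10 * m > 56\<close>, which holds from \<open>m = 6\<close>, that is from 11
  vertices on.\<close>

lemma large_clique_weight2:
  assumes "clique_system V E \<K>" "K \<in> \<K>" "3 < card K" "11 \<le> card V"
  shows "int (clique_system.weight2 E \<K>) < 2 * tri_max (card V)"
proof -
  interpret clique_system V E \<K> by fact
  define m where "m = card V - card K"
  have KV: "K \<subseteq> V" "finite K" using assms K_sub finite_clique by auto
  have V: "card V = m + card K" using KV finite_V card_mono unfolding m_def by (metis le_add_diff_inverse2)
  have "clique_system.weight2 (restrE E K) (restrK \<K> K) \<le> 2 * crude m"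
    using crude_bound[OF restr[of K]] KV by (simp add: card_Diff_subset m_def)
  then have W: "weight2 \<le> 2 * crude m + 2 * (card K choose 3) + 2 * m + 4 * (m div 4)"
    using delete_large_clique[OF assms(2,3)] unfolding m_def by simp
  have sq: "4 * (m\<^sup>2 div 4) \<le> m\<^sup>2" by simp
  have k: "card K = 4 \<or> card K = 5" using assms K_le5[of K] by linarith
  then have m: "6 \<le> m" "2 * (card K choose 3) \<le> 20" using assms(4) V by (auto simp: numeral_eq_Suc)
  have "4 * (m div 4) \<le> m" "3 * (m div 3) \<le> m" by simp_all
  then have "weight2 \<le> 2 * (m\<^sup>2 div 4) + 2 * (m div 3) + 3 * m + 2 * (card K choose 3)"
    using W m(1) unfolding crude_def by simp
  then have "6 * weight2 \<le> 3 * m\<^sup>2 + 22 * m + 12 * (card K choose 3)"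
    using sq \<open>3 * (m div 3) \<le> m\<close> by linarith
  then have "int (6 * weight2) \<le> int (3 * m\<^sup>2 + 22 * m + 12 * (card K choose 3))" by (simp only: of_nat_le_iff)
  then have 1: "6 * int weight2 \<le> 3 * (int m)\<^sup>2 + 22 * int m + 12 * int (card K choose 3)" by simp
  have gl: "int m + int (card K) \<le> 6 * g (card V) + 9" using g_lower[of "card V"] V by simp
  have "int ((card V)\<^sup>2) \<le> int (4 * ((card V)\<^sup>2 div 4) + 1)" using square_le_div_4[of "card V"] by (simp only: of_nat_le_iff)
  \<comment> \<open>The 21 is made up of 3 for the floor in \<open>tri_max\<close> and 18 for
    \<open>g_lower\<close>.\<close>
  then have 2: "3 * int ((card V)\<^sup>2) + 2 * (int m + int (card K)) - 21 \<le> 12 * tri_max (card V)"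
    using gl unfolding tri_max_def by simp
  from k show ?thesis
  proof
    assume c: "card K = 4"
    have "(card V)\<^sup>2 = m\<^sup>2 + 8 * m + 16" unfolding V c by (simp add: power2_eq_square algebra_simps)
    moreover have "card K choose 3 = 4" using c by (simp add: numeral_eq_Suc)
    ultimately show ?thesis using 1 2 m c by simp
  next
    assume c: "card K = 5"
    have "(card V)\<^sup>2 = m\<^sup>2 + 10 * m + 25" unfolding V c by (simp add: power2_eq_square algebra_simps)
    moreover have "card K choose 3 = 10" using c by (simp add: numeral_eq_Suc)
    ultimately show ?thesis using 1 2 m c by simp
  qed
qed

section \<open>Systems of pairwise disjoint triples\<close>

context clique_system
begin

text \<open>The neighbourhoods of two adjacent vertices of \<open>Y\<close> are disjoint, so together they contribute
  only \<open>card X\<close> to the degree sum of \<open>Y\<close> instead of \<open>2 * card X\<close>.\<close>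

lemma inner_edge_bound:
  assumes XY: "X \<union> Y = V" "X \<inter> Y = {}" "E \<inter> X \<times> X = {}"
    and deg: "\<And>v. v \<in> V \<Longrightarrow> card (E `` {v}) \<le> card X"
    and edge: "(z, c) \<in> E" "z \<in> Y" "c \<in> Y"
  shows "card E \<le> 2 * (card X * (card Y - 1)) + 2"
proof -
  have fin: "finite X" "finite Y" using XY(1) finite_V by (metis finite_Un)+
  have zc: "z \<noteq> c" using edge irrefl by blast
  let ?N = "\<lambda>v W. E `` {v} \<inter> W"
  have split: "card (E `` {v}) = card (?N v X) + card (?N v Y)" for v
  proof -
    have "E `` {v} = ?N v X \<union> ?N v Y" using E_sub XY by blast
    moreover have "card (?N v X \<union> ?N v Y) = card (?N v X) + card (?N v Y)"
      using XY(2) by (intro card_Un_disjoint) auto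
    ultimately show ?thesis by simp
  qed
  have "?N z X \<inter> ?N c X = {}" using triangle_free[OF edge(1)] by blast
  then have "card (?N z X) + card (?N c X) = card (?N z X \<union> ?N c X)"
    by (intro card_Un_disjoint[symmetric]) auto
  also have "\<dots> \<le> card X" using fin by (intro card_mono) auto
  finally have dX: "card (?N z X) + card (?N c X) \<le> card X" .
  \<comment> \<open>The arcs inside \<open>Y\<close> that leave \<open>z\<close> or
    \<open>c\<close>. Only the edge between \<open>z\<close> and \<open>c\<close> occurs in both
    directions, hence the correction 2 below.\<close>
  define Ob where "Ob = {z} \<times> ?N z Y \<union> {c} \<times> ?N c Y"
  have cO: "card Ob = card (?N z Y) + card (?N c Y)"
    unfolding Ob_def using zc by (subst card_Un_disjoint) (auto simp: card_cartesian_product)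
  have "Ob \<inter> Ob\<inverse> \<subseteq> {(z, c), (c, z)}" unfolding Ob_def using irrefl by blast
  then have i: "card (Ob \<inter> Ob\<inverse>) \<le> 2" using card_mono[of "{(z, c), (c, z)}" "Ob \<inter> Ob\<inverse>"] zc by simp
  have "Ob \<union> Ob\<inverse> \<subseteq> E \<inter> Y \<times> Y" unfolding Ob_def using edge E_sym by blast
  then have "card (Ob \<union> Ob\<inverse>) \<le> card (E \<inter> Y \<times> Y)" using finite_E by (intro card_mono) auto
  moreover have "card Ob + card (Ob\<inverse>) = card (Ob \<union> Ob\<inverse>) + card (Ob \<inter> Ob\<inverse>)"
    unfolding Ob_def by (rule card_Un_Int) auto
  moreover have "card (Ob\<inverse>) = card Ob" by (rule card_inverse)
  ultimately have "2 * card Ob \<le> card (E \<inter> Y \<times> Y) + 2" using i by simp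
  then have dY: "2 * (card (?N z Y) + card (?N c Y)) \<le> card (E \<inter> Y \<times> Y) + 2" unfolding cO .
  have "card {z, c} \<le> card Y" using fin edge by (intro card_mono) auto
  then have cY: "card Y = card (Y - {z, c}) + 2"
    using fin zc edge by (simp add: card_Diff_subset)
  have "(\<Sum>y\<in>Y. card (E `` {y})) = card (E `` {z}) + (card (E `` {c}) + (\<Sum>y\<in>Y - {z, c}. card (E `` {y})))"
    using sum.remove[of Y z "\<lambda>y. card (E `` {y})"] sum.remove[of "Y - {z}" c "\<lambda>y. card (E `` {y})"]
      fin zc edge Diff_insert2[of Y z "{c}"] by simp
  moreover have "(\<Sum>y\<in>Y - {z, c}. card (E `` {y})) \<le> (\<Sum>y\<in>Y - {z, c}. card X)"
    using deg XY by (intro sum_mono) blast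
  moreover have "(\<Sum>y\<in>Y - {z, c}. card X) = card X * (card Y - 2)" using cY by simp
  ultimately have "card (E \<inter> X \<times> Y) + card (E \<inter> Y \<times> Y) \<le>
      card X + card (?N z Y) + card (?N c Y) + card X * (card Y - 2)"
    using card_E_split(2)[OF XY(1-3)] split[of z] split[of c] dX by linarith
  moreover have "card X + card X * (card Y - 2) = card X * (card Y - 1)"
    using cY by (simp add: algebra_simps)
  ultimately have "card (E \<inter> X \<times> Y) + card (E \<inter> Y \<times> Y) \<le>
      card X * (card Y - 1) + (card (?N z Y) + card (?N c Y))" by simp
  \<comment> \<open>Twice the degree sum over \<open>Y\<close> counts each arc inside
    \<open>Y\<close> once too often; this surplus cancels the inner degrees of \<open>z\<close> and
    \<open>c\<close> up to 2.\<close>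
  then show ?thesis using dY card_E_split(1)[OF XY(1-3)] by simp
qed

text \<open>A vertex of \<open>P\<close> joined to both \<open>b\<close> and \<open>c\<close> would
  by \<open>near\<close> be joined to \<open>a\<close>, which is on its own side. So every vertex of
  \<open>P\<close> misses an edge to \<open>R\<close>.\<close>

lemma mixed_clique_bound:
  assumes PR: "P \<union> R = V" "P \<inter> R = {}" "E \<subseteq> P \<times> R \<union> R \<times> P"
    and T: "T \<in> \<K>" "a \<in> T" "a \<in> P" "b \<in> T" "b \<in> R" "c \<in> T" "c \<in> R" "b \<noteq> c"
  shows "card (E \<inter> P \<times> R) \<le> card P * (card R - 1)"
proof -
  have fin: "finite P" "finite R" using PR(1) finite_V by (metis finite_Un)+
  let ?f = "\<lambda>v. (v, if (v, b) \<in> E then c else b)"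
  have ne: "(v, b) \<notin> E \<or> (v, c) \<notin> E" if v: "v \<in> P" for v
  proof (rule ccontr)
    assume n: "\<not> ((v, b) \<notin> E \<or> (v, c) \<notin> E)"
    then have "v \<notin> T" using K_indep T by blast
    then have "(v, a) \<in> E" using near[of T v b c] n T by blast
    then show False using v T(3) PR by blast
  qed
  have "?f v \<in> P \<times> R - E" if "v \<in> P" for v using ne[OF that] that T by simp
  then have "?f ` P \<subseteq> P \<times> R - E" by blast
  then have "card (?f ` P) \<le> card (P \<times> R - E)" using fin by (intro card_mono) auto
  moreover have "card (?f ` P) = card P" by (rule card_image) (auto simp: inj_on_def)
  moreover have "card P * card R = card (E \<inter> P \<times> R) + card (P \<times> R - E)"
    using card_Int_Diff[of "P \<times> R" E] fin by (simp add: card_cartesian_product Int_commute)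
  ultimately show ?thesis by (simp add: diff_mult_distrib2)
qed

text \<open>Triples on opposite sides cannot be completely joined, since a joining edge would belong
  to both, against \<open>own\<close>. And a vertex that misses one vertex of a triple misses two of
  them, by \<open>near\<close>. So each opposite pair costs two edges.\<close>

lemma opposite_triples_bound:
  assumes tri: "\<forall>K\<in>\<K>. card K = 3" and dis: "disjoint \<K>"
    and PR: "P \<union> R = V" "P \<inter> R = {}" "E \<subseteq> P \<times> R \<union> R \<times> P"
  defines "A \<equiv> {T \<in> \<K>. T \<subseteq> P}" and "B \<equiv> {T \<in> \<K>. T \<subseteq> R}"
  shows "card (E \<inter> P \<times> R) + 2 * (card A * card B) \<le> card P * card R"
proof -
  have fin: "finite P" "finite R" using PR(1) finite_V by (metis finite_Un)+
  have finAB: "finite A" "finite B" unfolding A_def B_def using finite_cliques by auto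
  let ?M = "\<lambda>(T, T'). T \<times> T' - E"
  have two: "2 \<le> card (T \<times> T' - E)" if TT: "T \<in> A" "T' \<in> B" for T T'
  proof -
    have T: "T \<in> \<K>" "T \<subseteq> P" "T' \<in> \<K>" "T' \<subseteq> R" using TT unfolding A_def B_def by auto
    have ne: "T \<noteq> {}" "T' \<noteq> {}" using T tri by fastforce+
    then have TT': "T \<noteq> T'" "T \<inter> T' = {}" using T PR by blast+
    have finT: "finite T" "finite T'" using T finite_clique by auto
    have "\<not> T \<times> T' \<subseteq> E"
    proof
      assume *: "T \<times> T' \<subseteq> E"
      obtain x y where "x \<in> T" "y \<in> T'" using ne by blast
      then show False using own[OF T(1,3) TT'(1), of x y y x] * E_sym by blast
    qed
    then obtain x y where xy: "x \<in> T" "y \<in> T'" "(x, y) \<notin> E" by blast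
    have y: "y \<notin> T" using xy TT' by blast
    have "card (T - {x}) = 2" using xy T tri finT by simp
    then obtain u w where uw: "T - {x} = {u, w}" "u \<noteq> w" by (meson card_2_iff)
    have "(u, y) \<notin> E \<or> (w, y) \<notin> E"
    proof (rule ccontr)
      assume "\<not> ((u, y) \<notin> E \<or> (w, y) \<notin> E)"
      then have "T \<subseteq> E `` {y}" using near[OF T(1) y, of u w] uw E_sym by blast
      then show False using xy E_sym by blast
    qed
    then obtain v where v: "v \<in> T" "v \<noteq> x" "(v, y) \<notin> E" using uw by blast
    have "{(x, y), (v, y)} \<subseteq> T \<times> T' - E" using xy v by blast
    then have "card {(x, y), (v, y)} \<le> card (T \<times> T' - E)" using finT by (intro card_mono) auto
    then show ?thesis using v by simp
  qed
  have "2 * (card A * card B) = (\<Sum>p\<in>A \<times> B. 2)" by (simp add: card_cartesian_product)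
  also have "\<dots> \<le> (\<Sum>p\<in>A \<times> B. card (?M p))" using two by (intro sum_mono) auto
  also have "\<dots> = card (\<Union>p\<in>A \<times> B. ?M p)"
  proof (rule card_UN_disjoint[symmetric])
    show "finite (A \<times> B)" using finAB by simp
    show "\<forall>p\<in>A \<times> B. finite (?M p)" using finite_clique unfolding A_def B_def by auto
    show "\<forall>p\<in>A \<times> B. \<forall>q\<in>A \<times> B. p \<noteq> q \<longrightarrow> ?M p \<inter> ?M q = {}"
    proof (intro ballI impI)
      fix p q assume pq: "p \<in> A \<times> B" "q \<in> A \<times> B" "p \<noteq> q"
      obtain T T' L L' where e: "p = (T, T')" "q = (L, L')" by (metis surj_pair)
      have K: "T \<in> \<K>" "T' \<in> \<K>" "L \<in> \<K>" "L' \<in> \<K>" using pq e unfolding A_def B_def by auto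
      have "T \<inter> L = {} \<or> T' \<inter> L' = {}" using pq(3) K dis unfolding e disjoint_def by blast
      then show "?M p \<inter> ?M q = {}" unfolding e by blast
    qed
  qed
  also have "\<dots> \<le> card (P \<times> R - E)"
    using fin by (intro card_mono) (auto simp: A_def B_def)
  finally have "2 * (card A * card B) \<le> card (P \<times> R - E)" .
  moreover have "card P * card R = card (E \<inter> P \<times> R) + card (P \<times> R - E)"
    using card_Int_Diff[of "P \<times> R" E] fin by (simp add: card_cartesian_product Int_commute)
  ultimately show ?thesis by simp
qed

lemma restrK_triples:
  assumes "\<forall>K\<in>\<K>. card K = 3"
  shows "\<forall>K\<in>restrK \<K> S. card K = 3"
proof
  fix L assume "L \<in> restrK \<K> S"
  then obtain K where K: "K \<in> \<K>" "L = K - S" "3 \<le> card L" by blast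
  then have "card L \<le> card K" using finite_clique by (intro card_mono) auto
  then show "card L = 3" using K assms by simp
qed

lemma bipartite_card_E:
  assumes "P \<union> R = V" "P \<inter> R = {}" "E \<subseteq> P \<times> R \<union> R \<times> P"
  shows "card E = 2 * card (E \<inter> P \<times> R)"
proof -
  have "E \<inter> P \<times> P = {}" "E \<inter> R \<times> R = {}" using assms by blast+
  then show ?thesis using card_E_split(1)[OF assms(1,2)] by simp
qed

text \<open>As \<open>g n >= 1\<close>, the triples must bring a net gain over the Mantel bound. An
  edge inside \<open>Y\<close> or a triple meeting both sides costs about half of
  \<open>card V\<close> in edges, but there are at most a third of \<open>card V\<close> triples.
  With \<open>a\<close> and \<open>b\<close> triples on opposite sides,
  \<open>2 * (a * b) >= a + b\<close> edges are lost.\<close>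

theorem disjoint_triples_structure:
  assumes tri: "\<forall>K\<in>\<K>. card K = 3" and dis: "disjoint \<K>"
    and n: "11 \<le> card V" and W: "2 * tri_max (card V) \<le> int weight2"
  obtains P R where "P \<union> R = V" "P \<inter> R = {}" "E \<subseteq> P \<times> R \<union> R \<times> P" "\<Union>\<K> \<subseteq> P"
proof -
  let ?n = "card V" and ?s = "card \<K>"
  have s3: "3 * ?s \<le> ?n" using card_disjoint_triples(1)[OF tri dis _ finite_V] K_sub by blast
  have W2: "(?n\<^sup>2 div 4) * 2 + 2 \<le> card E + 2 * ?s"
  proof -
    have "int ((?n\<^sup>2 div 4) * 2 + 2) \<le> int (card E + 2 * ?s)"
      using W g_pos[OF n] unfolding tri_max_def weight2_triples[OF tri] by simp
    then show ?thesis by (simp only: of_nat_le_iff)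
  qed
  \<comment> \<open>With so few edges the Mantel bound drops by \<open>card V div 2\<close>, which
    the triples would have to make up.\<close>
  have few: False if "card E \<le> 2 * (p * (r - 1)) + 2" "p + r = ?n" "1 \<le> r" for p r
  proof -
    have "p * (r - 1) \<le> (?n - 1)\<^sup>2 div 4"
      using mult_le_square_div_4[of p "r - 1"] that by simp
    moreover have "?n\<^sup>2 div 4 = (?n - 1)\<^sup>2 div 4 + ?n div 2"
      using square_div_4_Suc[of "?n - 1"] n by simp
    ultimately have "?n div 2 \<le> ?s" using that(1) W2 by simp
    moreover have "?n < 2 * (?n div 2) + 2" by simp
    ultimately show False using s3 n by linarith
  qed
  obtain X Y where XY: "X \<union> Y = V" "X \<inter> Y = {}" "E \<inter> X \<times> X = {}"
    "\<And>v. v \<in> V \<Longrightarrow> card (E `` {v}) \<le> card X" using max_degree_split by metis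
  have fin: "finite X" "finite Y" using XY(1) finite_V by (metis finite_Un)+
  have cXY: "card X + card Y = ?n" using XY fin by (metis card_Un_disjoint)
  have YY: "E \<inter> Y \<times> Y = {}"
  proof (rule ccontr)
    assume "E \<inter> Y \<times> Y \<noteq> {}"
    then obtain z c where zc: "(z, c) \<in> E" "z \<in> Y" "c \<in> Y" by blast
    then have "1 \<le> card Y" using fin by (metis card_gt_0_iff empty_iff One_nat_def Suc_leI)
    then show False using few[OF inner_edge_bound[OF XY zc] cXY] by blast
  qed
  have E: "E \<subseteq> X \<times> Y \<union> Y \<times> X" using E_sub XY YY by blast
  have nomix: False if PR: "P \<union> R = V" "P \<inter> R = {}" "E \<subseteq> P \<times> R \<union> R \<times> P"
    and T: "T \<in> \<K>" "a \<in> T" "a \<in> P" "b \<in> T" "b \<in> R" "c \<in> T" "c \<in> R" "b \<noteq> c" for P R T a b c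
  proof -
    have finP: "finite P" "finite R" using PR(1) finite_V by (metis finite_Un)+
    have "card P + card R = ?n" using PR finP by (metis card_Un_disjoint)
    moreover have "1 \<le> card R" using T finP by (metis card_gt_0_iff empty_iff One_nat_def Suc_leI)
    ultimately show False
      using few[of "card P" "card R"] mixed_clique_bound[OF PR T] bipartite_card_E[OF PR] by linarith
  qed
  have YX: "Y \<union> X = V" "Y \<inter> X = {}" "E \<subseteq> Y \<times> X \<union> X \<times> Y" using XY E by blast+
  have side: "T \<subseteq> X \<or> T \<subseteq> Y" if T: "T \<in> \<K>" for T
  proof (rule ccontr)
    assume "\<not> (T \<subseteq> X \<or> T \<subseteq> Y)"
    then obtain a b where ab: "a \<in> T" "a \<in> X" "b \<in> T" "b \<in> Y" using K_sub[OF T] XY by blast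
    have "card {a, b} < card T" using tri T by (simp add: card_insert_if)
    then have "\<not> T \<subseteq> {a, b}" by (metis card_mono finite.emptyI finite_insert leD)
    then obtain c where c: "c \<in> T" "c \<noteq> a" "c \<noteq> b" by blast
    then consider "c \<in> X" | "c \<in> Y" using K_sub[OF T] XY by blast
    then show False
    proof cases
      case 1
      then show False using nomix[OF YX T ab(3,4,1,2) c(1) 1] c by blast
    next
      case 2
      then show False using nomix[OF XY(1,2) E T ab c(1) 2] c by blast
    qed
  qed
  let ?A = "{T \<in> \<K>. T \<subseteq> X}" and ?B = "{T \<in> \<K>. T \<subseteq> Y}"
  have finAB: "finite ?A" "finite ?B" using finite_cliques by auto
  have "\<K> = ?A \<union> ?B" using side by blast
  then have sAB: "?s \<le> card ?A + card ?B" by (metis card_Un_le)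
  have "?A = {} \<or> ?B = {}"
  proof (rule ccontr)
    assume "\<not> (?A = {} \<or> ?B = {})"
    then have p: "1 \<le> card ?A" "1 \<le> card ?B" using finAB by (simp_all add: Suc_leI card_gt_0_iff)
    \<comment> \<open>Written as successors, the inequality \<open>a + b <= 2 * (a * b)\<close> for
      positive numbers is left to simplification.\<close>
    obtain x y where xy: "card ?A = Suc x" "card ?B = Suc y" using p by (metis Suc_le_D One_nat_def)
    have "?s \<le> 2 * (card ?A * card ?B)" using sAB unfolding xy by simp
    then have "card E + 2 * ?s \<le> 2 * (card X * card Y)"
      using opposite_triples_bound[OF tri dis XY(1,2) E] bipartite_card_E[OF XY(1,2) E] by linarith
    also have "\<dots> \<le> 2 * (?n\<^sup>2 div 4)" using mult_le_square_div_4[of "card X" "card Y"] cXY by simp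
    finally show False using W2 by linarith
  qed
  then show ?thesis
  proof
    assume "?A = {}"
    then have "\<Union>\<K> \<subseteq> Y" using side by blast
    then show ?thesis using that[OF YX] by blast
  next
    assume "?B = {}"
    then have "\<Union>\<K> \<subseteq> X" using side by blast
    then show ?thesis using that[OF XY(1,2) E] by blast
  qed
qed

text \<open>Below \<open>2 * tri_max\<close> the claim is \<open>relaxed_max_ge\<close>; from there
  on the structure theorem reduces it to \<open>product_le_relaxed_max\<close>.\<close>

lemma disjoint_triples_bound:
  assumes tri: "\<forall>K\<in>\<K>. card K = 3" and dis: "disjoint \<K>"
    and n: "11 \<le> card V"
  shows "weight2 \<le> 2 * relaxed_max (card V)"
proof (cases "2 * tri_max (card V) \<le> int weight2")
  case True
  then obtain P R where PR: "P \<union> R = V" "P \<inter> R = {}" "E \<subseteq> P \<times> R \<union> R \<times> P" "\<Union>\<K> \<subseteq> P"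
    using disjoint_triples_structure[OF assms] by metis
  have fin: "finite P" "finite R" using PR(1) finite_V by (metis finite_Un)+
  have "3 * card \<K> \<le> card P" using card_disjoint_triples(1)[OF tri dis PR(4) fin(1)] .
  then have s: "card \<K> \<le> card P div 3" by simp
  have "card (E \<inter> P \<times> R) \<le> card (P \<times> R)" using fin by (intro card_mono) auto
  then have "card (E \<inter> P \<times> R) + card \<K> \<le> card P * card R + card P div 3"
    using s by (simp add: card_cartesian_product add_mono)
  also have "\<dots> \<le> relaxed_max (card V)"
    using product_le_relaxed_max[of "card P" "card R"] PR(1,2) fin by (metis card_Un_disjoint)
  finally show ?thesis unfolding weight2_triples[OF tri] bipartite_card_E[OF PR(1-3)] by simp
next
  case False
  then have "int weight2 \<le> int (2 * relaxed_max (card V))" using relaxed_max_ge[of "card V"] by simp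
  then show ?thesis by (simp only: of_nat_le_iff)
qed

end

section \<open>Sharp bounds and extremal clique systems\<close>

theorem triples_bound:
  assumes "clique_system V E \<K>" "\<forall>K\<in>\<K>. card K = 3"
  shows "clique_system.weight2 E \<K> \<le> 2 * relaxed_max (card V) + 4"
  using assms
proof (induction "card V" arbitrary: V E \<K> rule: less_induct)
  case less
  interpret clique_system V E \<K> by fact
  note tri = less.prems(2)
  consider (overlap) T T' a where "T \<in> \<K>" "T' \<in> \<K>" "T \<noteq> T'" "a \<in> T" "a \<in> T'"
    | (small) "disjoint \<K>" "card V < 11" | (large) "disjoint \<K>" "11 \<le> card V"
    unfolding disjoint_def by (metis disjoint_iff not_le)
  then show ?case
  proof cases
    case overlap
    let ?S = "(T \<union> T') - {a}"
    have S: "card ?S = 4" "?S \<subseteq> V" using overlap_degree_sum(1)[OF tri overlap] K_sub overlap by auto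
    then have "finite ?S" "card ?S \<le> card V" using finite_V finite_subset card_mono by blast+
    then have c: "card (V - ?S) = card V - 4" "4 \<le> card V" using S by (simp_all add: card_Diff_subset)
    have "\<forall>K\<in>restrK \<K> ?S. card K = 3"
      by (rule restrK_triples[OF tri])
    moreover have "card (V - ?S) < card V" using c by simp
    ultimately have "clique_system.weight2 (restrE E ?S) (restrK \<K> ?S) \<le> 2 * relaxed_max (card V - 4) + 4"
      using less.hyps[OF _ restr[of ?S]] unfolding c(1) by blast
    then show ?thesis using delete_overlap[OF tri overlap] relaxed_max_4[of "card V - 4"] c(2) by simp
  next
    case small
    have "3 * card \<K> \<le> card V" using card_disjoint_triples(1)[OF tri small(1) _ finite_V] K_sub by blast
    then have K: "card \<K> \<le> card V div 3" by simp
    have "card \<K> \<le> (card V + 1) div 2 div 3 + 2"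
    proof (cases "card V < 9")
      case True
      then have "card V div 3 \<le> 8 div 3" by (intro div_le_mono) simp
      then show ?thesis using K by simp
    next
      case False
      then have "10 div 2 div 3 \<le> (card V + 1) div 2 div 3" by (intro div_le_mono) simp
      moreover have "card V div 3 \<le> 10 div 3" using small by (intro div_le_mono) simp
      ultimately show ?thesis using K by simp
    qed
    then show ?thesis using mantel unfolding weight2_triples[OF tri] relaxed_max_def by simp
  next
    case large
    then show ?thesis using disjoint_triples_bound[OF tri] by simp
  qed
qed

text \<open>Overlapping triples are excluded numerically: the deletion gains 8, more than the
  surplus 4 of \<open>triples_bound\<close> and the gap of 2 between \<open>2 * relaxed_max\<close>
  and \<open>2 * tri_max\<close> together.\<close>

theorem extremal_clique_system:
  assumes "clique_system V E \<K>" "11 \<le> card V"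
    "2 * tri_max (card V) \<le> int (clique_system.weight2 E \<K>)"
  obtains P R where "P \<union> R = V" "P \<inter> R = {}" "E \<subseteq> P \<times> R \<union> R \<times> P" "\<Union>\<K> \<subseteq> P"
    "\<forall>K\<in>\<K>. card K = 3" "disjoint \<K>"
proof -
  interpret clique_system V E \<K> by fact
  have tri: "\<forall>K\<in>\<K>. card K = 3"
    using large_clique_weight2[OF assms(1) _ _ assms(2)] assms(3) K_ge3 by (metis le_neq_implies_less leD)
  have dis: "disjoint \<K>"
  proof (rule ccontr)
    assume "\<not> disjoint \<K>"
    then obtain T T' a where overlap: "T \<in> \<K>" "T' \<in> \<K>" "T \<noteq> T'" "a \<in> T" "a \<in> T'"
      unfolding disjoint_def by blast
    let ?S = "(T \<union> T') - {a}"
    have S: "card ?S = 4" "?S \<subseteq> V" using overlap_degree_sum(1)[OF tri overlap] K_sub overlap by auto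
    then have "finite ?S" "card ?S \<le> card V" using finite_V finite_subset card_mono by blast+
    then have c: "card (V - ?S) = card V - 4" "4 \<le> card V" using S by (simp_all add: card_Diff_subset)
    have "\<forall>K\<in>restrK \<K> ?S. card K = 3"
      by (rule restrK_triples[OF tri])
    then have "clique_system.weight2 (restrE E ?S) (restrK \<K> ?S) \<le> 2 * relaxed_max (card V - 4) + 4"
      using triples_bound[OF restr[of ?S]] c by simp
    then have "weight2 + 4 \<le> 2 * relaxed_max (card V)"
      using delete_overlap[OF tri overlap] relaxed_max_4[of "card V - 4"] c by simp
    then have "int (weight2 + 4) \<le> int (2 * relaxed_max (card V))" by (simp only: of_nat_le_iff)
    then show False using assms(3) relaxed_max_le[of "card V"] by simp
  qed
  show ?thesis
    using disjoint_triples_structure[OF tri dis assms(2,3)] that tri dis by metis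
qed

section \<open>Triangles in graphs without a squared path\<close>

definition clique :: "('a \<times> 'a) set \<Rightarrow> 'a set \<Rightarrow> bool" where
  "clique G S \<longleftrightarrow> (\<forall>x\<in>S. \<forall>y\<in>S. x \<noteq> y \<longrightarrow> (x, y) \<in> G)"

definition cliques_of_size :: "'a set \<Rightarrow> ('a \<times> 'a) set \<Rightarrow> nat \<Rightarrow> 'a set set" where
  "cliques_of_size V G k = {S. S \<subseteq> V \<and> card S = k \<and> clique G S}"

lemma card_3_two:
  assumes "card T = 3" "x \<in> T" "y \<in> T" "x \<noteq> y"
  obtains z where "T = {x, y, z}" "z \<noteq> x" "z \<noteq> y"
proof -
  have "card (T - {x, y}) = 1" using assms by (simp add: card_Diff_subset)
  then obtain z where "T - {x, y} = {z}" by (meson card_1_singletonE)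
  then show ?thesis using assms by (intro that[of z]) auto
qed

lemma card_4_two:
  assumes "card K = 4" "x \<in> K" "y \<in> K" "x \<noteq> y"
  obtains z w where "K = {x, y, z, w}" "z \<noteq> x" "z \<noteq> y" "w \<noteq> x" "w \<noteq> y" "z \<noteq> w"
proof -
  have "card (K - {x, y}) = 2" using assms by (simp add: card_Diff_subset)
  then obtain z w where "K - {x, y} = {z, w}" "z \<noteq> w" by (meson card_2_iff)
  then show ?thesis using assms by (intro that[of z w]) auto
qed

lemma card_5_two:
  assumes "card K = 5" "x \<in> K" "y \<in> K" "x \<noteq> y"
  obtains z w u where "K = {x, y, z, w, u}" "distinct [x, y, z, w, u]"
proof -
  have "card (K - {x, y}) = 3" using assms by (simp add: card_Diff_subset)
  then obtain z w u where "K - {x, y} = {z, w, u}" "z \<noteq> w" "z \<noteq> u" "w \<noteq> u" by (auto simp: card_3_iff)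
  then show ?thesis using assms by (intro that[of z w u]) auto
qed

text \<open>Bare vertex and arc sets allow the same setting to be instantiated again once the arcs
  of the K5s are removed.\<close>

locale p6_free_graph =
  fixes V :: "'a set" and G :: "('a \<times> 'a) set"
  assumes finite_V: "finite V"
    and G_sub: "G \<subseteq> V \<times> V"
    and G_sym: "(x, y) \<in> G \<Longrightarrow> (y, x) \<in> G"
    and G_irrefl: "(x, x) \<notin> G"
    and no_p6: "distinct [a, b, c, d, e, f] \<Longrightarrow> {(a, b), (a, c), (b, c), (b, d), (c, d), (c, e), (d, e), (d, f), (e, f)} \<subseteq> G
      \<Longrightarrow> False"
begin

lemma G_commute: "(x, y) \<in> G \<longleftrightarrow> (y, x) \<in> G"
  using G_sym by blast

abbreviation "tris \<equiv> cliques_of_size V G 3"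
abbreviation "quads \<equiv> cliques_of_size V G 4"
abbreviation "fives \<equiv> cliques_of_size V G 5"

lemma finite_cliques_of_size: "finite (cliques_of_size V G k)"
  unfolding cliques_of_size_def using finite_V by auto

lemma clique_edge: "S \<in> cliques_of_size V G k \<Longrightarrow> x \<in> S \<Longrightarrow> y \<in> S \<Longrightarrow> x \<noteq> y \<Longrightarrow> (x, y) \<in> G"
  unfolding cliques_of_size_def clique_def by blast

text \<open>\<open>v, x, y\<close> followed by the other three vertices of \<open>Q\<close> is a
  squared path.\<close>

lemma five_nbr:
  assumes "Q \<in> fives" "v \<notin> Q" "x \<in> Q" "y \<in> Q" "x \<noteq> y" "(v, x) \<in> G" "(v, y) \<in> G"
  shows False
proof -
  have c: "card Q = 5" using assms(1) unfolding cliques_of_size_def by blast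
  obtain a b d where Q: "Q = {x, y, a, b, d}" "distinct [x, y, a, b, d]"
    using card_5_two[OF c assms(3-5)] .
  note E = clique_edge[OF assms(1)]
  show False
    by (rule no_p6[of v x y a b d]) (use Q assms E in \<open>auto simp: G_commute\<close>)
qed

text \<open>The K4 supplies the last two triangles \<open>b, a, c\<close> and \<open>a, c, d\<close>
  of the squared path \<open>y, x, b, a, c, d\<close>, so two further triangles leaving it are
  enough.\<close>

lemma quad_no_tail:
  assumes K: "clique G {a, b, c, d}" "distinct [a, b, c, d, x, y]"
    and e: "(x, a) \<in> G" "(x, b) \<in> G" "(y, x) \<in> G" "(y, b) \<in> G"
  shows False
  by (rule no_p6[of y x b a c d]) (use assms in \<open>auto simp: clique_def G_commute\<close>)

definition light :: "'a \<Rightarrow> 'a \<Rightarrow> bool" where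
  "light x y \<longleftrightarrow> (x, y) \<in> G \<and> (\<exists>!w. (x, w) \<in> G \<and> (y, w) \<in> G)"

lemma light_sym: "light x y \<Longrightarrow> light y x"
  unfolding light_def using G_sym by blast

lemma light_unique: "light x y \<Longrightarrow> (x, v) \<in> G \<Longrightarrow> (y, v) \<in> G \<Longrightarrow> (x, w) \<in> G \<Longrightarrow> (y, w) \<in> G \<Longrightarrow> v = w"
  unfolding light_def by blast

text \<open>A light edge determines its triangle, so choosing one for each good triangle is
  injective.\<close>

definition good :: "'a set set" where
  "good = {S \<in> tris. \<exists>x\<in>S. \<exists>y\<in>S. light x y}"

definition bad :: "'a set set" where
  "bad = tris - good"

text \<open>In the absence of K5s, K4s that share an edge share a triangle, and the condition
  singles out that triangle. Bad triangles in no K4 also qualify, as do all four triangles of a K4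
  sharing no edge with another one.\<close>

definition cores :: "'a set set" where
  "cores = {T \<in> bad. \<forall>K\<in>quads. \<forall>x\<in>T \<inter> K. \<forall>y\<in>T \<inter> K. x \<noteq> y \<longrightarrow> T \<subseteq> K}"

lemma light_not_in_bad: "light x y \<Longrightarrow> S \<in> bad \<Longrightarrow> x \<in> S \<Longrightarrow> y \<in> S \<Longrightarrow> False"
  unfolding bad_def good_def by blast

lemma bad_tri: "S \<in> bad \<Longrightarrow> S \<in> tris"
  unfolding bad_def by blast

lemma core_bad: "T \<in> cores \<Longrightarrow> T \<in> bad"
  unfolding cores_def by blast

lemma core_quad: "T \<in> cores \<Longrightarrow> K \<in> quads \<Longrightarrow> x \<in> T \<Longrightarrow> x \<in> K \<Longrightarrow> y \<in> T \<Longrightarrow> y \<in> K \<Longrightarrow> x \<noteq> y \<Longrightarrow> T \<subseteq> K"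
  unfolding cores_def by blast

lemma triI: "(x, y) \<in> G \<Longrightarrow> (x, z) \<in> G \<Longrightarrow> (y, z) \<in> G \<Longrightarrow> {x, y, z} \<in> tris"
  unfolding cliques_of_size_def clique_def using G_sub G_sym G_irrefl by (auto simp: card_insert_if)

lemma quadI: "T \<in> tris \<Longrightarrow> T \<subseteq> G `` {z} \<Longrightarrow> insert z T \<in> quads \<and> z \<notin> T"
proof -
  assume T: "T \<in> tris" "T \<subseteq> G `` {z}"
  have z: "z \<notin> T" using T G_irrefl by blast
  moreover have "finite T" "card T = 3" using T unfolding cliques_of_size_def by (auto intro: card_ge_0_finite)
  moreover have "T \<noteq> {}" using calculation by auto
  ultimately show ?thesis
    using T G_sub G_sym unfolding cliques_of_size_def clique_def by auto
qed

lemma quad_not_light: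
  assumes "K \<in> quads" "x \<in> K" "y \<in> K" "light x y"
  shows False
proof -
  have xy: "x \<noteq> y" using assms G_irrefl unfolding light_def by blast
  have "card K = 4" using assms unfolding cliques_of_size_def by blast
  then obtain z w where K: "K = {x, y, z, w}" "z \<noteq> x" "z \<noteq> y" "w \<noteq> x" "w \<noteq> y" "z \<noteq> w"
    using card_4_two[OF _ assms(2,3) xy] by metis
  then show False using light_unique[OF assms(4), of z w] clique_edge[OF assms(1)] by blast
qed

lemma sub_quad_bad:
  assumes "K \<in> quads" "S \<subseteq> K" "card S = 3"
  shows "S \<in> bad"
proof -
  have "S \<in> tris" using assms unfolding cliques_of_size_def clique_def by blast
  then show ?thesis using quad_not_light[OF assms(1)] assms(2) unfolding bad_def good_def by blast
qed

lemma bad_extend: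
  assumes "S \<in> bad" "S = {x, y, z}" "x \<noteq> y" "x \<noteq> z" "y \<noteq> z"
  obtains w where "(x, w) \<in> G" "(y, w) \<in> G" "w \<notin> S"
proof -
  note E = clique_edge[OF bad_tri[OF assms(1)]]
  have "\<not> light x y" using light_not_in_bad[OF _ assms(1)] assms by blast
  moreover have "(x, y) \<in> G" "(x, z) \<in> G" "(y, z) \<in> G" using E assms by auto
  ultimately obtain w where "(x, w) \<in> G" "(y, w) \<in> G" "w \<noteq> z" unfolding light_def by blast
  then show ?thesis using assms(2) G_irrefl by (intro that[of w]) auto
qed

text \<open>A vertex seeing exactly two vertices of a core is joined to them by light edges: any further
  triangle on such an edge extends to a squared path on six vertices.\<close>

lemma core_partial_light:
  assumes T: "T \<in> cores" and x: "x \<notin> T" and ab: "a \<in> T" "b \<in> T" "a \<noteq> b"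
    and e: "(x, a) \<in> G" "(x, b) \<in> G" and n: "\<not> T \<subseteq> G `` {x}"
  shows "light x a"
proof (rule ccontr)
  assume nl: "\<not> light x a"
  have TB: "T \<in> bad" "T \<in> tris" using T core_bad bad_tri by blast+
  then have cT: "card T = 3" unfolding cliques_of_size_def by blast
  obtain c where c: "T = {a, b, c}" "c \<noteq> a" "c \<noteq> b" using card_3_two[OF cT ab] .
  have xc: "(x, c) \<notin> G" using n c e by auto
  have T': "(a, b) \<in> G" "(b, a) \<in> G" "(a, c) \<in> G" "(b, c) \<in> G" "(c, a) \<in> G" "(c, b) \<in> G"
    using clique_edge[OF TB(2)] c ab by auto
  obtain w where w: "(x, w) \<in> G" "(a, w) \<in> G" "w \<noteq> b"
    using nl e T' unfolding light_def by blast
  have wne: "w \<noteq> c" "w \<noteq> a" "w \<noteq> x" using w xc G_irrefl by blast+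
  show False
  \<comment> \<open>If \<open>T\<close> extends to a K4, then \<open>x\<close> and \<open>w\<close>
    form a forbidden tail of it. Otherwise \<open>T\<close> is prolonged across the edge
    \<open>bc\<close> by some \<open>y\<close>, and \<open>w, x, a, b, c, y\<close> is a squared
    path.\<close>
  proof (cases "\<exists>d. T \<subseteq> G `` {d}")
    case True
    then obtain d where d: "T \<subseteq> G `` {d}" by blast
    have dT: "d \<notin> T" using quadI[OF TB(2) d] by blast
    have dx: "d \<noteq> x" using d n by blast
    have Gd: "(d, a) \<in> G" "(d, b) \<in> G" "(d, c) \<in> G" using d c by auto
    show False
    proof (cases "w = d")
      case True
      \<comment> \<open>With \<open>w = d\<close> the vertices \<open>x, a, b, d\<close> form a K4
        that contains \<open>a\<close> and \<open>b\<close> but not \<open>c\<close>, which no core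
        allows.\<close>
      have "{a, b, d} \<in> tris" using triI[of a b d] T' Gd G_sym by blast
      moreover have "{a, b, d} \<subseteq> G `` {x}" using e w True by blast
      ultimately have "insert x {a, b, d} \<in> quads" using quadI by blast
      then have "T \<subseteq> insert x {a, b, d}" using core_quad[OF T, of _ a b] ab by blast
      then show False using c x dT by blast
    next
      case False
      show False
        by (rule quad_no_tail[of b a c d x w])
          (use False w wne Gd T' c x dT dx e ab in \<open>auto simp: clique_def G_commute\<close>)
    qed
  next
    case False
    obtain y where y: "(b, y) \<in> G" "(c, y) \<in> G" "y \<notin> T"
      using bad_extend[OF TB(1), of b c a] c ab by blast
    have "(y, a) \<notin> G" using False y c G_sym by blast
    then have ya: "w \<noteq> y" using w G_sym by blast
    have "y \<noteq> x" using y xc G_sym by blast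
    then show False
      by (intro no_p6[of w x a b c y]) (use ya w wne y T' c x e ab in \<open>auto simp: G_commute\<close>)
  qed
qed

end

section \<open>Cores and K4s in graphs without K5\<close>

locale k5_free_graph = p6_free_graph +
  assumes no_fives: "fives = {}"
begin

lemma no_five:
  assumes T: "T \<in> tris" "T \<subseteq> G `` {x}" "T \<subseteq> G `` {y}" "(x, y) \<in> G"
  shows False
proof -
  have x: "insert x T \<in> quads" "x \<notin> T" "y \<notin> T" using quadI[OF T(1)] T(2,3) by blast+
  have fin: "finite T" "card T = 3" using T unfolding cliques_of_size_def by (auto intro: card_ge_0_finite)
  have "x \<noteq> y" using T(4) G_irrefl by blast
  then have "card (insert y (insert x T)) = 5" using x fin by simp
  moreover have "insert y (insert x T) \<subseteq> V" using x(1) T(4) G_sub unfolding cliques_of_size_def by blast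
  moreover have "clique G (insert y (insert x T))"
    using x(1) T G_sym unfolding cliques_of_size_def clique_def by blast
  ultimately have "insert y (insert x T) \<in> fives" unfolding cliques_of_size_def by blast
  then show False using no_fives by blast
qed

text \<open>If the K4s had just \<open>x\<close> and \<open>y\<close> in common, two vertices of the
  second would be a tail of the first, against \<open>quad_no_tail\<close>.\<close>

lemma quads_meet:
  assumes K: "K \<in> quads" "L \<in> quads" "K \<noteq> L" "x \<in> K" "x \<in> L" "y \<in> K" "y \<in> L" "x \<noteq> y"
  obtains z u v where "K = {x, y, z, u}" "L = {x, y, z, v}" "distinct [x, y, z, u, v]"
proof -
  have c: "card K = 4" "card L = 4" using K unfolding cliques_of_size_def by auto
  obtain p q where p: "K = {x, y, p, q}" "p \<noteq> x" "p \<noteq> y" "q \<noteq> x" "q \<noteq> y" "p \<noteq> q"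
    using card_4_two[OF c(1) K(4,6,8)] .
  obtain r s where r: "L = {x, y, r, s}" "r \<noteq> x" "r \<noteq> y" "s \<noteq> x" "s \<noteq> y" "r \<noteq> s"
    using card_4_two[OF c(2) K(5,7,8)] .
  have "{p, q} \<inter> {r, s} \<noteq> {}"
  proof
    assume "{p, q} \<inter> {r, s} = {}"
    then show False
      using quad_no_tail[of x y p q r s] clique_edge[OF K(1)] clique_edge[OF K(2)] p r K(8)
      unfolding clique_def by (auto simp: G_commute)
  qed
  then consider "p = r" | "p = s" | "q = r" | "q = s" by blast
  then show ?thesis
  proof cases
    case 1 then show ?thesis using p r K(3,8) by (intro that[of p q s]) auto
  next
    case 2 then show ?thesis using p r K(3,8) by (intro that[of p q r]) auto
  next
    case 3 then show ?thesis using p r K(3,8) by (intro that[of q p s]) auto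
  next
    case 4 then show ?thesis using p r K(3,8) by (intro that[of q p r]) auto
  qed
qed

text \<open>If another K4 shares an edge with \<open>K\<close>, the common triangle is a core: a
  third K4 meeting it in an edge without containing it would by \<open>quads_meet\<close> contain
  both \<open>u\<close> and \<open>v\<close>, which are not adjacent because there is no K5. If
  there is no such K4, any triangle of \<open>K\<close> is a core.\<close>

lemma quad_contains_core:
  assumes K: "K \<in> quads"
  obtains T where "T \<in> cores" "T \<subseteq> K"
proof (cases "\<exists>L\<in>quads. L \<noteq> K \<and> (\<exists>x\<in>K \<inter> L. \<exists>y\<in>K \<inter> L. x \<noteq> y)")
  case True
  then obtain L x y where L: "L \<in> quads" "K \<noteq> L" "x \<in> K" "x \<in> L" "y \<in> K" "y \<in> L" "x \<noteq> y" by blast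
  obtain z u v where z: "K = {x, y, z, u}" "L = {x, y, z, v}" "distinct [x, y, z, u, v]"
    using quads_meet[OF K L] .
  let ?T = "{x, y, z}"
  have c: "card ?T = 3" using z by simp
  then have B: "?T \<in> bad" using sub_quad_bad[OF K _ c] z by blast
  have uv: "(u, v) \<notin> G"
    using no_five[of ?T u v] bad_tri[OF B] clique_edge[OF K] clique_edge[OF L(1)] z by auto
  have "?T \<subseteq> M" if M: "M \<in> quads" "a \<in> ?T" "b \<in> ?T" "a \<in> M" "b \<in> M" "a \<noteq> b" for M a b
  proof (rule ccontr)
    assume n: "\<not> ?T \<subseteq> M"
    obtain t where t: "?T = {a, b, t}" "t \<noteq> a" "t \<noteq> b" using card_3_two[OF c M(2,3,6)] .
    have "K \<noteq> M" "L \<noteq> M" using n z by auto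
    have in_M: "p \<in> M" if L: "L \<in> quads" "L \<noteq> M" "L = insert p ?T" for L p
    proof -
      have "a \<in> L" "b \<in> L" using L(3) M by blast+
      then obtain r p' q' where r: "L = {a, b, r, p'}" "M = {a, b, r, q'}" "distinct [a, b, r, p', q']"
        using quads_meet[OF L(1) M(1) L(2) _ M(4) _ M(5,6)] by metis
      have "r \<in> insert p ?T" using r L by blast
      moreover have "r \<noteq> t" using n t r by blast
      ultimately show ?thesis using r t by auto
    qed
    have "u \<in> M" "v \<in> M" using in_M[OF K, of u] in_M[OF L(1), of v] \<open>K \<noteq> M\<close> \<open>L \<noteq> M\<close> z by auto
    then show False using clique_edge[OF M(1), of u v] uv z by simp
  qed
  then have "?T \<in> cores" unfolding cores_def using B by blast
  then show ?thesis using that z by blast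
next
  case False
  have "card K = 4" using K unfolding cliques_of_size_def by blast
  then obtain T where T: "T \<subseteq> K" "card T = 3" using obtain_subset_with_card_n[of 3 K] by auto
  have "T \<in> bad" using sub_quad_bad[OF K T] .
  then have "T \<in> cores" unfolding cores_def using False T by blast
  then show ?thesis using that T by blast
qed

text \<open>Let a K4 \<open>a, b, x, y\<close> meet \<open>B\<close> in \<open>a, b\<close> only,
  with third vertex \<open>t\<close>. The edge \<open>bt\<close> is not light, so it lies in a
  second triangle \<open>b, t, w\<close>, and \<open>y, x, a, b, t, w\<close> is a squared path;
  \<open>w\<close> differs from \<open>x\<close> and \<open>y\<close> because neither sees
  \<open>t\<close>.\<close>

lemma bad_outside_quads_core:
  assumes B: "B \<in> bad" and n: "\<And>K. K \<in> quads \<Longrightarrow> \<not> B \<subseteq> K"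
  shows "B \<in> cores"
proof -
  have c: "card B = 3" using bad_tri[OF B] unfolding cliques_of_size_def by blast
  have False if K: "K \<in> quads" "a \<in> B" "b \<in> B" "a \<in> K" "b \<in> K" "a \<noteq> b" for K a b
  proof -
    obtain t where t: "B = {a, b, t}" "t \<noteq> a" "t \<noteq> b" using card_3_two[OF c K(2,3,6)] .
    have "card K = 4" using K unfolding cliques_of_size_def by blast
    then obtain x y where xy: "K = {a, b, x, y}" "x \<noteq> a" "x \<noteq> b" "y \<noteq> a" "y \<noteq> b" "x \<noteq> y"
      using card_4_two[OF _ K(4,5,6)] by metis
    have tK: "t \<notin> K" using n[OF K(1)] t K by blast
    obtain w where w: "(b, w) \<in> G" "(t, w) \<in> G" "w \<notin> B"
      using bad_extend[OF B, of b t a] t K(6) by blast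
    note E = clique_edge[OF K(1)] and F = clique_edge[OF bad_tri[OF B]]
    have nt: "(v, t) \<notin> G" if "v \<in> {x, y}" for v
    proof
      assume "(v, t) \<in> G"
      then have "B \<subseteq> G `` {v}" using that t xy E by auto
      then show False using quadI[OF bad_tri[OF B]] n by blast
    qed
    then have "w \<noteq> x" "w \<noteq> y" using w G_sym by blast+
    then show False
      by (intro no_p6[of y x a b t w]) (use t xy tK w E F K(6) in \<open>auto simp: G_commute\<close>)
  qed
  then show ?thesis using B unfolding cores_def by blast
qed

end

section \<open>Charging triangles to edges\<close>

text \<open>Cores may share edges, as in an isolated K4, but a clique system permits only single
  common vertices. Hence a maximal family of cores of this kind is selected; by \<open>T_max\<close>
  every core shares an edge with a selected one.\<close>

locale core_selection = k5_free_graph V G for V :: "'a set" and G +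
  fixes \<T> :: "'a set set" and sel :: "'a set \<Rightarrow> 'a \<times> 'a"
  assumes T_cores: "\<T> \<subseteq> cores"
    and T_share: "T \<in> \<T> \<Longrightarrow> U \<in> \<T> \<Longrightarrow> T \<noteq> U \<Longrightarrow> x \<in> T \<Longrightarrow> x \<in> U \<Longrightarrow> y \<in> T \<Longrightarrow> y \<in> U \<Longrightarrow> x = y"
    and T_max: "B \<in> cores \<Longrightarrow> \<exists>T\<in>\<T>. \<exists>x\<in>T \<inter> B. \<exists>y\<in>T \<inter> B. x \<noteq> y"
    and sel: "S \<in> good \<Longrightarrow> fst (sel S) \<in> S \<and> snd (sel S) \<in> S \<and> light (fst (sel S)) (snd (sel S))"
begin

definition light_arcs :: "('a \<times> 'a) set" where
  "light_arcs = sel ` good \<union> (sel ` good)\<inverse>"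

definition core_arcs :: "'a set \<Rightarrow> ('a \<times> 'a) set" where
  "core_arcs T = T \<times> {z. T \<subseteq> G `` {z}} \<union> {z. T \<subseteq> G `` {z}} \<times> T"

definition selected_arcs :: "('a \<times> 'a) set" where
  "selected_arcs = light_arcs \<union> (\<Union>T\<in>\<T>. core_arcs T)"

lemma T_tri: "T \<in> \<T> \<Longrightarrow> T \<in> tris"
  using T_cores core_bad bad_tri by blast

lemma light_edge: "light x y \<Longrightarrow> (x, y) \<in> G"
  unfolding light_def by blast

lemma light_arcs_light: "(x, y) \<in> light_arcs \<Longrightarrow> light x y"
proof -
  assume "(x, y) \<in> light_arcs"
  then obtain S where S: "S \<in> good" "sel S = (x, y) \<or> sel S = (y, x)" unfolding light_arcs_def by force
  show "light x y" using S(2) sel[OF S(1)] light_sym[of y x] by auto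
qed

text \<open>Only one triangle contains a light edge, so the triangle that selected the arc is the
  one completed by any common neighbour \<open>z\<close>.\<close>

lemma light_arcs_sel:
  assumes "(x, y) \<in> light_arcs" "(x, z) \<in> G" "(y, z) \<in> G"
  shows "{x, y, z} \<in> good \<and> (sel {x, y, z} = (x, y) \<or> sel {x, y, z} = (y, x))"
proof -
  obtain S where S: "S \<in> good" "sel S = (x, y) \<or> sel S = (y, x)"
    using assms(1) unfolding light_arcs_def by force
  have "x \<in> S" "y \<in> S" using sel[OF S(1)] S(2) by auto
  have l: "light x y" using light_arcs_light assms(1) .
  then have xy: "x \<noteq> y" using G_irrefl light_edge by blast
  have tri: "S \<in> tris" "card S = 3" using S(1) unfolding good_def cliques_of_size_def by blast+
  obtain w where w: "S = {x, y, w}" "w \<noteq> x" "w \<noteq> y" using card_3_two[OF tri(2) \<open>x \<in> S\<close> \<open>y \<in> S\<close> xy] .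
  have "w = z" using light_unique[OF l _ _ assms(2,3)] clique_edge[OF tri(1)] w by blast
  then show ?thesis using S w by blast
qed

lemma core_arcs_quad:
  assumes "T \<in> \<T>" "(x, y) \<in> core_arcs T"
  obtains z where "T \<subseteq> G `` {z}" "insert z T \<in> quads" "z \<notin> T" "x \<in> insert z T" "y \<in> insert z T" "x \<noteq> y"
    "x = z \<and> y \<in> T \<or> y = z \<and> x \<in> T"
proof -
  obtain z where z: "T \<subseteq> G `` {z}" "x = z \<and> y \<in> T \<or> y = z \<and> x \<in> T"
    using assms(2) unfolding core_arcs_def by blast
  then show ?thesis using that[OF z(1)] quadI[OF T_tri[OF assms(1)] z(1)] by blast
qed

lemma core_arcs_not_light: "T \<in> \<T> \<Longrightarrow> (x, y) \<in> core_arcs T \<Longrightarrow> \<not> light x y"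
  by (elim core_arcs_quad) (auto dest: quad_not_light)

lemma two_cores_not_in_quad:
  assumes "T \<in> \<T>" "U \<in> \<T>" "T \<noteq> U" "K \<in> quads" "T \<subseteq> K" "U \<subseteq> K"
  shows False
proof -
  have c: "card T = 3" "card U = 3" "card K = 4" using T_tri[OF assms(1)] T_tri[OF assms(2)] assms(4)
    unfolding cliques_of_size_def by auto
  then have fin: "finite T" "finite U" "finite K" by (auto intro: card_ge_0_finite)
  have "card (T \<union> U) \<le> 4" using c fin assms by (metis Un_least card_mono)
  then have "2 \<le> card (T \<inter> U)" using card_Un_Int[OF fin(1,2)] c by linarith
  then have "\<not> card (T \<inter> U) \<le> Suc 0" by simp
  then obtain x y where "x \<in> T \<inter> U" "y \<in> T \<inter> U" "x \<noteq> y"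
    using fin by (auto simp: card_le_Suc0_iff_eq)
  then show False using T_share[OF assms(1-3)] by blast
qed

text \<open>A core arc lies in the K4 formed by \<open>T\<close> and a common neighbour. A second
  core on it would lie in this K4 as well, and two triples within four points share an edge.\<close>

lemma core_arcs_not_in_core:
  assumes "T \<in> \<T>" "(x, y) \<in> core_arcs T" "U \<in> \<T>" "x \<in> U" "y \<in> U"
  shows False
proof (rule core_arcs_quad[OF assms(1,2)])
  fix z assume z: "insert z T \<in> quads" "z \<notin> T" "x \<in> insert z T" "y \<in> insert z T" "x \<noteq> y"
    "x = z \<and> y \<in> T \<or> y = z \<and> x \<in> T"
  have "U \<subseteq> insert z T" using core_quad[OF _ z(1)] T_cores assms z by blast
  moreover have "T \<noteq> U" using z assms by blast
  ultimately show False using two_cores_not_in_quad[OF assms(1,3) _ z(1)] by blast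
qed

text \<open>The arc lies in a K4 over \<open>T\<close> and a K4 over \<open>U\<close>. If these
  differ, they share a third vertex; then \<open>T\<close> meets the second K4 in an edge and lies
  in it, next to \<open>U\<close>.\<close>

lemma core_arcs_disjoint:
  assumes "T \<in> \<T>" "U \<in> \<T>" "T \<noteq> U" "(x, y) \<in> core_arcs T" "(x, y) \<in> core_arcs U"
  shows False
proof (rule core_arcs_quad[OF assms(1,4)])
  fix z assume z: "insert z T \<in> quads" "z \<notin> T" "x \<in> insert z T" "y \<in> insert z T" "x \<noteq> y"
    "x = z \<and> y \<in> T \<or> y = z \<and> x \<in> T"
  show False
  proof (rule core_arcs_quad[OF assms(2,5)])
    fix w assume w: "insert w U \<in> quads" "w \<notin> U" "x \<in> insert w U" "y \<in> insert w U"
      "x = w \<and> y \<in> U \<or> y = w \<and> x \<in> U"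
    show False
    proof (cases "insert z T = insert w U")
      case True
      then show False using two_cores_not_in_quad[OF assms(1-3) z(1)] by blast
    next
      case False
      obtain r u v where r: "insert z T = {x, y, r, u}" "insert w U = {x, y, r, v}" "distinct [x, y, r, u, v]"
        using quads_meet[OF z(1) w(1) False z(3) w(3) z(4) w(4) z(5)] .
      have rT: "r \<in> T" "r \<in> insert w U" using r z by auto
      obtain t where t: "t \<in> T" "t \<in> insert w U" "t \<noteq> r" using z(6) w(3,4) r(3) by auto
      have "T \<subseteq> insert w U" using core_quad[OF _ w(1) t(1,2) rT t(3)] assms(1) T_cores by blast
      then show False using two_cores_not_in_quad[OF assms(1-3) w(1)] by blast
    qed
  qed
qed

text \<open>If \<open>B\<close> lies in a K4, a core in that K4 shares an edge with a selected core
  \<open>T\<close>, which is thereby also in the K4. Otherwise \<open>B\<close> is a core and shares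
  an edge with a selected \<open>T\<close>; were they different, the third vertex of
  \<open>B\<close> would see just two vertices of \<open>T\<close>, and
  \<open>core_partial_light\<close> would give \<open>B\<close> a light edge.\<close>

lemma bad_covered:
  assumes B: "B \<in> bad"
  obtains T where "T \<in> \<T>" "B = T"
  | T z x where "T \<in> \<T>" "T \<subseteq> G `` {z}" "x \<in> T" "B = insert z (T - {x})"
proof (cases "\<exists>K\<in>quads. B \<subseteq> K")
  case True
  have cB: "card B = 3" using bad_tri[OF B] unfolding cliques_of_size_def by blast
  obtain K where K: "K \<in> quads" "B \<subseteq> K" using True by blast
  obtain T0 where T0: "T0 \<in> cores" "T0 \<subseteq> K" using quad_contains_core[OF K(1)] .
  obtain T x y where T: "T \<in> \<T>" "x \<in> T" "x \<in> T0" "y \<in> T" "y \<in> T0" "x \<noteq> y" using T_max[OF T0(1)] by blast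
  have TK: "T \<subseteq> K" using core_quad[OF _ K(1), of T x y] T T0 T_cores by blast
  have c: "card T = 3" "card K = 4" using T_tri[OF T(1)] K(1) unfolding cliques_of_size_def by auto
  then have fin: "finite T" "finite K" "finite B" using cB by (auto intro: card_ge_0_finite)
  have "card (K - T) = 1" using c fin TK by (simp add: card_Diff_subset)
  then obtain z where z: "K - T = {z}" by (meson card_1_singletonE)
  have Tz: "T \<subseteq> G `` {z}" using clique_edge[OF K(1), of z] z TK by blast
  show thesis
  proof (cases "B = T")
    case True
    then show thesis using that(1) T(1) by blast
  next
    case False
    have "z \<in> B"
    proof (rule ccontr)
      assume "z \<notin> B"
      moreover have "B - T \<subseteq> {z}" using K(2) z by auto
      ultimately have "B \<subseteq> T" by auto
      then show False using False fin cB c by (metis card_subset_eq)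
    qed
    have "card (K - B) = 1" using c cB fin K by (simp add: card_Diff_subset)
    then obtain v where v: "K - B = {v}" by (meson card_1_singletonE)
    have KT: "K = insert z T" using z TK by auto
    have BK: "B = K - {v}" "v \<in> K" using v K(2) by auto
    then have vz: "v \<noteq> z" using \<open>z \<in> B\<close> by blast
    then have "v \<in> T" using BK KT by blast
    moreover have "B = insert z (T - {v})" unfolding BK(1) KT using vz by auto
    ultimately show thesis using that(2)[OF T(1) Tz] by blast
  qed
next
  case False
  then have BC: "B \<in> cores" using bad_outside_quads_core[OF B] by blast
  obtain T a b where T: "T \<in> \<T>" "a \<in> T" "a \<in> B" "b \<in> T" "b \<in> B" "a \<noteq> b" using T_max[OF BC] by blast
  have cB: "card B = 3" using bad_tri[OF B] unfolding cliques_of_size_def by blast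
  obtain c where c: "B = {a, b, c}" "c \<noteq> a" "c \<noteq> b" using card_3_two[OF cB T(3,5,6)] .
  have "B = T"
  proof (rule ccontr)
    assume "B \<noteq> T"
    have cT: "card T = 3" using T_tri[OF T(1)] unfolding cliques_of_size_def by blast
    have cn: "c \<notin> T"
    proof
      assume "c \<in> T"
      then have "B \<subseteq> T" using c T by blast
      then show False using \<open>B \<noteq> T\<close> cB cT by (metis card_subset_eq card_ge_0_finite zero_less_numeral)
    qed
    have "\<not> T \<subseteq> G `` {c}"
    proof
      assume "T \<subseteq> G `` {c}"
      then have "insert c T \<in> quads" using quadI T_tri T(1) by blast
      then show False using False c T by blast
    qed
    then have "light c a"
      using core_partial_light[OF _ cn T(2,4,6)] T_cores T(1) clique_edge[OF bad_tri[OF B]] c by blast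
    then show False using light_not_in_bad[OF _ B] c by blast
  qed
  then show thesis using that(1) T(1) by blast
qed

lemma selected_arcs_cases:
  assumes "(x, y) \<in> selected_arcs"
  obtains "(x, y) \<in> light_arcs" | T where "T \<in> \<T>" "(x, y) \<in> core_arcs T"
  using assms unfolding selected_arcs_def by blast

lemma selected_arcs_sub: "selected_arcs \<subseteq> G"
proof (rule subrelI)
  fix x y assume "(x, y) \<in> selected_arcs"
  then show "(x, y) \<in> G"
    by (cases rule: selected_arcs_cases) (use light_arcs_light light_edge G_sym in \<open>auto simp: core_arcs_def\<close>)
qed

lemma selected_arcs_sym: "(x, y) \<in> selected_arcs \<Longrightarrow> (y, x) \<in> selected_arcs"
  unfolding selected_arcs_def light_arcs_def core_arcs_def by blast

lemma selected_arcs_full: "T \<in> \<T> \<Longrightarrow> T \<subseteq> G `` {z} \<longleftrightarrow> T \<subseteq> selected_arcs `` {z}"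
  using selected_arcs_sub unfolding selected_arcs_def core_arcs_def by blast

lemma selected_arcs_not_in_core: "(x, y) \<in> selected_arcs \<Longrightarrow> T \<in> \<T> \<Longrightarrow> x \<in> T \<Longrightarrow> y \<in> T \<Longrightarrow> False"
  by (elim selected_arcs_cases)
    (use light_arcs_light light_not_in_bad T_cores core_bad core_arcs_not_in_core in blast)+

text \<open>The two core arcs lie in K4s \<open>K\<close> and \<open>L\<close> through
  \<open>z\<close>. A further common vertex of \<open>K\<close> and \<open>L\<close> would be a
  second common neighbour of \<open>x\<close> and \<open>y\<close>; without one, \<open>y\<close>
  and \<open>r\<close> are a tail of \<open>K\<close>.\<close>

lemma light_core_core:
  assumes l: "light x y" and T: "T \<in> \<T>" "(x, z) \<in> core_arcs T" and U: "U \<in> \<T>" "(y, z) \<in> core_arcs U"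
  shows False
proof -
  obtain K where K: "K \<in> quads" "x \<in> K" "z \<in> K" "x \<noteq> z"
    using core_arcs_quad[OF T] by metis
  obtain L where L: "L \<in> quads" "y \<in> L" "z \<in> L" "y \<noteq> z"
    using core_arcs_quad[OF U] by metis
  have y: "y \<notin> K" using quad_not_light[OF K(1,2) _ l] by blast
  have x: "x \<notin> L" using quad_not_light[OF L(1) _ L(2) l] by blast
  have xy: "(x, y) \<in> G" using l light_edge by blast
  have c: "card K = 4" "card L = 4" using K L unfolding cliques_of_size_def by auto
  obtain p q where p: "K = {x, z, p, q}" "p \<noteq> x" "p \<noteq> z" "q \<noteq> x" "q \<noteq> z" "p \<noteq> q"
    using card_4_two[OF c(1) K(2-4)] .
  obtain r s where r: "L = {y, z, r, s}" "r \<noteq> y" "r \<noteq> z" "s \<noteq> y" "s \<noteq> z" "r \<noteq> s"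
    using card_4_two[OF c(2) L(2-4)] .
  note EK = clique_edge[OF K(1)] and EL = clique_edge[OF L(1)]
  show False
  proof (cases "r \<in> K")
    case True
    then have "(x, r) \<in> G" using EK[of x r] K(2) x r(1) by blast
    moreover have "(y, r) \<in> G" "(x, z) \<in> G" "(y, z) \<in> G" using EL EK r K L by auto
    ultimately show False using light_unique[OF l] r(3) by blast
  next
    case False
    have ck: "clique G {x, z, p, q}" using K(1) p(1) unfolding cliques_of_size_def by blast
    have e: "(y, x) \<in> G" "(y, z) \<in> G" "(r, y) \<in> G" "(r, z) \<in> G"
      using xy G_sym EL[OF L(2,3)] EL[of r y] EL[of r z] r L by blast+
    have d: "distinct [x, z, p, q, y, r]" using p r y False K(4) L(4) by auto
    show False using quad_no_tail[OF ck d e] .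
  qed
qed

text \<open>A triangle selects only one light edge, so with one light arc the other two sides are
  core arcs, excluded by \<open>light_core_core\<close>. Without light arcs the triangle is bad,
  hence has two vertices in a selected core, where no arc is selected.\<close>

lemma selected_arcs_triangle_free:
  assumes xy: "(x, y) \<in> selected_arcs" and yz: "(y, z) \<in> selected_arcs" and xz: "(x, z) \<in> selected_arcs"
  shows False
proof -
  have G: "(x, y) \<in> G" "(y, z) \<in> G" "(x, z) \<in> G" using assms selected_arcs_sub by auto
  have ne: "x \<noteq> y" "y \<noteq> z" "x \<noteq> z" using G G_irrefl by blast+
  have one: False if "(a, b) \<in> light_arcs" "(b, c) \<in> selected_arcs" "(a, c) \<in> selected_arcs" "a \<noteq> b" "a \<noteq> c" "b \<noteq> c" for a b c
  proof -
    have g: "(a, b) \<in> G" "(a, c) \<in> G" "(b, c) \<in> G" "(b, a) \<in> G" "(c, a) \<in> G" "(c, b) \<in> G"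
      using that selected_arcs_sub G_sym unfolding selected_arcs_def by blast+
    have 1: "sel {a, b, c} = (a, b) \<or> sel {a, b, c} = (b, a)"
      using light_arcs_sel[OF that(1), of c] g by blast
    have "(b, c) \<notin> light_arcs"
      using light_arcs_sel[of b c a] g 1 that(4-6) by (auto simp: insert_commute)
    moreover have "(a, c) \<notin> light_arcs"
      using light_arcs_sel[of a c b] g 1 that(4-6) by (auto simp: insert_commute)
    ultimately show False
      using light_core_core[OF light_arcs_light[OF that(1)]] that(2,3) by (metis selected_arcs_cases)
  qed
  have "(x, y) \<notin> light_arcs" using one[of x y z] assms ne by blast
  moreover have "(y, z) \<notin> light_arcs" using one[of y z x] assms ne selected_arcs_sym by blast
  moreover have "(x, z) \<notin> light_arcs" using one[of x z y] assms ne selected_arcs_sym by blast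
  ultimately have nl: "\<not> light x y" "\<not> light y z" "\<not> light x z"
    using assms core_arcs_not_light by (metis selected_arcs_cases)+
  have "{x, y, z} \<in> tris" using triI G by blast
  then have "{x, y, z} \<in> bad"
    unfolding bad_def good_def using nl light_sym light_edge G_irrefl by blast
  then obtain T a b where "T \<in> \<T>" "a \<in> T" "b \<in> T" "a \<noteq> b" "a \<in> {x, y, z}" "b \<in> {x, y, z}"
  proof (cases rule: bad_covered)
    case (1 T)
    then show ?thesis using that ne by blast
  next
    case (2 T w v)
    have "card T = 3" using T_tri[OF 2(1)] unfolding cliques_of_size_def by blast
    then have "card (T - {v}) = 2" using 2(3) by simp
    then obtain a b where "T - {v} = {a, b}" "a \<noteq> b" by (meson card_2_iff)
    then show ?thesis using that[OF 2(1), of a b] 2(4) by blast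
  qed
  then show False using selected_arcs_not_in_core[of a b T] assms selected_arcs_sym by blast
qed

end

section \<open>Counting the charged triangles\<close>

context core_selection
begin

lemma finite_good: "finite good" and finite_bad: "finite bad" and finite_T: "finite \<T>"
proof -
  have f: "finite tris" by (rule finite_cliques_of_size)
  show "finite good" using f unfolding good_def by simp
  show b: "finite bad" using f unfolding bad_def by simp
  show "finite \<T>" using T_cores b core_bad by (meson finite_subset subset_iff)
qed

lemma finite_G: "finite G"
  using G_sub finite_V by (meson finite_SigmaI finite_subset)

lemma good_unique:
  assumes "S \<in> good" "S' \<in> good" "light x y" "x \<in> S" "y \<in> S" "x \<in> S'" "y \<in> S'"
  shows "S = S'"
proof -
  have xy: "x \<noteq> y" using assms(3) light_edge G_irrefl by blast
  have t: "S \<in> tris" "S' \<in> tris" "card S = 3" "card S' = 3"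
    using assms(1,2) unfolding good_def cliques_of_size_def by blast+
  obtain w where w: "S = {x, y, w}" "w \<noteq> x" "w \<noteq> y" using card_3_two[OF t(3) assms(4,5) xy] .
  obtain v where v: "S' = {x, y, v}" "v \<noteq> x" "v \<noteq> y" using card_3_two[OF t(4) assms(6,7) xy] .
  have "v = w" using light_unique[OF assms(3), of v w] clique_edge[OF t(1)] clique_edge[OF t(2)] v w by blast
  then show ?thesis using v w by simp
qed

lemma card_light_arcs: "card light_arcs = 2 * card good"
proof -
  have inj: "inj_on sel good"
  proof (rule inj_onI)
    fix S S' assume S: "S \<in> good" "S' \<in> good" "sel S = sel S'"
    then show "S = S'" using good_unique[OF S(1,2)] sel[OF S(1)] sel[OF S(2)] by metis
  qed
  have dis: "sel ` good \<inter> (sel ` good)\<inverse> = {}"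
  proof (rule equals0I)
    fix p assume pp: "p \<in> sel ` good \<inter> (sel ` good)\<inverse>"
    note p = IntD1[OF pp] IntD2[OF pp]
    obtain x y where xy: "p = (x, y)" by (cases p)
    have "(y, x) \<in> sel ` good" using p(2) unfolding xy by simp
    then obtain S' where S': "S' \<in> good" "sel S' = (y, x)" by (metis imageE)
    obtain S where S: "S \<in> good" "sel S = (x, y)" using p(1) unfolding xy by (metis imageE)
    have s: "x \<in> S" "y \<in> S" "light x y" using sel[OF S(1)] S(2) by simp_all
    have s': "x \<in> S'" "y \<in> S'" using sel[OF S'(1)] S'(2) by simp_all
    have "S = S'" using good_unique[OF S(1) S'(1) s(3) s(1,2) s'] .
    then have "x = y" using S(2) S'(2) by (metis prod.inject)
    then show False using s light_edge G_irrefl by blast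
  qed
  have "card light_arcs = card (sel ` good) + card ((sel ` good)\<inverse>)"
    unfolding light_arcs_def using dis finite_good by (intro card_Un_disjoint) auto
  then show ?thesis using card_image[OF inj] by simp
qed

lemma card_core_arcs:
  assumes "T \<in> \<T>"
  shows "card (core_arcs T) = 6 * card {z. T \<subseteq> G `` {z}}"
proof -
  let ?Z = "{z. T \<subseteq> G `` {z}}"
  have cT: "card T = 3" using T_tri[OF assms] unfolding cliques_of_size_def by blast
  then have finT: "finite T" "T \<noteq> {}" by (auto intro: card_ge_0_finite)
  have "?Z \<subseteq> V" using finT(2) G_sub by blast
  then have finZ: "finite ?Z" using finite_V finite_subset by blast
  have "T \<inter> ?Z = {}" using quadI[OF T_tri[OF assms]] by blast
  then have "card (core_arcs T) = card (T \<times> ?Z) + card (?Z \<times> T)"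
    unfolding core_arcs_def using finT finZ by (intro card_Un_disjoint) auto
  then show ?thesis using cT by (simp add: card_cartesian_product)
qed

lemma card_selected_arcs: "card selected_arcs = 2 * card good + (\<Sum>T\<in>\<T>. 6 * card {z. T \<subseteq> G `` {z}})"
proof -
  have finc: "finite (core_arcs T)" if "T \<in> \<T>" for T
    using that selected_arcs_sub finite_G unfolding selected_arcs_def by (meson UN_upper finite_subset le_supE)
  have "card (\<Union>T\<in>\<T>. core_arcs T) = (\<Sum>T\<in>\<T>. card (core_arcs T))"
  proof (rule card_UN_disjoint[OF finite_T])
    show "\<forall>T\<in>\<T>. finite (core_arcs T)" using finc by blast
    show "\<forall>T\<in>\<T>. \<forall>U\<in>\<T>. T \<noteq> U \<longrightarrow> core_arcs T \<inter> core_arcs U = {}"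
    proof (intro ballI impI equals0I)
      fix T U p assume T: "T \<in> \<T>" "U \<in> \<T>" "T \<noteq> U" "p \<in> core_arcs T \<inter> core_arcs U"
      show False using core_arcs_disjoint[OF T(1-3), of "fst p" "snd p"] T(4) by simp
    qed
  qed
  also have "\<dots> = (\<Sum>T\<in>\<T>. 6 * card {z. T \<subseteq> G `` {z}})"
    by (intro sum.cong refl card_core_arcs)
  finally have 1: "card (\<Union>T\<in>\<T>. core_arcs T) = (\<Sum>T\<in>\<T>. 6 * card {z. T \<subseteq> G `` {z}})" .
  have "light_arcs \<inter> (\<Union>T\<in>\<T>. core_arcs T) = {}"
  proof (rule equals0I)
    fix p assume p: "p \<in> light_arcs \<inter> (\<Union>T\<in>\<T>. core_arcs T)"
    then obtain T where T: "T \<in> \<T>" "p \<in> core_arcs T" by blast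
    show False using light_arcs_light[of "fst p" "snd p"] core_arcs_not_light[OF T(1), of "fst p" "snd p"] p T(2) by simp
  qed
  then have "card selected_arcs = card light_arcs + card (\<Union>T\<in>\<T>. core_arcs T)"
    unfolding selected_arcs_def using finite_T finc finite_good
    by (intro card_Un_disjoint finite_UN_I) (simp_all add: light_arcs_def)
  then show ?thesis using 1 card_light_arcs by simp
qed

lemma card_bad: "card bad \<le> (\<Sum>T\<in>\<T>. 1 + 3 * card {z. T \<subseteq> G `` {z}})"
proof -
  let ?Z = "\<lambda>T. {z. T \<subseteq> G `` {z}}"
  let ?B = "\<lambda>T. insert T ((\<lambda>(z, x). insert z (T - {x})) ` (?Z T \<times> T))"
  have fin: "finite (?Z T \<times> T)" "card T = 3" if "T \<in> \<T>" for T
  proof -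
    show cT: "card T = 3" using T_tri[OF that] unfolding cliques_of_size_def by blast
    then have finT: "finite T" "T \<noteq> {}" by (auto intro: card_ge_0_finite)
    have "?Z T \<subseteq> V" using finT(2) G_sub by blast
    then show "finite (?Z T \<times> T)" using finT finite_V finite_subset by blast
  qed
  have "bad \<subseteq> (\<Union>T\<in>\<T>. ?B T)"
  proof
    fix B assume "B \<in> bad"
    then show "B \<in> (\<Union>T\<in>\<T>. ?B T)"
    proof (cases rule: bad_covered)
      case (1 T)
      then show ?thesis by blast
    next
      case (2 T z x)
      then have "B \<in> (\<lambda>(z, x). insert z (T - {x})) ` (?Z T \<times> T)" by (intro image_eqI[of _ _ "(z, x)"]) auto
      then show ?thesis using 2(1) by blast
    qed
  qed
  then have "card bad \<le> card (\<Union>T\<in>\<T>. ?B T)" using finite_T fin by (intro card_mono) auto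
  also have "\<dots> \<le> (\<Sum>T\<in>\<T>. card (?B T))" by (rule card_UN_le[OF finite_T])
  also have "\<dots> \<le> (\<Sum>T\<in>\<T>. 1 + 3 * card (?Z T))"
  proof (rule sum_mono)
    fix T assume T: "T \<in> \<T>"
    have "card (?B T) \<le> Suc (card ((\<lambda>(z, x). insert z (T - {x})) ` (?Z T \<times> T)))"
      using fin(1)[OF T] by (subst card_insert_if) auto
    also have "\<dots> \<le> Suc (card (?Z T \<times> T))" using card_image_le[OF fin(1)[OF T]] by (simp del: card_cartesian_product)
    finally show "card (?B T) \<le> 1 + 3 * card (?Z T)" using fin(2)[OF T] by (simp add: card_cartesian_product mult.commute)
  qed
  finally show ?thesis .
qed

text \<open>A common neighbour of a core accounts for at most three bad triangles and for three
  edges, so only the cores themselves remain uncharged.\<close>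

lemma card_tris: "2 * card tris \<le> card selected_arcs + 2 * card \<T>"
proof -
  have "tris = good \<union> bad" unfolding bad_def good_def by blast
  moreover have "card (good \<union> bad) \<le> card good + card bad" by (rule card_Un_le)
  ultimately have "card tris \<le> card good + card bad" by simp
  moreover have "(\<Sum>T\<in>\<T>. 1 + 3 * card {z. T \<subseteq> G `` {z}}) = card \<T> + (\<Sum>T\<in>\<T>. 3 * card {z. T \<subseteq> G `` {z}})"
    unfolding sum.distrib by simp
  moreover have "(\<Sum>T\<in>\<T>. 6 * card {z. T \<subseteq> G `` {z}}) = 2 * (\<Sum>T\<in>\<T>. 3 * card {z. T \<subseteq> G `` {z}})"
    unfolding sum_distrib_left by (simp add: mult.assoc[symmetric])
  ultimately show ?thesis using card_bad unfolding card_selected_arcs by linarith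
qed

text \<open>The triangle on a light arc selects no other edge, so a second side of it can be
  selected only as a core arc. In an extremal graph this produces missing edges at vertices outside
  all cores.\<close>

lemma selected_arcs_third_vertex:
  assumes "(u, y) \<in> selected_arcs" and n: "\<And>T. T \<in> \<T> \<Longrightarrow> (u, y) \<notin> core_arcs T"
  obtains w where "(u, w) \<in> G" "(y, w) \<in> G" "(w, y) \<in> selected_arcs \<Longrightarrow> \<exists>T\<in>\<T>. (w, y) \<in> core_arcs T"
proof -
  have l: "(u, y) \<in> light_arcs" using assms by (cases rule: selected_arcs_cases) auto
  then obtain w where w: "(u, w) \<in> G" "(y, w) \<in> G" using light_arcs_light unfolding light_def by blast
  have "(w, y) \<notin> light_arcs"
  proof
    assume "(w, y) \<in> light_arcs"
    moreover have "(w, u) \<in> G" "(y, u) \<in> G" using w G_sym l light_arcs_light light_edge by blast+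
    ultimately have "sel {w, y, u} = (w, y) \<or> sel {w, y, u} = (y, w)" using light_arcs_sel by blast
    moreover have "{w, y, u} = {u, y, w}" by blast
    ultimately have "w = u" using light_arcs_sel[OF l w] by (metis prod.inject)
    then show False using w G_irrefl by blast
  qed
  then show ?thesis using that w by (metis selected_arcs_cases)
qed

end

context k5_free_graph
begin

lemma core_selection_exists:
  obtains \<T> sel where "core_selection V G \<T> sel"
proof -
  define F where "F = {\<T>. \<T> \<subseteq> cores \<and>
    (\<forall>T\<in>\<T>. \<forall>U\<in>\<T>. T \<noteq> U \<longrightarrow> (\<forall>x\<in>T \<inter> U. \<forall>y\<in>T \<inter> U. x = y))}"
  have "finite cores" using finite_cliques_of_size unfolding cores_def bad_def by simp
  then have "finite F" unfolding F_def by simp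
  moreover have "{} \<in> F" unfolding F_def by simp
  ultimately obtain \<T> where T: "\<T> \<in> F" "\<And>\<U>. \<U> \<in> F \<Longrightarrow> \<T> \<subseteq> \<U> \<Longrightarrow> \<U> = \<T>"
    using finite_has_maximal2[of F "{}"] by metis
  have max: "\<exists>T\<in>\<T>. \<exists>x\<in>T \<inter> B. \<exists>y\<in>T \<inter> B. x \<noteq> y" if B: "B \<in> cores" for B
  proof (cases "B \<in> \<T>")
    case True
    have "card B = 3" using bad_tri[OF core_bad[OF B]] unfolding cliques_of_size_def by blast
    then obtain x y z where xy: "B = {x, y, z}" "x \<noteq> y" by (auto simp: card_3_iff)
    then have "x \<in> B \<inter> B" "y \<in> B \<inter> B" by simp_all
    then show ?thesis using xy(2) True by (intro bexI[of _ B] bexI[of _ x] bexI[of _ y])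
  next
    case False
    then have "insert B \<T> \<notin> F" using T(2)[of "insert B \<T>"] by blast
    moreover have "insert B \<T> \<subseteq> cores" using T(1) B unfolding F_def by blast
    ultimately obtain U W x y where U: "U \<in> insert B \<T>" "W \<in> insert B \<T>" "U \<noteq> W"
      "x \<in> U \<inter> W" "y \<in> U \<inter> W" "x \<noteq> y" unfolding F_def by blast
    have "\<not> (U \<in> \<T> \<and> W \<in> \<T>)" using T(1) U(3-6) unfolding F_def by blast
    then consider "U = B" "W \<in> \<T>" | "W = B" "U \<in> \<T>" using U(1-3) by blast
    then show ?thesis using U(4-6) by cases blast+
  qed
  have "\<forall>S\<in>good. \<exists>p. fst p \<in> S \<and> snd p \<in> S \<and> light (fst p) (snd p)" unfolding good_def by fastforce
  then obtain sel where "\<forall>S\<in>good. fst (sel S) \<in> S \<and> snd (sel S) \<in> S \<and> light (fst (sel S)) (snd (sel S))"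
    by metis
  note sel = this
  have "core_selection V G \<T> sel"
  proof
    show "\<T> \<subseteq> cores" using T(1) unfolding F_def by blast
    show "x = y" if "T \<in> \<T>" "U \<in> \<T>" "T \<noteq> U" "x \<in> T" "x \<in> U" "y \<in> T" "y \<in> U" for T U x y
      using T(1) that unfolding F_def by blast
  qed (use max sel in blast)+
  then show ?thesis by (rule that)
qed

end

section \<open>From graphs to clique systems\<close>

context p6_free_graph
begin

definition five_arcs :: "('a \<times> 'a) set" where
  "five_arcs = (\<Union>Q\<in>fives. Q \<times> Q)"

lemma k5_free_rest: "k5_free_graph V (G - five_arcs)"
proof
  show "finite V" by (rule finite_V)
  show "G - five_arcs \<subseteq> V \<times> V" using G_sub by blast
  show "(y, x) \<in> G - five_arcs" if "(x, y) \<in> G - five_arcs" for x y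
    using that G_sym unfolding five_arcs_def by blast
  show "(x, x) \<notin> G - five_arcs" for x using G_irrefl by blast
  show False if "distinct [a, b, c, d, e, f]"
    "{(a, b), (a, c), (b, c), (b, d), (c, d), (c, e), (d, e), (d, f), (e, f)} \<subseteq> G - five_arcs" for a b c d e f
    using no_p6[OF that(1)] that(2) by blast
  show "cliques_of_size V (G - five_arcs) 5 = {}"
  proof (rule ccontr)
    assume "cliques_of_size V (G - five_arcs) 5 \<noteq> {}"
    then obtain Q where Q: "Q \<in> cliques_of_size V (G - five_arcs) 5" by blast
    then have "Q \<in> fives" unfolding cliques_of_size_def clique_def by blast
    moreover have "card Q = 5" using Q unfolding cliques_of_size_def by blast
    then have "finite Q" "\<not> card Q \<le> Suc 0" by (simp_all add: card_ge_0_finite)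
    then obtain x y where "x \<in> Q" "y \<in> Q" "x \<noteq> y" by (auto simp: card_le_Suc0_iff_eq)
    ultimately show False using Q unfolding cliques_of_size_def clique_def five_arcs_def by blast
  qed
qed

lemma five_arc_third:
  assumes "(x, y) \<in> five_arcs" "x \<noteq> y" "(x, z) \<in> G" "(y, z) \<in> G"
  shows "\<exists>Q\<in>fives. x \<in> Q \<and> y \<in> Q \<and> z \<in> Q"
proof -
  obtain Q where Q: "Q \<in> fives" "x \<in> Q" "y \<in> Q" using assms(1) unfolding five_arcs_def by blast
  have "z \<in> Q" using five_nbr[OF Q(1) _ Q(2,3) assms(2)] assms(3,4) G_sym by blast
  then show ?thesis using Q by blast
qed

lemma card_tris_fives: "card tris \<le> card (cliques_of_size V (G - five_arcs) 3) + 10 * card fives"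
proof -
  have "tris \<subseteq> cliques_of_size V (G - five_arcs) 3 \<union> (\<Union>Q\<in>fives. {S. S \<subseteq> Q \<and> card S = 3})"
  proof
    fix S assume S: "S \<in> tris"
    show "S \<in> cliques_of_size V (G - five_arcs) 3 \<union> (\<Union>Q\<in>fives. {S. S \<subseteq> Q \<and> card S = 3})"
    proof (cases "S \<in> cliques_of_size V (G - five_arcs) 3")
      case False
      then obtain x y where xy: "x \<in> S" "y \<in> S" "x \<noteq> y" "(x, y) \<in> five_arcs"
        using S unfolding cliques_of_size_def clique_def by blast
      have c: "card S = 3" using S unfolding cliques_of_size_def by blast
      obtain z where z: "S = {x, y, z}" "z \<noteq> x" "z \<noteq> y" using card_3_two[OF c xy(1-3)] .
      then obtain Q where "Q \<in> fives" "S \<subseteq> Q"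
        using five_arc_third[OF xy(4,3), of z] clique_edge[OF S] by blast
      then show ?thesis using c by blast
    qed blast
  qed
  moreover have fin: "finite {S. S \<subseteq> Q \<and> card S = 3}" if "Q \<in> fives" for Q
  proof -
    have "finite Q" using that finite_V finite_subset unfolding cliques_of_size_def by blast
    then show ?thesis by simp
  qed
  ultimately have "card tris \<le> card (cliques_of_size V (G - five_arcs) 3 \<union> (\<Union>Q\<in>fives. {S. S \<subseteq> Q \<and> card S = 3}))"
    using p6_free_graph.finite_cliques_of_size[OF k5_free_graph.axioms(1)[OF k5_free_rest]]
    by (intro card_mono finite_UnI finite_UN_I finite_cliques_of_size)
  also have "\<dots> \<le> card (cliques_of_size V (G - five_arcs) 3) + card (\<Union>Q\<in>fives. {S. S \<subseteq> Q \<and> card S = 3})"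
    by (rule card_Un_le)
  finally have "card tris \<le> card (cliques_of_size V (G - five_arcs) 3) + card (\<Union>Q\<in>fives. {S. S \<subseteq> Q \<and> card S = 3})" .
  moreover have "card (\<Union>Q\<in>fives. {S. S \<subseteq> Q \<and> card S = 3}) \<le> (\<Sum>Q\<in>fives. card {S. S \<subseteq> Q \<and> card S = 3})"
    by (rule card_UN_le[OF finite_cliques_of_size])
  moreover have "(\<Sum>Q\<in>fives. card {S. S \<subseteq> Q \<and> card S = 3}) = (\<Sum>Q\<in>fives. 10)"
  proof (rule sum.cong[OF refl])
    fix Q assume "Q \<in> fives"
    then have "card Q = 5" "finite Q" using finite_V finite_subset unfolding cliques_of_size_def by auto
    then show "card {S. S \<subseteq> Q \<and> card S = 3} = 10" by (simp add: n_subsets numeral_eq_Suc)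
  qed
  ultimately show ?thesis by simp
qed

text \<open>Cores and charged edges are taken in the graph without the arcs of K5s. Adjacency in
  \<open>E\<close> or through a clique is adjacency in \<open>G\<close>, so \<open>near\<close>
  follows from \<open>five_nbr\<close> for K5s and from \<open>core_partial_light\<close> for cores.
  The last clause prepares the extremal case.\<close>

theorem clique_system_exists:
  obtains E \<T> where "clique_system V E (\<T> \<union> fives)"
    "2 * card tris \<le> clique_system.weight2 E (\<T> \<union> fives)"
    "E \<subseteq> G" "\<T> \<subseteq> tris"
    "\<And>u y. (u, y) \<in> E \<Longrightarrow> u \<notin> \<Union>\<T> \<Longrightarrow> y \<notin> \<Union>\<T> \<Longrightarrow>
      \<exists>w. (u, w) \<in> G \<and> (y, w) \<in> G \<and> ((w, y) \<in> E \<longrightarrow> w \<in> \<Union>\<T>)"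
proof -
  let ?H = "G - five_arcs"
  interpret H: k5_free_graph V ?H by (rule k5_free_rest)
  obtain \<T> sel where "core_selection V ?H \<T> sel" using H.core_selection_exists .
  then interpret C: core_selection V ?H \<T> sel .
  define E where "E = C.selected_arcs"
  have EH: "E \<subseteq> ?H" unfolding E_def by (rule C.selected_arcs_sub)
  have TG: "T \<in> tris" if "T \<in> \<T>" for T
    using C.T_tri[OF that] unfolding cliques_of_size_def clique_def by blast
  have T3: "card T = 3" if "T \<in> \<T>" for T using TG[OF that] unfolding cliques_of_size_def by blast
  have Q5: "card Q = 5" if "Q \<in> fives" for Q using that unfolding cliques_of_size_def by blast
  have TQ: "x = y" if T: "T \<in> \<T>" "Q \<in> fives" "x \<in> T" "x \<in> Q" "y \<in> T" "y \<in> Q" for T Q x y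
  proof (rule ccontr)
    assume "x \<noteq> y"
    then have "(x, y) \<in> ?H" using H.clique_edge[OF C.T_tri[OF T(1)]] T by blast
    then show False using T unfolding five_arcs_def by blast
  qed
  have QQ: "x = y" if Q: "Q \<in> fives" "R \<in> fives" "Q \<noteq> R" "x \<in> Q" "x \<in> R" "y \<in> Q" "y \<in> R" for Q R x y
  proof (rule ccontr)
    assume xy: "x \<noteq> y"
    have "\<not> R \<subseteq> Q"
      using Q5[OF Q(1)] Q5[OF Q(2)] Q(3) by (metis card_subset_eq card_ge_0_finite zero_less_numeral)
    then obtain v where v: "v \<in> R" "v \<notin> Q" by blast
    have "(v, x) \<in> G" "(v, y) \<in> G" using clique_edge[OF Q(2)] v Q by blast+
    then show False using five_nbr[OF Q(1) v(2) Q(4,6) xy] by blast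
  qed
  have DG: "(v, x) \<in> G" if "(v, x) \<in> E \<or> (\<exists>L\<in>\<T> \<union> fives. v \<in> L \<and> x \<in> L)" "v \<noteq> x" for v x
    using that EH clique_edge[of _ 3 v x] clique_edge[of _ 5 v x] TG by blast
  have Qfull: False if Q: "Q \<in> fives" "Q \<subseteq> E `` {y}" for Q y
  proof -
    obtain a b where ab: "a \<in> Q" "b \<in> Q" "a \<noteq> b"
    proof -
      have "finite Q" "\<not> card Q \<le> Suc 0" using Q5[OF Q(1)] by (simp_all add: card_ge_0_finite)
      then show thesis using that by (auto simp: card_le_Suc0_iff_eq)
    qed
    have y: "(y, a) \<in> ?H" "(y, b) \<in> ?H" using Q ab EH by blast+
    then have "y \<notin> Q" using Q(1) ab unfolding five_arcs_def by blast
    then show False using five_nbr[OF Q(1) _ ab] y by blast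
  qed
  have sys: "clique_system V E (\<T> \<union> fives)"
  proof
    show "finite V" by (rule finite_V)
    show "E \<subseteq> V \<times> V" using EH G_sub by blast
    show "(y, x) \<in> E" if "(x, y) \<in> E" for x y using that C.selected_arcs_sym unfolding E_def by blast
    show "(x, z) \<notin> E" if "(x, y) \<in> E" "(y, z) \<in> E" for x y z
      using that C.selected_arcs_triangle_free unfolding E_def by blast
    show "K \<subseteq> V" if "K \<in> \<T> \<union> fives" for K using that TG unfolding cliques_of_size_def by blast
    show "3 \<le> card K" "card K \<le> 5" if "K \<in> \<T> \<union> fives" for K using that T3[of K] Q5[of K] by auto
    show "(x, y) \<notin> E" if K: "K \<in> \<T> \<union> fives" "x \<in> K" "y \<in> K" for K x y
      using K(1)
    proof
      assume "K \<in> \<T>"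
      then show ?thesis using C.selected_arcs_not_in_core K(2,3) unfolding E_def by blast
    next
      assume "K \<in> fives"
      then show ?thesis using EH K(2,3) unfolding five_arcs_def by blast
    qed
    show "x = y" if "K \<in> \<T> \<union> fives" "L \<in> \<T> \<union> fives" "K \<noteq> L" "x \<in> K" "x \<in> L" "y \<in> K" "y \<in> L" for K L x y
      using that(1,2) TQ[of K L x y] TQ[of L K x y] QQ[of K L x y] C.T_share[of K L x y] that(3-7) by blast
    show "card K = 3 \<and> K \<subseteq> E `` {v}" if K: "K \<in> \<T> \<union> fives" "v \<notin> K" "x \<in> K" "y \<in> K" "x \<noteq> y"
      and D: "(v, x) \<in> E \<or> (\<exists>L\<in>\<T> \<union> fives. v \<in> L \<and> x \<in> L)"
        "(v, y) \<in> E \<or> (\<exists>L\<in>\<T> \<union> fives. v \<in> L \<and> y \<in> L)" for K v x y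
    proof -
      have vxy: "v \<noteq> x" "v \<noteq> y" using K by blast+
      have g: "(v, x) \<in> G" "(v, y) \<in> G" using DG[OF D(1) vxy(1)] DG[OF D(2) vxy(2)] by blast+
      have KT: "K \<in> \<T>" using K(1) five_nbr[OF _ K(2-5) g] by blast
      have xyH: "(x, y) \<in> ?H" using H.clique_edge[OF C.T_tri[OF KT]] K by blast
      \<comment> \<open>A K5 containing \<open>v\<close> and \<open>a\<close> would by
        \<open>five_arc_third\<close> also contain \<open>b\<close>, but the edge \<open>ab\<close>
        lies in no K5.\<close>
      have gH: "(v, a) \<in> ?H" if a: "(v, a) \<in> G" "(v, b) \<in> G" "(a, b) \<in> ?H" "v \<noteq> a" for a b
      proof -
        have "(v, a) \<notin> five_arcs"
        proof
          assume "(v, a) \<in> five_arcs"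
          then obtain Q where "Q \<in> fives" "a \<in> Q" "b \<in> Q"
            using five_arc_third[of v a b] a by blast
          then show False using a(3) unfolding five_arcs_def by blast
        qed
        then show ?thesis using a(1) by blast
      qed
      have h: "(v, x) \<in> ?H" "(v, y) \<in> ?H"
        using gH[OF g xyH vxy(1)] gH[OF g(2,1) H.G_sym[OF xyH] vxy(2)] by blast+
      have "K \<subseteq> ?H `` {v}"
      proof (rule ccontr)
        assume n: "\<not> K \<subseteq> ?H `` {v}"
        \<comment> \<open>Seeing only part of the core, \<open>v\<close> has light edges to
          \<open>x\<close> and \<open>y\<close>. Both would have to be selected by the one triangle
          \<open>v, x, y\<close>.\<close>
        have core: "K \<in> H.cores" using C.T_cores KT by blast
        have l: "H.light v x" "H.light v y"
          using H.core_partial_light[OF core K(2-5) h n] H.core_partial_light[OF core K(2,4,3) K(5)[symmetric] h(2,1) n]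
          by blast+
        have arc: "(v, a) \<in> C.light_arcs"
          if a: "(v, a) \<in> E \<or> (\<exists>L\<in>\<T> \<union> fives. v \<in> L \<and> a \<in> L)" "(v, a) \<in> ?H" "H.light v a" for a
        proof -
          have "\<not> (v \<in> L \<and> a \<in> L)" if "L \<in> \<T>" for L
            using H.light_not_in_bad[OF a(3)] H.core_bad C.T_cores that by blast
          moreover have "\<not> (v \<in> L \<and> a \<in> L)" if "L \<in> fives" for L
            using a(2) that unfolding five_arcs_def by blast
          ultimately have "(v, a) \<in> C.selected_arcs" using a(1) unfolding E_def by blast
          then show ?thesis using C.core_arcs_not_light a(3) by (metis C.selected_arcs_cases)
        qed
        note vx = arc[OF D(1) h(1) l(1)] and vy = arc[OF D(2) h(2) l(2)]
        have 1: "sel {v, x, y} = (v, x) \<or> sel {v, x, y} = (x, v)" using C.light_arcs_sel[OF vx h(2) xyH] by blast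
        have 2: "sel {v, y, x} = (v, y) \<or> sel {v, y, x} = (y, v)"
          using C.light_arcs_sel[OF vy h(1) H.G_sym[OF xyH]] by blast
        have "{v, y, x} = {v, x, y}" by blast
        then show False using 1 2 K(5) vxy by (metis prod.inject)
      qed
      then have "K \<subseteq> E `` {v}" using C.selected_arcs_full[OF KT] unfolding E_def by blast
      then show ?thesis using T3[OF KT] by blast
    qed
    show "{a, y} \<noteq> {b, z}" if K: "K \<in> \<T> \<union> fives" "L \<in> \<T> \<union> fives" "K \<noteq> L" "a \<in> K" "K \<subseteq> E `` {y}"
      "b \<in> L" "L \<subseteq> E `` {z}" for K L a b y z
    proof
      assume e: "{a, y} = {b, z}"
      have KL: "K \<in> \<T>" "L \<in> \<T>" using K Qfull by blast+
      have "K \<subseteq> ?H `` {y}" "L \<subseteq> ?H `` {z}" using K(5,7) EH by blast+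
      then have ka: "(a, y) \<in> C.core_arcs K" and lb: "(b, z) \<in> C.core_arcs L" "(z, b) \<in> C.core_arcs L"
        using K(4,6) unfolding C.core_arcs_def by blast+
      have "(a, y) = (b, z) \<or> (a, y) = (z, b)" using e by (auto simp: doubleton_eq_iff)
      then have "(a, y) \<in> C.core_arcs L" using lb by metis
      then show False using C.core_arcs_disjoint[OF KL K(3) ka] by blast
    qed
  qed
  interpret S: clique_system V E "\<T> \<union> fives" by (rule sys)
  have "\<T> \<inter> fives = {}" using T3 Q5 by fastforce
  then have "(\<Sum>K\<in>\<T> \<union> fives. card K choose 3) = (\<Sum>K\<in>\<T>. card K choose 3) + (\<Sum>K\<in>fives. card K choose 3)"
    using C.finite_T finite_cliques_of_size by (intro sum.union_disjoint) auto
  also have "(\<Sum>K\<in>\<T>. card K choose 3) = (\<Sum>K\<in>\<T>. 1)" using T3 by (intro sum.cong) simp_all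
  also have "(\<Sum>K\<in>fives. card K choose 3) = (\<Sum>K\<in>fives. 10)" using Q5 by (intro sum.cong) (simp_all add: numeral_eq_Suc)
  finally have "S.weight2 = card E + 2 * card \<T> + 20 * card fives" unfolding S.weight2_def by simp
  then have W: "2 * card tris \<le> S.weight2"
    using card_tris_fives C.card_tris unfolding E_def by linarith
  have third: "\<exists>w. (u, w) \<in> G \<and> (y, w) \<in> G \<and> ((w, y) \<in> E \<longrightarrow> w \<in> \<Union>\<T>)"
    if u: "(u, y) \<in> E" "u \<notin> \<Union>\<T>" "y \<notin> \<Union>\<T>" for u y
  proof -
    have "(u, y) \<notin> C.core_arcs T" if "T \<in> \<T>" for T using that u(2,3) unfolding C.core_arcs_def by blast
    then obtain w where w: "(u, w) \<in> ?H" "(y, w) \<in> ?H" "(w, y) \<in> C.selected_arcs \<Longrightarrow> \<exists>T\<in>\<T>. (w, y) \<in> C.core_arcs T"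
      using C.selected_arcs_third_vertex[of u y] u(1) unfolding E_def by metis
    have "w \<in> \<Union>\<T>" if "(w, y) \<in> E"
      using w(3) that u(3) unfolding E_def C.core_arcs_def by blast
    then show ?thesis using w(1,2) by blast
  qed
  show thesis
    using that[OF sys W _ _ third] EH TG by blast
qed

end

section \<open>The structure of extremal graphs\<close>

text \<open>The multiple of 3 closest to \<open>n / 2\<close>. For \<open>n\<close> congruent to 3
  modulo 6 two are equally close, and the larger one holds one more triangle.\<close>

definition opt_size :: "nat \<Rightarrow> nat" where
  "opt_size n = (if n mod 6 \<in> {0, 1} then n div 2 else if n mod 6 = 2 then n div 2 - 1
     else if n mod 6 \<in> {3, 4} then (n + 1) div 2 + 1 else (n + 1) div 2)"

lemma opt_size_simps:
  "opt_size (6 * k) = 3 * k" "opt_size (6 * k + 1) = 3 * k" "opt_size (6 * k + 2) = 3 * k"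
  "opt_size (6 * k + 3) = 3 * k + 3" "opt_size (6 * k + 4) = 3 * k + 3" "opt_size (6 * k + 5) = 3 * k + 3"
proof -
  have m: "(6 * k) mod 6 = 0" "(6 * k + 1) mod 6 = 1" "(6 * k + 2) mod 6 = 2"
    "(6 * k + 3) mod 6 = 3" "(6 * k + 4) mod 6 = 4" "(6 * k + 5) mod 6 = 5" by (simp_all only: mod_mult_self4) simp_all
  have d: "(6 * k) div 2 = 3 * k" "(6 * k + 1) div 2 = 3 * k" "(6 * k + 2) div 2 = 3 * k + 1"
    "(6 * k + 3 + 1) div 2 = 3 * k + 2" "(6 * k + 4 + 1) div 2 = 3 * k + 2" "(6 * k + 5 + 1) div 2 = 3 * k + 3"
    by simp_all
  show "opt_size (6 * k) = 3 * k" "opt_size (6 * k + 1) = 3 * k" "opt_size (6 * k + 2) = 3 * k"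
    "opt_size (6 * k + 3) = 3 * k + 3" "opt_size (6 * k + 4) = 3 * k + 3" "opt_size (6 * k + 5) = 3 * k + 3"
    unfolding opt_size_def m d by simp_all
qed

lemma square_div_4_simps:
  "(6 * k)\<^sup>2 div 4 = 9 * k * k" "(6 * k + 1)\<^sup>2 div 4 = 9 * k * k + 3 * k" "(6 * k + 2)\<^sup>2 div 4 = 9 * k * k + 6 * k + 1"
  "(6 * k + 3)\<^sup>2 div 4 = 9 * k * k + 9 * k + 2" "(6 * k + 4)\<^sup>2 div 4 = 9 * k * k + 12 * k + 4"
  "(6 * k + 5)\<^sup>2 div 4 = 9 * k * k + 15 * k + (6::nat)"
proof -
  have *: "(r + 2 * (3 * k))\<^sup>2 div 4 = r\<^sup>2 div 4 + 3 * k * (r + 3 * k)" for r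
    by (rule square_div_4_add)
  have **: "(6 * k + r)\<^sup>2 div 4 = r\<^sup>2 div 4 + 3 * k * (r + 3 * k)" for r
    using *[of r] by (simp add: add.commute)
  show "(6 * k)\<^sup>2 div 4 = 9 * k * k" using **[of 0] by simp
  show "(6 * k + 1)\<^sup>2 div 4 = 9 * k * k + 3 * k" unfolding ** by (simp add: algebra_simps)
  show "(6 * k + 2)\<^sup>2 div 4 = 9 * k * k + 6 * k + 1" unfolding ** by (simp add: algebra_simps)
  show "(6 * k + 3)\<^sup>2 div 4 = 9 * k * k + 9 * k + 2" unfolding ** by (simp add: algebra_simps)
  show "(6 * k + 4)\<^sup>2 div 4 = 9 * k * k + 12 * k + 4" unfolding ** by (simp add: algebra_simps)
  show "(6 * k + 5)\<^sup>2 div 4 = 9 * k * k + 15 * k + 6" unfolding ** by (simp add: algebra_simps)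
qed

lemma tri_max_simps:
  "tri_max (6 * k) = 9 * int k * int k + int k"
  "tri_max (6 * k + 1) = 9 * int k * int k + 4 * int k"
  "tri_max (6 * k + 2) = 9 * int k * int k + 7 * int k"
  "tri_max (6 * k + 3) = 9 * int k * int k + 10 * int k + 1"
  "tri_max (6 * k + 4) = 9 * int k * int k + 13 * int k + 4"
  "tri_max (6 * k + 5) = 9 * int k * int k + 16 * int k + 7"
  unfolding tri_max_def g_simps square_div_4_simps by simp_all

lemma opt_size_value:
  assumes "11 \<le> n"
  shows "int (opt_size n * (n - opt_size n) + opt_size n div 3) = tri_max n"
    and "3 dvd opt_size n" and "0 < opt_size n" and "opt_size n < n"
  using assms
  by (cases n rule: mod_6_cases; hypsubst; simp only: opt_size_simps tri_max_simps; simp add: algebra_simps)+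

text \<open>For \<open>n = 6 * k + s\<close> and \<open>p = 3 * (k + d)\<close>, the part of the
  triangle count depending on \<open>d\<close> is \<open>c * d - 9 * d * d\<close> with
  \<open>c = 3 * s + 1\<close>. Only \<open>d = 0\<close> and \<open>d = 1\<close> compete, with
  values 0 and \<open>c - 9\<close>; a tie would need \<open>c = 9\<close>, which is not of this
  form. Hence the uniqueness.\<close>

lemma quadratic_max:
  fixes c d :: int
  assumes "1 \<le> c" "c \<le> 16" "c \<noteq> 9"
  shows "c * d - 9 * d * d \<le> max 0 (c - 9)"
    and "max 0 (c - 9) \<le> c * d - 9 * d * d \<Longrightarrow> d = (if c < 9 then 0 else 1)"
proof -
  define e where "e = c * d - 9 * d * d"
  consider "d \<le> - 1" | "d = 0" | "d = 1" | "2 \<le> d" by linarith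
  then have "e < 0 \<or> d = 0 \<and> e = 0 \<or> d = 1 \<and> e = c - 9"
  proof cases
    case 1
    have "c * d \<le> 1 * d" using assms 1 by (intro mult_right_mono_neg) auto
    moreover have "0 \<le> 9 * d * d" using 1 by (simp add: mult_nonpos_nonpos)
    ultimately show ?thesis using 1 unfolding e_def by linarith
  next
    case 4
    have "c * d \<le> 16 * d" using assms 4 by (intro mult_right_mono) auto
    moreover have "18 * d \<le> 9 * d * d" using 4 by (intro mult_right_mono) auto
    ultimately show ?thesis using 4 unfolding e_def by linarith
  qed (simp_all add: e_def)
  then have "e \<le> max 0 (c - 9) \<and> (max 0 (c - 9) \<le> e \<longrightarrow> d = (if c < 9 then 0 else 1))"
    using assms by auto
  then show "c * d - 9 * d * d \<le> max 0 (c - 9)"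
    and "max 0 (c - 9) \<le> c * d - 9 * d * d \<Longrightarrow> d = (if c < 9 then 0 else 1)" unfolding e_def by blast+
qed

lemma opt_size_unique:
  assumes "3 dvd p" "p + r = n"
  shows "int (p * r + p div 3) \<le> tri_max n"
    and "tri_max n \<le> int (p * r + p div 3) \<Longrightarrow> p = opt_size n"
proof -
  obtain j where p: "p = 3 * j" using assms(1) by blast
  have main: "int (p * r + p div 3) \<le> tri_max n \<and> (tri_max n \<le> int (p * r + p div 3) \<longrightarrow> p = opt_size n)"
    if n: "n = 6 * k + s" "s \<le> 5" and
      t: "tri_max n = 9 * int k * int k + (3 * int s + 1) * int k + max 0 (3 * int s + 1 - 9)" and
      o: "opt_size n = (if 3 * int s + 1 < 9 then 3 * k else 3 * k + 3)" for k s
  proof -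
    define d where "d = int j - int k"
    define c where "c = 3 * int s + 1"
    have j: "int j = int k + d" unfolding d_def by simp
    have r: "int r = 3 * int k + int s - 3 * d"
      using assms(2) n p unfolding d_def by simp
    have "int (p * r + p div 3) = 3 * int j * int r + int j" unfolding p by simp
    also have "\<dots> = 9 * int k * int k + c * int k + (c * d - 9 * d * d)"
      unfolding j r c_def by (simp add: algebra_simps)
    finally have e: "int (p * r + p div 3) = 9 * int k * int k + c * int k + (c * d - 9 * d * d)" .
    have c: "1 \<le> c" "c \<le> 16" "c \<noteq> 9" unfolding c_def using n(2) by presburger+
    have "p = opt_size n" if "d = (if c < 9 then 0 else 1)"
      using that j unfolding o p c_def by (auto split: if_splits)
    then show ?thesis
      using quadratic_max[OF c, of d] unfolding e t c_def[symmetric] by auto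
  qed
  have "int (p * r + p div 3) \<le> tri_max n \<and> (tri_max n \<le> int (p * r + p div 3) \<longrightarrow> p = opt_size n)"
  proof (cases n rule: mod_6_cases)
    case (1 k)
    then show ?thesis using main[of k 0] opt_size_simps(1)[of k] tri_max_simps(1)[of k] by simp
  next
    case (2 k)
    then show ?thesis using main[of k 1] opt_size_simps(2)[of k] tri_max_simps(2)[of k] by simp
  next
    case (3 k)
    then show ?thesis using main[of k 2] opt_size_simps(3)[of k] tri_max_simps(3)[of k] by simp
  next
    case (4 k)
    then show ?thesis using main[of k 3] opt_size_simps(4)[of k] tri_max_simps(4)[of k] by simp
  next
    case (5 k)
    then show ?thesis using main[of k 4] opt_size_simps(5)[of k] tri_max_simps(5)[of k] by simp
  next
    case (6 k)
    then show ?thesis using main[of k 5] opt_size_simps(6)[of k] tri_max_simps(6)[of k] by simp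
  qed
  then show "int (p * r + p div 3) \<le> tri_max n"
    and "tri_max n \<le> int (p * r + p div 3) \<Longrightarrow> p = opt_size n" by blast+
qed

section \<open>The structure forced by equality\<close>

context p6_free_graph
begin

text \<open>Deviations are refuted by two pairs missing from \<open>E\<close>, by a K5, or by a
  squared path through two vertices of \<open>R\<close>.\<close>

theorem extremal_structure:
  assumes n: "11 \<le> card V" and t: "tri_max (card V) \<le> int (card tris)"
  obtains P R \<T> where "P \<union> R = V" "P \<inter> R = {}" "\<Union>\<T> = P" "disjoint \<T>" "\<forall>T\<in>\<T>. card T = 3"
    "G = P \<times> R \<union> R \<times> P \<union> {(x, y). x \<noteq> y \<and> (\<exists>T\<in>\<T>. x \<in> T \<and> y \<in> T)}"
    "card P = opt_size (card V)" "int (card tris) = tri_max (card V)"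
proof -
  obtain E \<T> where sys: "clique_system V E (\<T> \<union> fives)"
    and W: "2 * card tris \<le> clique_system.weight2 E (\<T> \<union> fives)"
    and EG: "E \<subseteq> G" and TT: "\<T> \<subseteq> tris"
    and third: "\<And>u y. (u, y) \<in> E \<Longrightarrow> u \<notin> \<Union>\<T> \<Longrightarrow> y \<notin> \<Union>\<T> \<Longrightarrow>
      \<exists>w. (u, w) \<in> G \<and> (y, w) \<in> G \<and> ((w, y) \<in> E \<longrightarrow> w \<in> \<Union>\<T>)"
    using clique_system_exists by metis
  interpret S: clique_system V E "\<T> \<union> fives" by (rule sys)
  have W2: "2 * tri_max (card V) \<le> int S.weight2" using W t by linarith
  obtain P R where PR: "P \<union> R = V" "P \<inter> R = {}" "E \<subseteq> P \<times> R \<union> R \<times> P" "\<Union>(\<T> \<union> fives) \<subseteq> P"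
    and tri: "\<forall>K\<in>\<T> \<union> fives. card K = 3" and dis: "disjoint (\<T> \<union> fives)"
    by (rule extremal_clique_system[OF sys n W2])
  have nf: "fives = {}"
  proof (rule equals0I)
    fix Q assume "Q \<in> fives"
    then have "card Q = 5" "card Q = 3" using tri unfolding cliques_of_size_def by blast+
    then show False by simp
  qed
  then interpret k5_free_graph V G by unfold_locales
  have TP: "\<Union>\<T> \<subseteq> P" using PR(4) by blast
  have disT: "disjoint \<T>" using dis nf by simp
  have triT: "\<forall>T\<in>\<T>. card T = 3" using tri by blast
  have fin: "finite P" "finite R" using PR(1) finite_V by (metis finite_Un)+
  have cV: "card P + card R = card V" using PR fin by (metis card_Un_disjoint)
  let ?s = "card \<T>" and ?M = "P \<times> R - E"
  have s3: "3 * ?s = card (\<Union>\<T>)" using S.card_disjoint_triples(2)[OF tri dis] TP nf fin by simp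
  then have s: "?s \<le> card P div 3" using card_mono[OF fin(1) TP] by simp
  have finM: "finite ?M" using fin by simp
  have cM: "card P * card R = card (E \<inter> P \<times> R) + card ?M"
    using card_Int_Diff[of "P \<times> R" E] fin by (simp add: card_cartesian_product Int_commute)
  have w: "S.weight2 = 2 * (card (E \<inter> P \<times> R) + ?s)"
    using S.weight2_triples[OF tri] S.bipartite_card_E[OF PR(1-3)] nf by simp
  have le: "tri_max (card V) \<le> int (card (E \<inter> P \<times> R) + ?s)" using W2 unfolding w by simp
  \<comment> \<open>At most one pair of \<open>P \<times> R\<close> is missing, because
    \<open>relaxed_max\<close> is at most \<open>tri_max + 1\<close>.\<close>
  have "int (card P * card R + card P div 3) \<le> tri_max (card V) + 1"
    using product_le_relaxed_max[of "card P" "card R"] relaxed_max_le[of "card V"] unfolding cV by linarith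
  then have q: "card ?M \<le> 1"
    using le s unfolding cM by linarith
  have pair: False if "(a, b) \<in> ?M" "(c, d) \<in> ?M" "(a, b) \<noteq> (c, d)" for a b c d
  proof -
    have "card {(a, b), (c, d)} \<le> card ?M" using finM that by (intro card_mono) auto
    then show False using q that(3) by simp
  qed
  have sq: "2 * card V \<le> (card V)\<^sup>2 div 4"
  proof -
    have "8 * card V \<le> (card V)\<^sup>2" unfolding power2_eq_square using n by (intro mult_right_mono) auto
    then have "8 * card V div 4 \<le> (card V)\<^sup>2 div 4" by (rule div_le_mono)
    then show ?thesis by simp
  qed
  have Tne: "\<T> \<noteq> {}"
  proof
    assume "\<T> = {}"
    then have "tri_max (card V) \<le> int (card P * card R)" using le cM by simp
    also have "\<dots> \<le> int ((card V)\<^sup>2 div 4)"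
      using mult_le_square_div_4[of "card P" "card R"] unfolding cV by (simp only: of_nat_le_iff)
    finally show False using g_pos[OF n] unfolding tri_max_def by simp
  qed
  have R2: "2 \<le> card R"
  proof (rule ccontr)
    assume "\<not> 2 \<le> card R"
    then have "card P * card R \<le> card P * 1" by (intro mult_le_mono2) simp
    then have "card (E \<inter> P \<times> R) + ?s \<le> 2 * card V" using cM s cV by linarith
    then have "int (card (E \<inter> P \<times> R) + ?s) \<le> int ((card V)\<^sup>2 div 4)"
      using sq by (simp only: of_nat_le_iff)
    then show False using le g_pos[OF n] unfolding tri_max_def by simp
  qed
  \<comment> \<open>By \<open>near\<close>, a vertex of \<open>R\<close> missing one vertex of a
    triple misses a second one.\<close>
  have Tfull: "(x, y) \<in> E" if T: "T \<in> \<T>" "x \<in> T" "y \<in> R" for T x y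
  proof (rule ccontr)
    assume xy: "(x, y) \<notin> E"
    have y: "y \<notin> T" using T TP PR(2) by blast
    have c3: "card T = 3" using triT T by blast
    then have "card (T - {x}) = 2" using T(2) by simp
    then obtain u v where uv: "T - {x} = {u, v}" "u \<noteq> v" by (meson card_2_iff)
    then have uvT: "u \<in> T" "v \<in> T" "u \<noteq> x" "v \<noteq> x" by blast+
    have "(u, y) \<notin> E \<or> (v, y) \<notin> E"
    proof (rule ccontr)
      assume "\<not> ((u, y) \<notin> E \<or> (v, y) \<notin> E)"
      then have "(y, u) \<in> E" "(y, v) \<in> E" using S.E_sym by blast+
      then have "T \<subseteq> E `` {y}" using S.near[of T y u v] T y uv uvT by blast
      then show False using T xy S.E_sym by blast
    qed
    then obtain b where b: "b \<in> T" "b \<noteq> x" "(b, y) \<notin> E" using uvT by blast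
    have "(x, y) \<in> ?M" "(b, y) \<in> ?M" using xy b T TP by blast+
    then show False using pair b(2) by blast
  qed
  have Tsub: "T \<in> tris" if "T \<in> \<T>" for T using TT that by blast
  have TnR: "T \<subseteq> G `` {y}" if "T \<in> \<T>" "y \<in> R" for T y
    using Tfull[OF that(1) _ that(2)] EG G_sym by blast
  obtain T0 where T0: "T0 \<in> \<T>" using Tne by blast
  \<comment> \<open>Two adjacent vertices of \<open>R\<close> would form a K5 with
    \<open>T0\<close>.\<close>
  have Rind: "(y, z) \<notin> G" if "y \<in> R" "z \<in> R" for y z
    using no_five[OF Tsub[OF T0] TnR[OF T0 that(1)] TnR[OF T0 that(2)]] by blast
  have other: "\<exists>y'\<in>R. y' \<noteq> y" for y
  proof (rule ccontr)
    assume "\<not> (\<exists>y'\<in>R. y' \<noteq> y)"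
    then have "R \<subseteq> {y}" by blast
    then show False using R2 card_mono[of "{y}" R] by simp
  qed
  \<comment> \<open>Given \<open>u\<close> outside all triples, every \<open>y\<close> in
    \<open>R\<close> misses an edge: either \<open>uy\<close>, or \<open>wy\<close> for the third
    vertex \<open>w\<close> of the triangle charged to \<open>uy\<close>. Two vertices of
    \<open>R\<close> then give two missing pairs.\<close>
  have Punion: "P = \<Union>\<T>"
  proof (rule ccontr)
    assume "P \<noteq> \<Union>\<T>"
    then obtain u where u: "u \<in> P" "u \<notin> \<Union>\<T>" using TP by blast
    have miss: "\<exists>x. (x, y) \<in> ?M" if y: "y \<in> R" for y
    proof (cases "(u, y) \<in> E")
      case False
      then show ?thesis using u y by blast
    next
      case True
      have "y \<notin> \<Union>\<T>" using y TP PR(2) by blast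
      then obtain w where w: "(u, w) \<in> G" "(y, w) \<in> G" "(w, y) \<in> E \<longrightarrow> w \<in> \<Union>\<T>"
        using third[OF True u(2)] by blast
      have wP: "w \<in> P" using Rind[OF y, of w] w(2) G_sub PR(1) by blast
      have "w \<notin> \<Union>\<T>"
      proof
        assume "w \<in> \<Union>\<T>"
        then obtain T where T: "T \<in> \<T>" "w \<in> T" by blast
        have "card (T - {w}) = 2" using triT T by simp
        then obtain b c where bc: "T - {w} = {b, c}" "b \<noteq> c" by (meson card_2_iff)
        then have bcT: "b \<in> T" "c \<in> T" "b \<noteq> w" "c \<noteq> w" by blast+
        obtain y' where y': "y' \<in> R" "y' \<noteq> y" using other by blast
        have uT: "u \<notin> T" using u T by blast
        have TR: "x \<noteq> y \<and> x \<noteq> y'" if "x \<in> P" for x using that y y' PR(2) by blast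
        have "T \<subseteq> P" using T TP by blast
        then have ne: "w \<noteq> y" "w \<noteq> y'" "b \<noteq> y" "b \<noteq> y'" "c \<noteq> y" "c \<noteq> y'" "u \<noteq> y" "u \<noteq> y'"
          using TR bcT T(2) u(1) by blast+
        have ed: "(w, b) \<in> G" "(b, c) \<in> G" "(y, b) \<in> G" "(w, y') \<in> G" "(b, y') \<in> G" "(y', c) \<in> G"
          using clique_edge[OF Tsub[OF T(1)]] bcT T(2) bc(2) TnR[OF T(1) y] TnR[OF T(1) y'(1)] G_sym by blast+
        \<comment> \<open>If \<open>w\<close> lay in a triple \<open>w, b, c\<close>, then
          \<open>u, y, w, b, y', c\<close> would be a squared path.\<close>
        show False
          by (rule no_p6[of u y w b y' c])
            (use ne ed w True EG uT bcT T(2) bc(2) y' in \<open>auto simp: G_commute\<close>)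
      qed
      then have "(w, y) \<notin> E" using w(3) by blast
      then show ?thesis using wP y by blast
    qed
    obtain y where y: "y \<in> R" using other by blast
    obtain y' where y': "y' \<in> R" "y' \<noteq> y" using other by blast
    obtain x x' where "(x, y) \<in> ?M" "(x', y') \<in> ?M" using miss y y' by metis
    then show False using pair y'(2) by blast
  qed
  then have p3: "card P = 3 * ?s" using s3 by simp
  then have dvd: "3 dvd card P" by simp
  have pr: "card P div 3 = ?s" using p3 by simp
  have "int (card (E \<inter> P \<times> R) + ?s) \<le> int (card P * card R + card P div 3)"
    unfolding pr cM by simp
  then have opt: "card P = opt_size (card V)" "int (card P * card R + card P div 3) = tri_max (card V)"
    using opt_size_unique[OF dvd cV] le by linarith+
  have tt: "int (card tris) = tri_max (card V)"
  proof -
    have "card tris \<le> card (E \<inter> P \<times> R) + ?s" using W unfolding w by simp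
    then have "int (card tris) \<le> int (card P * card R + card P div 3)" unfolding pr cM by simp
    then show ?thesis using t opt(2) by linarith
  qed
  have PRG: "P \<times> R \<subseteq> G"
  proof -
    have "card P * card R \<le> card (E \<inter> P \<times> R)" using le opt(2) pr by linarith
    then have "?M = {}" using cM finM by simp
    then show ?thesis using EG by blast
  qed
  \<comment> \<open>An edge between two triples extends to the squared path
    \<open>b, r, x, y, r', c\<close>, with \<open>b\<close> and \<open>c\<close> from the triples of
    \<open>x\<close> and \<open>y\<close> and with \<open>r\<close> and \<open>r'\<close> from
    \<open>R\<close>.\<close>
  have same: "\<exists>T\<in>\<T>. x \<in> T \<and> y \<in> T" if xy: "(x, y) \<in> G" "x \<in> P" "y \<in> P" for x y
  proof (rule ccontr)
    assume no: "\<not> (\<exists>T\<in>\<T>. x \<in> T \<and> y \<in> T)"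
    obtain T U where TU: "T \<in> \<T>" "x \<in> T" "U \<in> \<T>" "y \<in> U" using xy(2,3) Punion by blast
    have TUn: "T \<noteq> U" using no TU by blast
    then have TUd: "T \<inter> U = {}" using disT TU unfolding disjoint_def by blast
    have "card (T - {x}) = 2" using triT TU by simp
    then obtain b b2 where b: "T - {x} = {b, b2}" by (meson card_2_iff)
    have "card (U - {y}) = 2" using triT TU by simp
    then obtain c c2 where c: "U - {y} = {c, c2}" by (meson card_2_iff)
    have bc: "b \<in> T" "b \<noteq> x" "c \<in> U" "c \<noteq> y" using b c by blast+
    obtain r where r: "r \<in> R" using other by blast
    obtain r' where r': "r' \<in> R" "r' \<noteq> r" using other by blast
    have sub: "b \<in> P" "c \<in> P" using bc TU TP by blast+
    have ne: "b \<noteq> r" "b \<noteq> r'" "x \<noteq> r" "x \<noteq> r'" "y \<noteq> r" "y \<noteq> r'" "c \<noteq> r" "c \<noteq> r'"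
      using sub xy(2,3) r r' PR(2) by blast+
    have ne2: "b \<noteq> y" "b \<noteq> c" "x \<noteq> y" "x \<noteq> c" using TUd TU bc by blast+
    have ed: "(b, r) \<in> G" "(x, r) \<in> G" "(y, r) \<in> G" "(x, r') \<in> G" "(y, r') \<in> G" "(c, r') \<in> G"
      using PRG sub xy(2,3) r r' by blast+
    have ed2: "(b, x) \<in> G" "(y, c) \<in> G"
      using clique_edge[OF Tsub[OF TU(1)]] clique_edge[OF Tsub[OF TU(3)]] bc TU by blast+
    show False
      by (rule no_p6[of b r x y r' c]) (use ne ne2 ed ed2 xy(1) bc r' in \<open>auto simp: G_commute\<close>)
  qed
  have Geq: "G = P \<times> R \<union> R \<times> P \<union> {(x, y). x \<noteq> y \<and> (\<exists>T\<in>\<T>. x \<in> T \<and> y \<in> T)}"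
  proof (rule set_eqI)
    fix p :: "'a \<times> 'a"
    obtain x y where p: "p = (x, y)" by (cases p)
    show "p \<in> G \<longleftrightarrow> p \<in> P \<times> R \<union> R \<times> P \<union> {(x, y). x \<noteq> y \<and> (\<exists>T\<in>\<T>. x \<in> T \<and> y \<in> T)}"
    proof
      assume "p \<in> G"
      then have g: "(x, y) \<in> G" unfolding p .
      then have v: "x \<in> P \<union> R" "y \<in> P \<union> R" using G_sub PR(1) by auto
      have "x \<noteq> y" using g G_irrefl by blast
      then show "p \<in> P \<times> R \<union> R \<times> P \<union> {(x, y). x \<noteq> y \<and> (\<exists>T\<in>\<T>. x \<in> T \<and> y \<in> T)}"
        unfolding p using v Rind[of x y] same[of x y] g by auto
    next
      assume "p \<in> P \<times> R \<union> R \<times> P \<union> {(x, y). x \<noteq> y \<and> (\<exists>T\<in>\<T>. x \<in> T \<and> y \<in> T)}"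
      then consider "x \<in> P" "y \<in> R" | "y \<in> P" "x \<in> R" | T where "T \<in> \<T>" "x \<in> T" "y \<in> T" "x \<noteq> y"
        unfolding p by auto
      then show "p \<in> G" unfolding p
      proof cases
        case 1 then show "(x, y) \<in> G" using PRG by blast
      next
        case 2 then show "(x, y) \<in> G" using PRG G_sym by blast
      next
        case 3 then show "(x, y) \<in> G" using clique_edge[OF Tsub] by blast
      qed
    qed
  qed
  show thesis using that[OF PR(1,2) Punion[symmetric] disT triT Geq opt(1) tt] .
qed

end

section \<open>Translation to pair digraphs\<close>

lemma num_triangles_eq:
  assumes "pair_wf_digraph G"
  shows "num_triangles G = card (cliques_of_size (pverts G) (parcs G) 3)"
proof -
  define f where "f = (\<lambda>S :: 'a set. \<lparr> pverts = S, parcs = {(u, v). (u, v) \<in> S \<times> S \<and> u \<noteq> v} \<rparr>)"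
  have "{T :: 'a pair_pre_digraph. subgraph (with_proj T) (with_proj G) \<and> complete_digraph 3 (with_proj T)}
      = f ` cliques_of_size (pverts G) (parcs G) 3" (is "?A = ?B")
  proof (intro equalityI subsetI)
    fix T assume "T \<in> ?A"
    then have T: "subgraph (with_proj T) (with_proj G)" "card (pverts T) = 3"
      "parcs T = {(u, v). (u, v) \<in> pverts T \<times> pverts T \<and> u \<noteq> v}"
      by (simp_all add: complete_digraph_pair_def)
    then have "T = f (pverts T)" unfolding f_def by simp
    moreover have "pverts T \<in> cliques_of_size (pverts G) (parcs G) 3"
      using T unfolding cliques_of_size_def clique_def subgraph_def by auto
    ultimately show "T \<in> ?B" by blast
  next
    fix T assume "T \<in> ?B"
    then obtain S where S: "T = f S" "S \<subseteq> pverts G" "card S = 3" "clique (parcs G) S"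
      unfolding cliques_of_size_def by blast
    have "finite S" using S(3) by (simp add: card_ge_0_finite)
    then have K: "complete_digraph 3 (with_proj T)"
      unfolding complete_digraph_pair_def S(1) f_def using S(3) by simp
    have "wf_digraph (with_proj T)" using K unfolding complete_digraph_def graph_def digraph_def fin_digraph_def by blast
    moreover have "wf_digraph (with_proj G)" using assms by (simp add: wf_digraph_wp_iff)
    ultimately have "subgraph (with_proj T) (with_proj G)"
      unfolding subgraph_def S(1) f_def using S(2,4) by (auto simp: compatible_def clique_def)
    then show "T \<in> ?A" using K by blast
  qed
  moreover have "inj_on f (cliques_of_size (pverts G) (parcs G) 3)" unfolding f_def by (rule inj_onI) simp
  ultimately show ?thesis unfolding num_triangles_def by (simp add: card_image)
qed

text \<open>Arcs are pairs of vertices, so the arc map of an isomorphism is forced by its vertex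
  map.\<close>

lemma digraph_iso_pair_iff:
  "digraph_iso (with_proj A) (with_proj B) \<longleftrightarrow> pair_wf_digraph A \<and>
    (\<exists>\<phi>. inj_on \<phi> (pverts A) \<and> pverts B = \<phi> ` pverts A \<and> parcs B = map_prod \<phi> \<phi> ` parcs A)"
proof
  assume "digraph_iso (with_proj A) (with_proj B)"
  then obtain h where h: "pre_digraph.digraph_isomorphism (with_proj A) h"
    and B: "with_proj B = app_iso h (with_proj A)" unfolding digraph_iso_def by blast
  have B': "pverts B = iso_verts h ` pverts A" "parcs B = iso_arcs h ` parcs A"
    "iso_tail h = fst" "iso_head h = snd"
    using arg_cong[OF B, of verts] arg_cong[OF B, of arcs] arg_cong[OF B, of tail] arg_cong[OF B, of head] by simp_all
  have wf: "wf_digraph (with_proj A)" and inj: "inj_on (iso_verts h) (pverts A)"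
    and arc: "\<And>a. a \<in> parcs A \<Longrightarrow> iso_verts h (fst a) = fst (iso_arcs h a) \<and> iso_verts h (snd a) = snd (iso_arcs h a)"
    using h B' unfolding pre_digraph.digraph_isomorphism_def by simp_all
  have "iso_arcs h a = map_prod (iso_verts h) (iso_verts h) a" if "a \<in> parcs A" for a
    using arc[OF that] by (simp add: map_prod_def split_beta prod_eq_iff)
  then have "parcs B = map_prod (iso_verts h) (iso_verts h) ` parcs A" unfolding B'(2) by (rule image_cong[OF refl])
  then show "pair_wf_digraph A \<and>
    (\<exists>\<phi>. inj_on \<phi> (pverts A) \<and> pverts B = \<phi> ` pverts A \<and> parcs B = map_prod \<phi> \<phi> ` parcs A)"
    using wf inj B'(1) by (auto simp: wf_digraph_wp_iff)
next
  assume "pair_wf_digraph A \<and>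
    (\<exists>\<phi>. inj_on \<phi> (pverts A) \<and> pverts B = \<phi> ` pverts A \<and> parcs B = map_prod \<phi> \<phi> ` parcs A)"
  then obtain \<phi> where wf: "pair_wf_digraph A" and \<phi>: "inj_on \<phi> (pverts A)" "pverts B = \<phi> ` pverts A"
    "parcs B = map_prod \<phi> \<phi> ` parcs A" by blast
  interpret pair_wf_digraph A by (rule wf)
  define h where "h = \<lparr> iso_verts = \<phi>, iso_arcs = map_prod \<phi> \<phi>, iso_head = snd, iso_tail = fst \<rparr>"
  have "inj_on (map_prod \<phi> \<phi>) (parcs A)"
  proof (rule inj_onI)
    fix p q assume pq: "p \<in> parcs A" "q \<in> parcs A" "map_prod \<phi> \<phi> p = map_prod \<phi> \<phi> q"
    have "fst p = fst q" "snd p = snd q"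
      using pq arc_fst_in_verts arc_snd_in_verts inj_onD[OF \<phi>(1)] by (simp_all add: map_prod_def split_beta)
    then show "p = q" by (rule prod_eqI)
  qed
  then have "pre_digraph.digraph_isomorphism (with_proj A) h"
    unfolding pre_digraph.digraph_isomorphism_def h_def using wf \<phi>(1) by (simp add: wf_digraph_wp_iff)
  moreover have "with_proj B = app_iso h (with_proj A)"
    unfolding app_iso_def h_def with_proj_def using \<phi> by simp
  ultimately show "digraph_iso (with_proj A) (with_proj B)" unfolding digraph_iso_def by blast
qed

definition no_path6_square :: "('a \<times> 'a) set \<Rightarrow> bool" where
  "no_path6_square G \<longleftrightarrow> (\<forall>a b c d e f. distinct [a, b, c, d, e, f] \<longrightarrow>
     \<not> {(a, b), (a, c), (b, c), (b, d), (c, d), (c, e), (d, e), (d, f), (e, f)} \<subseteq> G)"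

lemma parcs_square_path6:
  "parcs square_path6 = {(1, 2), (1, 3), (2, 3), (2, 4), (3, 4), (3, 5), (4, 5), (4, 6), (5, 6)}
     \<union> {(2, 1), (3, 1), (3, 2), (4, 2), (4, 3), (5, 3), (5, 4), (6, 4), (6, 5)}"
proof -
  have six: "i = 1 \<or> i = 2 \<or> i = 3 \<or> i = 4 \<or> i = 5 \<or> i = 6" if "i \<in> {1..6}" for i :: nat
    using that by auto
  show ?thesis (is "_ = ?R")
  proof (rule set_eqI)
    fix p :: "nat \<times> nat"
    obtain i j where p: "p = (i, j)" by (cases p)
    show "p \<in> parcs square_path6 \<longleftrightarrow> p \<in> ?R"
    proof
      assume "p \<in> parcs square_path6"
      then have ij: "i \<in> {1..6}" "j \<in> {1..6}" and d: "1 \<le> \<bar>int i - int j\<bar>" "\<bar>int i - int j\<bar> \<le> 2"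
        unfolding p square_path6_def by simp_all
      show "p \<in> ?R" unfolding p
        by (rule disjE[OF six[OF ij(1)]]; (elim disjE)?; rule disjE[OF six[OF ij(2)]]; (elim disjE)?; use d in simp)
    qed (auto simp: square_path6_def)
  qed
qed

lemma pverts_square_path6: "pverts square_path6 = {1, 2, 3, 4, 5, 6}"
  unfolding square_path6_def by auto

lemma free_of_square_path6:
  assumes "pair_wf_digraph G" and sym: "\<And>x y. (x, y) \<in> parcs G \<Longrightarrow> (y, x) \<in> parcs G"
  shows "free_of square_path6 G \<longleftrightarrow> no_path6_square (parcs G)"
proof
  assume free: "free_of square_path6 G"
  show "no_path6_square (parcs G)"
    unfolding no_path6_square_def
  proof (intro allI impI notI)
    fix a b c d e f
    assume dist: "distinct [a, b, c, d, e, f]"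
      and sub: "{(a, b), (a, c), (b, c), (b, d), (c, d), (c, e), (d, e), (d, f), (e, f)} \<subseteq> parcs G"
    define \<phi> where "\<phi> = (\<lambda>i::nat. if i = 1 then a else if i = 2 then b else if i = 3 then c
      else if i = 4 then d else if i = 5 then e else f)"
    define H where "H = \<lparr> pverts = \<phi> ` pverts square_path6, parcs = map_prod \<phi> \<phi> ` parcs square_path6 \<rparr>"
    have inj: "inj_on \<phi> (pverts square_path6)"
      unfolding pverts_square_path6 inj_on_def \<phi>_def using dist by auto
    have wf6: "pair_wf_digraph square_path6"
      by unfold_locales (auto simp: square_path6_def)
    have iso: "digraph_iso (with_proj square_path6) (with_proj H)"
      unfolding digraph_iso_pair_iff using wf6 inj by (auto simp: H_def)
    have arcs: "parcs H \<subseteq> parcs G"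
      unfolding H_def parcs_square_path6 using sub sym by (simp add: \<phi>_def)
    interpret pair_wf_digraph G by (rule assms)
    have verts: "pverts H \<subseteq> pverts G"
      using sub in_arcsD1 in_arcsD2 by (auto simp: H_def pverts_square_path6 \<phi>_def)
    have "pair_wf_digraph H"
      using wf6 unfolding H_def pair_wf_digraph_def by auto
    then have "subgraph (with_proj H) (with_proj G)"
      using arcs verts assms(1) unfolding subgraph_def by (simp add: wf_digraph_wp_iff compatible_def)
    then show False using free iso unfolding free_of_def by blast
  qed
next
  assume no: "no_path6_square (parcs G)"
  show "free_of square_path6 G"
    unfolding free_of_def
  proof
    assume "\<exists>H. subgraph (with_proj H) (with_proj G) \<and> digraph_iso (with_proj square_path6) (with_proj H)"
    then obtain H :: "'a pair_pre_digraph" where sub: "subgraph (with_proj H) (with_proj G)"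
      and iso: "digraph_iso (with_proj square_path6) (with_proj H)" by blast
    obtain \<phi> where \<phi>: "inj_on \<phi> (pverts square_path6)" "parcs H = map_prod \<phi> \<phi> ` parcs square_path6"
      using iso unfolding digraph_iso_pair_iff by blast
    have "parcs H \<subseteq> parcs G" using sub unfolding subgraph_def by simp
    note H = this \<phi>
    have d: "distinct [\<phi> 1, \<phi> 2, \<phi> 3, \<phi> 4, \<phi> 5, \<phi> 6]"
      using H(2) unfolding pverts_square_path6 by (simp add: inj_on_eq_iff)
    have e: "{(\<phi> 1, \<phi> 2), (\<phi> 1, \<phi> 3), (\<phi> 2, \<phi> 3), (\<phi> 2, \<phi> 4), (\<phi> 3, \<phi> 4), (\<phi> 3, \<phi> 5), (\<phi> 4, \<phi> 5),
        (\<phi> 4, \<phi> 6), (\<phi> 5, \<phi> 6)} \<subseteq> parcs G"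
      using H(1) unfolding H(3) parcs_square_path6 by simp
    show False using no[unfolded no_path6_square_def, rule_format, OF d] e by (rule notE)
  qed
qed

lemma pair_graph_sym: "pair_graph G \<Longrightarrow> (x, y) \<in> parcs G \<Longrightarrow> (y, x) \<in> parcs G"
proof -
  assume "pair_graph G" "(x, y) \<in> parcs G"
  then interpret pair_graph G by simp
  show ?thesis
    using symD[OF pair_sym_arcs[unfolded symmetric_def with_proj_simps] \<open>(x, y) \<in> parcs G\<close>] .
qed

lemma p6_free_graph_iff:
  assumes G: "pair_graph G"
  shows "free_of square_path6 G \<longleftrightarrow> p6_free_graph (pverts G) (parcs G)"
proof -
  interpret pair_graph G by (rule G)
  have "p6_free_graph (pverts G) (parcs G) \<longleftrightarrow> no_path6_square (parcs G)"
  proof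
    assume "p6_free_graph (pverts G) (parcs G)"
    then show "no_path6_square (parcs G)"
      unfolding no_path6_square_def by (intro allI impI notI) (rule p6_free_graph.no_p6)
  next
    assume no: "no_path6_square (parcs G)"
    show "p6_free_graph (pverts G) (parcs G)"
    proof
      show "finite (pverts G)" by (rule pair_finite_verts)
      show "parcs G \<subseteq> pverts G \<times> pverts G" using in_arcsD1 in_arcsD2 by auto
      show "(y, x) \<in> parcs G" if "(x, y) \<in> parcs G" for x y using pair_graph_sym[OF G that] .
      show "(x, x) \<notin> parcs G" for x using pair_no_loops by fastforce
      show False if "distinct [a, b, c, d, e, f]"
        "{(a, b), (a, c), (b, c), (b, d), (c, d), (c, e), (d, e), (d, f), (e, f)} \<subseteq> parcs G" for a b c d e f
        using no[unfolded no_path6_square_def, rule_format, OF that(1)] that(2) by (rule notE)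
    qed
  qed
  then show ?thesis
    using free_of_square_path6[OF pair_wf_digraph_axioms pair_graph_sym[OF G]] by blast
qed

text \<open>For the converse of the characterisation: a graph over an arbitrary vertex type inherits
  extremality from the concrete graph on natural numbers.\<close>

lemma iso_transfer:
  assumes A: "pair_graph A" and iso: "digraph_iso (with_proj A) (with_proj B)"
  shows "pair_graph B" and "card (pverts B) = card (pverts A)" and "num_triangles B = num_triangles A"
    and "free_of square_path6 A \<Longrightarrow> free_of square_path6 B"
proof -
  interpret A: pair_graph A by (rule A)
  obtain \<phi> where inj: "inj_on \<phi> (pverts A)" and B: "pverts B = \<phi> ` pverts A" "parcs B = map_prod \<phi> \<phi> ` parcs A"
    using iso unfolding digraph_iso_pair_iff by blast
  have arc: "(\<phi> x, \<phi> y) \<in> parcs B \<longleftrightarrow> (x, y) \<in> parcs A" if "x \<in> pverts A" "y \<in> pverts A" for x y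
  proof
    assume "(\<phi> x, \<phi> y) \<in> parcs B"
    then obtain u v where uv: "(u, v) \<in> parcs A" "\<phi> u = \<phi> x" "\<phi> v = \<phi> y" unfolding B(2) by auto
    then have "u = x" "v = y" using inj_onD[OF inj] that A.in_arcsD1 A.in_arcsD2 by blast+
    then show "(x, y) \<in> parcs A" using uv by blast
  qed (force simp: B)
  have sub: "parcs B \<subseteq> pverts B \<times> pverts B"
    unfolding B using A.in_arcsD1 A.in_arcsD2 by auto
  show gB: "pair_graph B"
  proof
    show "fst e \<in> pverts B" "snd e \<in> pverts B" if "e \<in> parcs B" for e using that sub by auto
    show "finite (pverts B)" "finite (parcs B)" unfolding B using A.pair_finite_verts A.pair_finite_arcs by auto
    show "fst e \<noteq> snd e" if e: "e \<in> parcs B" for e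
    proof -
      obtain x y where "e = (\<phi> x, \<phi> y)" "(x, y) \<in> parcs A" using e unfolding B by auto
      then show ?thesis using A.pair_no_loops[of "(x, y)"] inj_onD[OF inj] A.in_arcsD1 A.in_arcsD2 by auto
    qed
    show "symmetric (with_proj B)"
      unfolding symmetric_def with_proj_simps by (rule symI) (use pair_graph_sym[OF A] in \<open>auto simp: B\<close>)
  qed
  interpret B: pair_graph B by (rule gB)
  show "card (pverts B) = card (pverts A)" unfolding B using inj by (rule card_image)
  have "cliques_of_size (pverts B) (parcs B) 3 = (`) \<phi> ` cliques_of_size (pverts A) (parcs A) 3"
  proof (intro equalityI subsetI)
    fix S assume S: "S \<in> cliques_of_size (pverts B) (parcs B) 3"
    then obtain U where U: "U \<subseteq> pverts A" "S = \<phi> ` U"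
      unfolding cliques_of_size_def B(1) by (auto simp: subset_image_iff)
    have "inj_on \<phi> U" using inj U inj_on_subset by blast
    then have "card U = 3" using S U card_image[of \<phi> U] unfolding cliques_of_size_def by simp
    moreover have "clique (parcs A) U"
      unfolding clique_def
    proof (intro ballI impI)
      fix x y assume xy: "x \<in> U" "y \<in> U" "x \<noteq> y"
      then have "x \<in> pverts A" "y \<in> pverts A" using U by blast+
      moreover have "\<phi> x \<noteq> \<phi> y" using calculation xy(3) inj_onD[OF inj] by blast
      ultimately show "(x, y) \<in> parcs A"
        using arc[of x y] S U(2) xy unfolding cliques_of_size_def clique_def by blast
    qed
    ultimately have "U \<in> cliques_of_size (pverts A) (parcs A) 3" using U(1) unfolding cliques_of_size_def by blast
    then show "S \<in> (`) \<phi> ` cliques_of_size (pverts A) (parcs A) 3" using U(2) by blast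
  next
    fix S assume "S \<in> (`) \<phi> ` cliques_of_size (pverts A) (parcs A) 3"
    then obtain U where U: "U \<subseteq> pverts A" "card U = 3" "clique (parcs A) U" "S = \<phi> ` U"
      unfolding cliques_of_size_def by blast
    have "card S = 3" using U card_image[of \<phi> U] inj_on_subset[OF inj U(1)] by simp
    moreover have "clique (parcs B) S"
      unfolding clique_def
    proof (intro ballI impI)
      fix x y assume xy: "x \<in> S" "y \<in> S" "x \<noteq> y"
      then obtain u v where uv: "x = \<phi> u" "u \<in> U" "y = \<phi> v" "v \<in> U" unfolding U(4) by blast
      have "u \<noteq> v" using uv xy(3) by blast
      then have "(u, v) \<in> parcs A" using U(3) uv unfolding clique_def by blast
      then show "(x, y) \<in> parcs B" unfolding B(2) uv by (force simp: image_iff)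
    qed
    ultimately show "S \<in> cliques_of_size (pverts B) (parcs B) 3"
      using U unfolding cliques_of_size_def B(1) by blast
  qed
  moreover have "inj_on ((`) \<phi>) (cliques_of_size (pverts A) (parcs A) 3)"
    by (rule inj_on_subset[OF inj_on_image_Pow[OF inj]]) (auto simp: cliques_of_size_def)
  ultimately show "num_triangles B = num_triangles A"
    using num_triangles_eq[OF A.pair_wf_digraph_axioms] num_triangles_eq[OF B.pair_wf_digraph_axioms]
    by (simp add: card_image)
  show "free_of square_path6 B" if "free_of square_path6 A"
  proof -
    have no: "no_path6_square (parcs A)"
      using that free_of_square_path6[OF A.pair_wf_digraph_axioms pair_graph_sym[OF A]] by blast
    have "no_path6_square (parcs B)"
      unfolding no_path6_square_def
    proof (intro allI impI notI)
      fix a b c d e f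
      assume dist: "distinct [a, b, c, d, e, f]"
        and e: "{(a, b), (a, c), (b, c), (b, d), (c, d), (c, e), (d, e), (d, f), (e, f)} \<subseteq> parcs B"
      then have "a \<in> pverts B" "b \<in> pverts B" "c \<in> pverts B" "d \<in> pverts B" "e \<in> pverts B" "f \<in> pverts B"
        using sub by auto
      then obtain a' b' c' d' e' f' where im: "a = \<phi> a'" "b = \<phi> b'" "c = \<phi> c'" "d = \<phi> d'" "e = \<phi> e'" "f = \<phi> f'"
        and v: "a' \<in> pverts A" "b' \<in> pverts A" "c' \<in> pverts A" "d' \<in> pverts A" "e' \<in> pverts A" "f' \<in> pverts A"
        unfolding B(1) by blast
      have d': "distinct [a', b', c', d', e', f']" using dist im by auto
      have e': "{(a', b'), (a', c'), (b', c'), (b', d'), (c', d'), (c', e'), (d', e'), (d', f'), (e', f')} \<subseteq> parcs A"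
        using e v unfolding im by (simp add: arc)
      show False using no[unfolded no_path6_square_def, rule_format, OF d'] e' by (rule notE)
    qed
    then show ?thesis using free_of_square_path6[OF B.pair_wf_digraph_axioms pair_graph_sym[OF gB]] by blast
  qed
qed

section \<open>The graphs \<open>H_graph\<close>\<close>

context
  fixes n i :: nat
  assumes dvd: "3 dvd i" and i: "0 < i" "i < n"
begin

lemma pverts_H_graph: "pverts (H_graph n i) = {0..<n}"
  using i unfolding H_graph_def by (auto simp: Let_def)

lemma parcs_H_graph:
  "(x, y) \<in> parcs (H_graph n i) \<longleftrightarrow> (x < i \<and> i \<le> y \<and> y < n) \<or> (y < i \<and> i \<le> x \<and> x < n)
    \<or> (x < i \<and> y < i \<and> x \<noteq> y \<and> x div 3 = y div 3)"
  unfolding H_graph_def by (auto simp: Let_def)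

lemma pair_graph_H_graph: "pair_graph (H_graph n i)"
proof
  have sub: "parcs (H_graph n i) \<subseteq> {0..<n} \<times> {0..<n}" using i by (auto simp: parcs_H_graph)
  show "fst e \<in> pverts (H_graph n i)" "snd e \<in> pverts (H_graph n i)" if "e \<in> parcs (H_graph n i)" for e
    using that sub unfolding pverts_H_graph by auto
  show "finite (pverts (H_graph n i))" unfolding pverts_H_graph by simp
  show "finite (parcs (H_graph n i))" using sub finite_subset by blast
  show "fst e \<noteq> snd e" if e: "e \<in> parcs (H_graph n i)" for e
    using that by (cases e) (auto simp: parcs_H_graph)
  show "symmetric (with_proj (H_graph n i))"
    unfolding symmetric_def with_proj_simps by (rule symI) (auto simp: parcs_H_graph)
qed

lemma pair_wf_digraph_H_graph: "pair_wf_digraph (H_graph n i)"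
  using pair_graph_H_graph unfolding pair_graph_def pair_digraph_def pair_fin_digraph_def by blast

text \<open>Every triangle has at least two vertices in \<open>X\<close>, all of them in the same block of three;
  consecutive triangles of a squared path share two vertices, hence its at least four vertices
  in \<open>X\<close> would all lie in one block.\<close>

lemma free_of_H_graph: "free_of square_path6 (H_graph n i)"
proof -
  let ?G = "parcs (H_graph n i)"
  have "no_path6_square ?G"
    unfolding no_path6_square_def
  proof (intro allI impI notI)
    fix a b c d e f
    assume dist: "distinct [a, b, c, d, e, f]"
      and sub: "{(a, b), (a, c), (b, c), (b, d), (c, d), (c, e), (d, e), (d, f), (e, f)} \<subseteq> ?G"
    have one: "\<not> (i \<le> x \<and> i \<le> y)" if "(x, y) \<in> ?G" for x y using that unfolding parcs_H_graph by auto
    have blk: "x div 3 = y div 3" if "(x, y) \<in> ?G" "x < i" "y < i" for x y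
      using that unfolding parcs_H_graph by auto
    have E: "(a, b) \<in> ?G" "(a, c) \<in> ?G" "(b, c) \<in> ?G" "(b, d) \<in> ?G" "(c, d) \<in> ?G" "(c, e) \<in> ?G" "(d, e) \<in> ?G"
      "(d, f) \<in> ?G" "(e, f) \<in> ?G" using sub by simp_all
    obtain k where k: "\<And>x. x \<in> {a, b, c, d, e, f} \<Longrightarrow> x < i \<Longrightarrow> x div 3 = k"
    proof (cases "c < i")
      case True
      show ?thesis
      proof (rule that[of "c div 3"])
        have c1: "x div 3 = c div 3" if "x \<in> {a, b, c, d, e}" "x < i" for x
          using that True blk[OF E(2)] blk[OF E(3)] blk[OF E(5)] blk[OF E(6)] by auto
        fix x assume x: "x \<in> {a, b, c, d, e, f}" "x < i"
        consider "x = f" | "x \<in> {a, b, c, d, e}" using x by blast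
        then show "x div 3 = c div 3"
        proof cases
          case 1
          have "d < i \<or> e < i" using one[OF E(7)] by linarith
          then show ?thesis using c1[of d] c1[of e] blk[OF E(8)] blk[OF E(9)] x(2) 1 by auto
        qed (use c1 x in blast)
      qed
    next
      case False
      have bd: "b < i" "d < i" using one[OF E(3)] one[OF E(5)] False by linarith+
      show ?thesis
      proof (rule that[of "d div 3"])
        fix x assume x: "x \<in> {a, b, c, d, e, f}" "x < i"
        then show "x div 3 = d div 3"
          using bd False blk[OF E(1)] blk[OF E(4)] blk[OF E(7)] blk[OF E(8)] by auto
      qed
    qed
    let ?A = "{x \<in> {a, b, c, d, e, f}. x < i}" and ?B = "{x \<in> {a, b, c, d, e, f}. i \<le> x}"
    have "?A \<subseteq> {3 * k, 3 * k + 1, 3 * k + 2}"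
    proof
      fix x assume "x \<in> ?A"
      then have "x div 3 = k" using k by blast
      then have x: "x = 3 * k + x mod 3" by auto
      have "x mod 3 < 3" by simp
      then have "x mod 3 = 0 \<or> x mod 3 = 1 \<or> x mod 3 = 2" by linarith
      then have "x = 3 * k \<or> x = 3 * k + 1 \<or> x = 3 * k + 2" using x by (metis add_0_right)
      then show "x \<in> {3 * k, 3 * k + 1, 3 * k + 2}" by blast
    qed
    then have "card ?A \<le> card {3 * k, 3 * k + 1, 3 * k + 2}" by (intro card_mono) auto
    also have "\<dots> \<le> 3" by (simp add: card_insert_if)
    finally have A: "card ?A \<le> 3" .
    \<comment> \<open>\<open>a, b, c\<close> and \<open>d, e, f\<close> are triangles, and each has
      at most one vertex in the independent class; three plus two vertices are fewer than
      six.\<close>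
    have B: "card ?B \<le> 2"
    proof -
      obtain u where u: "{x \<in> {a, b, c}. i \<le> x} \<subseteq> {u}"
        using one[OF E(1)] one[OF E(2)] one[OF E(3)]
        by (intro that[of "if i \<le> a then a else if i \<le> b then b else c"]) auto
      obtain v where v: "{x \<in> {d, e, f}. i \<le> x} \<subseteq> {v}"
        using one[OF E(7)] one[OF E(8)] one[OF E(9)]
        by (intro that[of "if i \<le> d then d else if i \<le> e then e else f"]) auto
      have "?B \<subseteq> {u, v}" using u v by blast
      then have "card ?B \<le> card {u, v}" by (intro card_mono) auto
      then show ?thesis by (rule order_trans) (simp add: card_insert_if)
    qed
    have "W = {x \<in> W. x < i} \<union> {x \<in> W. i \<le> x}" for W by auto
    then have "card {a, b, c, d, e, f} \<le> card ?A + card ?B" by (metis (no_types) card_Un_le)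
    moreover have "card {a, b, c, d, e, f} = 6" using dist by simp
    ultimately show False using A B by linarith
  qed
  then show ?thesis
    using free_of_square_path6[OF pair_wf_digraph_H_graph pair_graph_sym[OF pair_graph_H_graph]] by blast
qed

text \<open>\<open>\<sigma>\<close> rotates each block of three, so the pairs of \<open>x\<close>
  and \<open>\<sigma> x\<close> run through the \<open>i\<close> edges inside \<open>X\<close> once
  each, and each is completed by any vertex of the other class. For the optimal \<open>i\<close> the
  matching upper bound is \<open>num_triangles_le\<close>.\<close>

lemma num_triangles_H_graph_ge: "i * (n - i) + i div 3 \<le> num_triangles (H_graph n i)"
proof -
  define \<sigma> where "\<sigma> = (\<lambda>x::nat. if x mod 3 = 2 then x - 2 else x + 1)"
  have s: "\<sigma> x < i \<and> \<sigma> x \<noteq> x \<and> \<sigma> x div 3 = x div 3 \<and> \<sigma> (\<sigma> x) \<noteq> x" if "x < i" for x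
  proof -
    obtain j where j: "i = 3 * j" using dvd by blast
    define k where "k = x div 3"
    have "x mod 3 < 3" by simp
    then consider "x = 3 * k" | "x = 3 * k + 1" | "x = 3 * k + 2"
      unfolding k_def by (metis add.commute add_0 less_Suc_eq less_one mod_mult_div_eq numeral_2_eq_2 numeral_3_eq_3 One_nat_def)
    moreover have "k < j" using that j unfolding k_def by simp
    ultimately show ?thesis unfolding j \<sigma>_def by cases (simp_all add: mod_Suc div_Suc)
  qed
  let ?C = "cliques_of_size (pverts (H_graph n i)) (parcs (H_graph n i)) 3"
  define f where "f = (\<lambda>(x, y). {x, \<sigma> x, y})"
  define t where "t = (\<lambda>k::nat. {3 * k, 3 * k + 1, 3 * k + 2})"
  let ?A = "f ` ({0..<i} \<times> {i..<n})" and ?B = "t ` {0..<i div 3}"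
  have injf: "inj_on f ({0..<i} \<times> {i..<n})"
  proof (rule inj_onI)
    fix p q assume pq: "p \<in> {0..<i} \<times> {i..<n}" "q \<in> {0..<i} \<times> {i..<n}" "f p = f q"
    obtain x y u v where p: "p = (x, y)" and q: "q = (u, v)" by (metis surj_pair)
    have l: "x < i" "u < i" "i \<le> y" "i \<le> v" using pq p q by auto
    have e: "{x, \<sigma> x, y} = {u, \<sigma> u, v}" using pq(3) unfolding p q f_def by simp
    have ne: "z \<noteq> w" if "z < i" "i \<le> w" for z w using that by linarith
    have yv: "y = v" using e l s[OF l(1)] s[OF l(2)] by (metis insertCI insertE not_less singletonD)
    have "{x, \<sigma> x, y} - {y} = {x, \<sigma> x}" "{u, \<sigma> u, v} - {v} = {u, \<sigma> u}"
      using l s[OF l(1)] s[OF l(2)] by auto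
    then have "{x, \<sigma> x} = {u, \<sigma> u}" using e yv by metis
    then have "x = u" using s[OF l(1)] s[OF l(2)] by (metis doubleton_eq_iff)
    then show "p = q" using p q yv by simp
  qed
  have injt: "inj_on t {0..<i div 3}"
  proof (rule inj_onI)
    fix k l assume "t k = t l"
    then have "Min (t k) = Min (t l)" by simp
    then show "k = l" unfolding t_def by simp
  qed
  have A: "?A \<subseteq> ?C"
  proof
    fix S assume "S \<in> ?A"
    then obtain x y where x: "x < i" "i \<le> y" "y < n" "S = {x, \<sigma> x, y}" unfolding f_def by auto
    have "clique (parcs (H_graph n i)) S" unfolding clique_def x(4) using x(1-3) s[OF x(1)] by (auto simp: parcs_H_graph)
    moreover have "card S = 3" unfolding x(4) using x(1-3) s[OF x(1)] by (auto simp: card_insert_if)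
    ultimately show "S \<in> ?C" unfolding cliques_of_size_def pverts_H_graph using x s[OF x(1)] i by auto
  qed
  have tlt: "t k \<subseteq> {0..<i}" if "k < i div 3" for k unfolding t_def using that by auto
  have B: "?B \<subseteq> ?C"
  proof
    fix S assume "S \<in> ?B"
    then obtain k where k: "k < i div 3" "S = t k" by auto
    have "x div 3 = k" if "x \<in> t k" for x using that unfolding t_def by auto
    then have "clique (parcs (H_graph n i)) S"
      unfolding clique_def k(2) parcs_H_graph using tlt[OF k(1)] by auto
    moreover have "card S = 3" unfolding k(2) t_def by simp
    ultimately show "S \<in> ?C" unfolding cliques_of_size_def pverts_H_graph using tlt[OF k(1)] k(2) i by auto
  qed
  have dis: "?A \<inter> ?B = {}"
  proof (rule equals0I)
    fix S assume S: "S \<in> ?A \<inter> ?B"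
    obtain x y where y: "i \<le> y" "S = {x, \<sigma> x, y}" using IntD1[OF S] unfolding f_def by auto
    obtain k where k: "k < i div 3" "S = t k" using IntD2[OF S] by auto
    have "y \<in> t k" using y(2) k(2) by blast
    then show False using tlt[OF k(1)] y(1) by auto
  qed
  have fin: "finite ?C" unfolding cliques_of_size_def pverts_H_graph by simp
  have "card (?A \<union> ?B) \<le> card ?C" using A B fin by (intro card_mono) auto
  moreover have "card (?A \<union> ?B) = card ?A + card ?B" using dis by (intro card_Un_disjoint) auto
  ultimately have "i * (n - i) + i div 3 \<le> card ?C"
    using card_image[OF injf] card_image[OF injt] by simp
  then show ?thesis using num_triangles_eq[OF pair_wf_digraph_H_graph] by simp
qed

end

section \<open>Recognising the extremal graphs\<close>

lemma iso_H_graph: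
  assumes G: "pair_graph G" and PR: "P \<union> R = pverts G" "P \<inter> R = {}"
    and T: "\<Union>\<T> = P" "disjoint \<T>" "\<forall>T\<in>\<T>. card T = 3"
    and arcs: "parcs G = P \<times> R \<union> R \<times> P \<union> {(x, y). x \<noteq> y \<and> (\<exists>T\<in>\<T>. x \<in> T \<and> y \<in> T)}"
    and p: "3 dvd card P" "0 < card P" "card P < card (pverts G)"
  shows "digraph_iso (with_proj (H_graph (card (pverts G)) (card P))) (with_proj G)"
proof -
  interpret pair_graph G by (rule G)
  let ?n = "card (pverts G)" and ?p = "card P" and ?s = "card \<T>"
  let ?H = "H_graph ?n ?p"
  have fin: "finite P" "finite R" using PR(1) pair_finite_verts by (metis finite_Un)+
  have cV: "?n = ?p + card R" using PR fin by (metis card_Un_disjoint)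
  have finT: "finite \<T>" using T(1) fin(1) by (simp add: finite_UnionD)
  have fT: "finite T" if "T \<in> \<T>" for T using that T(3) by (simp add: card_ge_0_finite)
  have "card (\<Union>\<T>) = (\<Sum>T\<in>\<T>. card T)" using T(2) fT by (simp add: card_Union_disjoint)
  then have ps: "?p = 3 * ?s" using T(1,3) by simp
  obtain h where h: "bij_betw h {0..<?s} \<T>" using ex_bij_betw_nat_finite[OF finT] by blast
  have "\<forall>T\<in>\<T>. \<exists>b. bij_betw b {0..<3::nat} T" using ex_bij_betw_nat_finite fT T(3) by metis
  then obtain b where b: "\<And>T. T \<in> \<T> \<Longrightarrow> bij_betw (b T) {0..<3::nat} T" by metis
  obtain r where r: "bij_betw r {0..<card R} R" using ex_bij_betw_nat_finite[OF fin(2)] by blast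
  \<comment> \<open>\<open>x div 3\<close> is the number of the triple and \<open>x mod 3\<close>
    the position in it, in accordance with the blocks of \<open>H_graph\<close>.\<close>
  define \<phi> where "\<phi> = (\<lambda>x. if x < ?p then b (h (x div 3)) (x mod 3) else r (x - ?p))"
  have hT: "h (x div 3) \<in> \<T>" if "x < ?p" for x
    using that bij_betwE[OF h] unfolding ps by (simp add: less_mult_imp_div_less mult.commute)
  have in_T: "\<phi> x \<in> h (x div 3)" if "x < ?p" for x
    using that bij_betwE[OF b[OF hT[OF that]]] unfolding \<phi>_def by simp
  have in_P: "\<phi> x \<in> P" if "x < ?p" for x using in_T[OF that] hT[OF that] T(1) by blast
  have in_R: "\<phi> x \<in> R" if "?p \<le> x" "x < ?n" for x
    using that bij_betwE[OF r] cV unfolding \<phi>_def by simp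
  have block: "T = h (x div 3)" if "x < ?p" "T \<in> \<T>" "\<phi> x \<in> T" for x T
    using in_T[OF that(1)] hT[OF that(1)] that(2,3) T(2) unfolding disjoint_def by blast
  have h_inj: "x div 3 = y div 3" if "x < ?p" "y < ?p" "h (x div 3) = h (y div 3)" for x y
  proof -
    have "x div 3 \<in> {0..<?s}" "y div 3 \<in> {0..<?s}" using that unfolding ps by (simp_all add: less_mult_imp_div_less mult.commute)
    then show ?thesis using inj_onD[OF bij_betw_imp_inj_on[OF h] that(3)] by blast
  qed
  have inj: "inj_on \<phi> {0..<?n}"
  proof (rule inj_onI)
    fix x y assume xy: "x \<in> {0..<?n}" "y \<in> {0..<?n}" "\<phi> x = \<phi> y"
    consider "x < ?p" "y < ?p" | "x < ?p" "?p \<le> y" | "?p \<le> x" "y < ?p" | "?p \<le> x" "?p \<le> y" by linarith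
    then show "x = y"
    proof cases
      case 1
      have e: "h (x div 3) = h (y div 3)" using block[OF 1(2) hT[OF 1(1)]] in_T[OF 1(1)] xy(3) by simp
      then have "b (h (x div 3)) (x mod 3) = b (h (x div 3)) (y mod 3)" using xy(3) 1 unfolding \<phi>_def by simp
      then have "x mod 3 = y mod 3"
        using inj_onD[OF bij_betw_imp_inj_on[OF b[OF hT[OF 1(1)]]]] by simp
      then show ?thesis using h_inj[OF 1 e] by (metis div_mult_mod_eq)
    next
      case 2
      then show ?thesis using in_P[of x] in_R[of y] xy PR(2) by auto
    next
      case 3
      then show ?thesis using in_P[of y] in_R[of x] xy PR(2) by auto
    next
      case 4
      then have "r (x - ?p) = r (y - ?p)" using xy(3) unfolding \<phi>_def by simp
      then have "x - ?p = y - ?p" using inj_onD[OF bij_betw_imp_inj_on[OF r]] 4 xy(1,2) cV by simp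
      then show ?thesis using 4 by simp
    qed
  qed
  have img: "\<phi> ` {0..<?n} = pverts G"
  proof (rule card_subset_eq[OF pair_finite_verts])
    show "\<phi> ` {0..<?n} \<subseteq> pverts G"
    proof
      fix v assume "v \<in> \<phi> ` {0..<?n}"
      then obtain x where "x < ?n" "v = \<phi> x" by auto
      then show "v \<in> pverts G" using in_P[of x] in_R[of x] PR(1) by (cases "x < ?p") auto
    qed
    show "card (\<phi> ` {0..<?n}) = card (pverts G)" using card_image[OF inj] by simp
  qed
  have vH: "pverts ?H = {0..<?n}" by (rule pverts_H_graph[OF p])
  have arc: "(\<phi> x, \<phi> y) \<in> parcs G \<longleftrightarrow> (x, y) \<in> parcs ?H" if xy: "x < ?n" "y < ?n" for x y
  proof -
    have xP: "\<phi> x \<in> P \<longleftrightarrow> x < ?p" "\<phi> x \<in> R \<longleftrightarrow> ?p \<le> x"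
      using in_P[of x] in_R[of x] xy PR(2) by (meson disjoint_iff not_le)+
    have yP: "\<phi> y \<in> P \<longleftrightarrow> y < ?p" "\<phi> y \<in> R \<longleftrightarrow> ?p \<le> y"
      using in_P[of y] in_R[of y] xy PR(2) by (meson disjoint_iff not_le)+
    have ne: "\<phi> x = \<phi> y \<longleftrightarrow> x = y" using inj_on_eq_iff[OF inj] xy by simp
    have "(\<exists>T\<in>\<T>. \<phi> x \<in> T \<and> \<phi> y \<in> T) \<longleftrightarrow> x < ?p \<and> y < ?p \<and> x div 3 = y div 3"
    proof
      assume "\<exists>T\<in>\<T>. \<phi> x \<in> T \<and> \<phi> y \<in> T"
      then obtain T where T': "T \<in> \<T>" "\<phi> x \<in> T" "\<phi> y \<in> T" by blast
      then have lt: "x < ?p" "y < ?p" using xP(1) yP(1) T(1) by blast+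
      then show "x < ?p \<and> y < ?p \<and> x div 3 = y div 3"
        using block[OF lt(1) T'(1,2)] block[OF lt(2) T'(1,3)] h_inj[OF lt] by simp
    next
      assume lt: "x < ?p \<and> y < ?p \<and> x div 3 = y div 3"
      then show "\<exists>T\<in>\<T>. \<phi> x \<in> T \<and> \<phi> y \<in> T"
        using hT[of x] in_T[of x] in_T[of y] by (intro bexI[of _ "h (x div 3)"]) auto
    qed
    then show ?thesis unfolding arcs parcs_H_graph[OF p] using xP yP ne xy by auto
  qed
  have "parcs G = map_prod \<phi> \<phi> ` parcs ?H"
  proof (intro equalityI subsetI)
    fix q assume q: "q \<in> parcs G"
    obtain u v where uv: "q = (u, v)" by (cases q)
    have "u \<in> \<phi> ` {0..<?n}" "v \<in> \<phi> ` {0..<?n}" unfolding img using q in_arcsD1 in_arcsD2 unfolding uv by blast+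
    then obtain x y where xy: "u = \<phi> x" "x < ?n" "v = \<phi> y" "y < ?n" by auto
    then have "(x, y) \<in> parcs ?H" using arc[OF xy(2,4)] q uv by simp
    then show "q \<in> map_prod \<phi> \<phi> ` parcs ?H" unfolding uv xy by (force simp: image_iff)
  next
    fix q assume "q \<in> map_prod \<phi> \<phi> ` parcs ?H"
    then obtain x y where xy: "q = (\<phi> x, \<phi> y)" "(x, y) \<in> parcs ?H" by auto
    interpret H: pair_graph ?H by (rule pair_graph_H_graph[OF p])
    have "x < ?n" "y < ?n" using H.in_arcsD1[OF xy(2)] H.in_arcsD2[OF xy(2)] unfolding vH by simp_all
    then show "q \<in> parcs G" using arc xy by simp
  qed
  moreover have "pair_wf_digraph ?H"
    by (rule pair_wf_digraph_H_graph[OF p])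
  ultimately show ?thesis
    unfolding digraph_iso_pair_iff using inj img vH by metis
qed

text \<open>\<open>extremal_structure\<close> only assumes that the count reaches
  \<open>tri_max\<close> and concludes equality, so it also contains the upper bound.\<close>

lemma num_triangles_le:
  assumes "11 \<le> n" "graph_on n G" "free_of square_path6 G"
  shows "int (num_triangles G) \<le> tri_max n"
proof -
  have G: "pair_graph G" "card (pverts G) = n" using assms(2) unfolding graph_on_def by auto
  interpret pair_graph G by (rule G)
  interpret P: p6_free_graph "pverts G" "parcs G" using assms(3) p6_free_graph_iff[OF G(1)] by blast
  show ?thesis
  proof (rule ccontr)
    assume "\<not> int (num_triangles G) \<le> tri_max n"
    then have "tri_max n < int (card P.tris)" using num_triangles_eq[OF pair_wf_digraph_axioms] by simp
    then show False using P.extremal_structure[unfolded G(2), OF assms(1)] by (metis less_imp_le order_less_irrefl)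
  qed
qed

lemma H_graph_opt:
  assumes "11 \<le> n"
  shows "graph_on n (H_graph n (opt_size n))" "free_of square_path6 (H_graph n (opt_size n))"
    "int (num_triangles (H_graph n (opt_size n))) = tri_max n"
proof -
  note o = opt_size_value[OF assms]
  show g: "graph_on n (H_graph n (opt_size n))"
    unfolding graph_on_def using pair_graph_H_graph[OF o(2-4)] pverts_H_graph[OF o(2-4)] by simp
  show f: "free_of square_path6 (H_graph n (opt_size n))" by (rule free_of_H_graph[OF o(2-4)])
  have "tri_max n \<le> int (num_triangles (H_graph n (opt_size n)))"
    unfolding o(1)[symmetric] by (rule of_nat_mono[OF num_triangles_H_graph_ge[OF o(2-4)]])
  then show "int (num_triangles (H_graph n (opt_size n))) = tri_max n"
    using num_triangles_le[OF assms g f] by linarith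
qed

lemma ex_K3_square_path6:
  assumes "11 \<le> n"
  shows "int (ex_K3 n square_path6) = tri_max n"
proof -
  let ?S = "{num_triangles G | G :: nat pair_pre_digraph. graph_on n G \<and> free_of square_path6 G}"
  have le: "x \<le> num_triangles (H_graph n (opt_size n))" if x: "x \<in> ?S" for x
  proof -
    obtain G :: "nat pair_pre_digraph" where "x = num_triangles G" "graph_on n G" "free_of square_path6 G" using x by blast
    then have "int x \<le> tri_max n" using num_triangles_le[OF assms] by blast
    then show ?thesis using H_graph_opt(3)[OF assms] by linarith
  qed
  \<comment> \<open>The bound is also what makes the set finite, so that \<open>Max\<close> is
    meaningful.\<close>
  have "?S \<subseteq> {..num_triangles (H_graph n (opt_size n))}" using le by blast
  then have "finite ?S" using finite_subset by blast
  moreover have "num_triangles (H_graph n (opt_size n)) \<in> ?S" using H_graph_opt(1,2)[OF assms] by blast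
  ultimately have "ex_K3 n square_path6 = num_triangles (H_graph n (opt_size n))"
    unfolding ex_K3_def using le by (intro Max_eqI)
  then show ?thesis using H_graph_opt(3)[OF assms] by simp
qed

lemma extremal_K3_iff:
  assumes "11 \<le> n"
  shows "extremal_K3 n square_path6 G \<longleftrightarrow> digraph_iso (with_proj (H_graph n (opt_size n))) (with_proj G)"
proof
  assume ext: "extremal_K3 n square_path6 G"
  then have G: "pair_graph G" "card (pverts G) = n" and free: "free_of square_path6 G"
    and num: "int (num_triangles G) = tri_max n"
    using ex_K3_square_path6[OF assms] unfolding extremal_K3_def graph_on_def by auto
  interpret pair_graph G by (rule G)
  interpret P: p6_free_graph "pverts G" "parcs G" using free p6_free_graph_iff[OF G(1)] by blast
  have t: "tri_max n \<le> int (card P.tris)" using num num_triangles_eq[OF pair_wf_digraph_axioms] by simp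
  obtain P R \<T> where S: "P \<union> R = pverts G" "P \<inter> R = {}" "\<Union>\<T> = P" "disjoint \<T>" "\<forall>T\<in>\<T>. card T = 3"
    "parcs G = P \<times> R \<union> R \<times> P \<union> {(x, y). x \<noteq> y \<and> (\<exists>T\<in>\<T>. x \<in> T \<and> y \<in> T)}" "card P = opt_size n"
    by (rule P.extremal_structure[unfolded G(2), OF assms t])
  show "digraph_iso (with_proj (H_graph n (opt_size n))) (with_proj G)"
    using iso_H_graph[OF G(1) S(1-6)] opt_size_value[OF assms] unfolding G(2) S(7) by blast
next
  assume iso: "digraph_iso (with_proj (H_graph n (opt_size n))) (with_proj G)"
  note H = H_graph_opt[OF assms]
  have "pair_graph (H_graph n (opt_size n))" "card (pverts (H_graph n (opt_size n))) = n"
    using H(1) unfolding graph_on_def by auto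
  then show "extremal_K3 n square_path6 G"
    using iso_transfer[OF _ iso] H ex_K3_square_path6[OF assms]
    unfolding extremal_K3_def graph_on_def by (metis of_nat_eq_iff)
qed

theorem theorem1p11:
  fixes n :: nat
  assumes "n \<ge> 11"
  shows "int (ex_K3 n square_path6) = \<lfloor>(real n)\<^sup>2 / 4\<rfloor> + g n \<and>
    (n mod 6 \<in> {0, 1} \<longrightarrow>
      (\<forall>G :: 'a pair_pre_digraph. extremal_K3 n square_path6 G \<longleftrightarrow>
        digraph_iso (with_proj (H_graph n (nat \<lfloor>real n / 2\<rfloor>))) (with_proj G))) \<and>
    (n mod 6 = 2 \<longrightarrow>
      (\<forall>G :: 'a pair_pre_digraph. extremal_K3 n square_path6 G \<longleftrightarrow>
        digraph_iso (with_proj (H_graph n (nat \<lfloor>real n / 2\<rfloor> - 1))) (with_proj G))) \<and>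
    (n mod 6 \<in> {3, 4} \<longrightarrow>
      (\<forall>G :: 'a pair_pre_digraph. extremal_K3 n square_path6 G \<longleftrightarrow>
        digraph_iso (with_proj (H_graph n (nat \<lceil>real n / 2\<rceil> + 1))) (with_proj G))) \<and>
    (n mod 6 = 5 \<longrightarrow>
      (\<forall>G :: 'a pair_pre_digraph. extremal_K3 n square_path6 G \<longleftrightarrow>
        digraph_iso (with_proj (H_graph n (nat \<lceil>real n / 2\<rceil>))) (with_proj G)))"
proof -
  have "\<lfloor>(real n)\<^sup>2 / 4\<rfloor> = int (n\<^sup>2 div 4)"
    using floor_divide_of_nat_eq[of "n\<^sup>2" 4, where ?'a = real] by simp
  then have ex: "int (ex_K3 n square_path6) = \<lfloor>(real n)\<^sup>2 / 4\<rfloor> + g n"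
    using ex_K3_square_path6[OF assms] unfolding tri_max_def by simp
  have fl: "nat \<lfloor>real n / 2\<rfloor> = n div 2"
    using floor_divide_of_nat_eq[of n 2, where ?'a = real] by simp
  have ce: "nat \<lceil>real n / 2\<rceil> = (n + 1) div 2"
  proof -
    have "\<lceil>real n / 2\<rceil> = int ((n + 1) div 2)"
      by (rule ceiling_unique) (cases "even n"; auto elim!: evenE oddE)+
    then show ?thesis by simp
  qed
  have o: "n mod 6 \<in> {0, 1} \<Longrightarrow> opt_size n = n div 2" "n mod 6 = 2 \<Longrightarrow> opt_size n = n div 2 - 1"
    "n mod 6 \<in> {3, 4} \<Longrightarrow> opt_size n = (n + 1) div 2 + 1" "n mod 6 = 5 \<Longrightarrow> opt_size n = (n + 1) div 2"
    unfolding opt_size_def by auto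
  show ?thesis
    unfolding fl ce
    by (intro conjI impI allI) (simp_all only: ex extremal_K3_iff[OF assms] o)
qed

end
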